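(* Let $r$ be a nonnegative integer. (i) The random structure $D^{(r+2)}(n,(r+1)\ln n/n)$ does not obey the FO 0--1 law. (ii) For any positive integer $k$, $D^{(r+3)}(n,(1+\frac1k+r)\ln n/n)$ does not obey the FO 0--1 law. (iii) For any rational $\beta\in(\frac23,1)$, $\mathrm{FOC}(D^{(r+3)}(n,(\beta+r)\ln n/n))$ is not totally bounded.
   Context: $D^{(d)}(n,p)$ is the random structure on $[n]$ over the signature $\{=,P\}$ with $P$ of arity $d$, in which each of the $n^d$ tuples in $[n]^d$ (including tuples with repeated entries) satisfies $P$ independently with probability $p$. A sequence $(D_n)$ of random structures obeys the FO 0--1 law if for every first order sentence $\varphi$, $\Pr(D_n\models\varphi)$ converges to $0$ or to $1$. $\ell^\infty$: bounded real sequences with sup norm; $c_0$: sequences tending to $0$; $\ell^\infty/c_0$ with norm $\limsup_n|x_n|$ and projection $\pi$. $\mathrm{FOC}(D_n)=\{\pi((\Pr(D_n\models\varphi))_{n}):\varphi\text{ a FO sentence}\}\subset\ell^\infty/c_0$. *)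

theory Defs
  imports "HOL-Probability.Probability"
begin

datatype fo =
    Eq nat nat
  | Rel "nat list"
  | Neg fo
  | Conj fo fo
  | Exi nat fo

primrec fo_vars_free :: "fo \<Rightarrow> nat set" where
  "fo_vars_free (Eq x y) = {x, y}"
| "fo_vars_free (Rel xs) = set xs"
| "fo_vars_free (Neg \<phi>) = fo_vars_free \<phi>"
| "fo_vars_free (Conj \<phi> \<psi>) = fo_vars_free \<phi> \<union> fo_vars_free \<psi>"
| "fo_vars_free (Exi x \<phi>) = fo_vars_free \<phi> - {x}"

primrec fo_arity :: "nat \<Rightarrow> fo \<Rightarrow> bool" where
  "fo_arity d (Eq x y) \<longleftrightarrow> True"
| "fo_arity d (Rel xs) \<longleftrightarrow> length xs = d"
| "fo_arity d (Neg \<phi>) \<longleftrightarrow> fo_arity d \<phi>"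
| "fo_arity d (Conj \<phi> \<psi>) \<longleftrightarrow> fo_arity d \<phi> \<and> fo_arity d \<psi>"
| "fo_arity d (Exi x \<phi>) \<longleftrightarrow> fo_arity d \<phi>"

definition fo_sentence :: "nat \<Rightarrow> fo \<Rightarrow> bool" where
  "fo_sentence d \<phi> \<longleftrightarrow> fo_arity d \<phi> \<and> fo_vars_free \<phi> = {}"

text \<open>A structure is given by its universe and the interpretation of the relation symbol.\<close>

type_synonym 'a struct = "'a set \<times> ('a list \<Rightarrow> bool)"

primrec fo_sat :: "'a struct \<Rightarrow> (nat \<Rightarrow> 'a) \<Rightarrow> fo \<Rightarrow> bool" where
  "fo_sat S e (Eq x y) \<longleftrightarrow> e x = e y"
| "fo_sat S e (Rel xs) \<longleftrightarrow> snd S (map e xs)"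
| "fo_sat S e (Neg \<phi>) \<longleftrightarrow> \<not> fo_sat S e \<phi>"
| "fo_sat S e (Conj \<phi> \<psi>) \<longleftrightarrow> fo_sat S e \<phi> \<and> fo_sat S e \<psi>"
| "fo_sat S e (Exi x \<phi>) \<longleftrightarrow> (\<exists>a\<in>fst S. fo_sat S (e(x := a)) \<phi>)"

text \<open>The satisfaction of a sentence does not depend on the assignment (see
  \<open>models_iff_sat\<close> below), so it is harmless that the assignments are not required to
  take their values in the universe.\<close>

definition models :: "'a struct \<Rightarrow> fo \<Rightarrow> bool" (infix "\<Turnstile>" 50) where
  "S \<Turnstile> \<phi> \<longleftrightarrow> (\<forall>e. fo_sat S e \<phi>)"

lemma fo_sat_cong:
  "(\<And>x. x \<in> fo_vars_free \<phi> \<Longrightarrow> e x = e' x) \<Longrightarrow> fo_sat S e \<phi> \<longleftrightarrow> fo_sat S e' \<phi>"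
proof (induction \<phi> arbitrary: e e')
  case (Rel xs)
  then have "map e xs = map e' xs" by auto
  then show ?case by (simp del: map_eq_conv)
next
  case (Conj \<phi> \<psi>)
  have "fo_sat S e \<phi> \<longleftrightarrow> fo_sat S e' \<phi>" "fo_sat S e \<psi> \<longleftrightarrow> fo_sat S e' \<psi>"
    by (rule Conj.IH; use Conj.prems in auto)+
  then show ?case by simp
next
  case (Exi x \<phi>)
  have "fo_sat S (e(x := a)) \<phi> \<longleftrightarrow> fo_sat S (e'(x := a)) \<phi>" for a
    by (rule Exi.IH) (use Exi.prems in auto)
  then show ?case by simp
next
  case (Neg \<phi>)
  have "fo_sat S e \<phi> \<longleftrightarrow> fo_sat S e' \<phi>"
    by (rule Neg.IH) (use Neg.prems in auto)
  then show ?case by simp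
qed simp

lemma models_iff_sat:
  assumes "fo_sentence d \<phi>"
  shows "S \<Turnstile> \<phi> \<longleftrightarrow> fo_sat S e \<phi>"
proof -
  have "fo_sat S e' \<phi> \<longleftrightarrow> fo_sat S e \<phi>" for e'
    using assms by (intro fo_sat_cong) (simp add: fo_sentence_def)
  then show ?thesis
    unfolding models_def by blast
qed

text \<open>For \<open>p\<close> outside of \<open>[0, 1]\<close>, which can happen for finitely many \<open>n\<close>
  when \<open>p = c * ln n / n\<close>, \<open>bernoulli_pmf\<close> replaces \<open>p\<close> by the nearest point of
  \<open>[0, 1]\<close>.\<close>

definition rand_struct :: "nat \<Rightarrow> nat \<Rightarrow> real \<Rightarrow> nat struct pmf" where
  "rand_struct d n p =
     map_pmf (Pair {1..n})
       (Pi_pmf {xs. length xs = d \<and> set xs \<subseteq> {1..n}} False (\<lambda>_. bernoulli_pmf p))"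

definition pr_models :: "'a struct pmf \<Rightarrow> fo \<Rightarrow> real" where
  "pr_models D \<phi> = measure_pmf.prob D {S. S \<Turnstile> \<phi>}"

definition fo_zero_one_law :: "nat \<Rightarrow> (nat \<Rightarrow> 'a struct pmf) \<Rightarrow> bool" where
  "fo_zero_one_law d D \<longleftrightarrow>
     (\<forall>\<phi>. fo_sentence d \<phi> \<longrightarrow>
        (\<lambda>n. pr_models (D n) \<phi>) \<longlonglongrightarrow> 0 \<or> (\<lambda>n. pr_models (D n) \<phi>) \<longlonglongrightarrow> 1)"

text \<open>Since \<open>nat\<close> is discrete, \<open>nat \<Rightarrow>\<^sub>C real\<close> is the space of all
  bounded real sequences with the supremum norm.\<close>

type_synonym linf = "nat \<Rightarrow>\<^sub>C real"

lemma bcontfun_seq_iff: "(x :: nat \<Rightarrow> real) \<in> bcontfun \<longleftrightarrow> Bseq x"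
proof -
  have "continuous_on UNIV x"
    by simp
  then show ?thesis
    by (auto simp: bcontfun_def Bseq_eq_bounded)
qed

definition c0 :: "linf set" where
  "c0 = {f. apply_bcontfun f \<longlonglongrightarrow> 0}"

lemma c0_zero: "0 \<in> c0"
  by (simp add: c0_def)

lemma c0_add: "f \<in> c0 \<Longrightarrow> g \<in> c0 \<Longrightarrow> f + g \<in> c0"
  using tendsto_add[of "apply_bcontfun f" 0 sequentially "apply_bcontfun g" 0]
  by (simp add: c0_def plus_bcontfun.rep_eq)

lemma c0_scaleR: "f \<in> c0 \<Longrightarrow> r *\<^sub>R f \<in> c0"
  using tendsto_mult_right_zero[of "apply_bcontfun f" sequentially r]
  by (simp add: c0_def scaleR_bcontfun.rep_eq)

lemma c0_minus: "f \<in> c0 \<Longrightarrow> - f \<in> c0"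
  using c0_scaleR[of f "-1"] by simp

lemma c0_diff: "f \<in> c0 \<Longrightarrow> g \<in> c0 \<Longrightarrow> f - g \<in> c0"
  using c0_add[of f "- g"] c0_minus[of g] by simp

quotient_type linf_mod_c0 = "linf" / "\<lambda>f g. f - g \<in> c0"
  morphisms rep_linf_mod_c0 proj_c0
proof (rule equivpI)
  show "reflp (\<lambda>f g :: linf. f - g \<in> c0)"
    by (simp add: reflp_def c0_zero)
  show "symp (\<lambda>f g :: linf. f - g \<in> c0)"
  proof (rule sympI)
    fix f g :: linf
    assume "f - g \<in> c0"
    from c0_minus[OF this] show "g - f \<in> c0" by simp
  qed
  show "transp (\<lambda>f g :: linf. f - g \<in> c0)"
  proof (rule transpI)
    fix f g h :: linf
    assume "f - g \<in> c0" "g - h \<in> c0"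
    from c0_add[OF this] show "f - h \<in> c0" by simp
  qed
qed

definition limsup_norm :: "linf \<Rightarrow> real" where
  "limsup_norm f = real_of_ereal (limsup (\<lambda>n. ereal \<bar>apply_bcontfun f n\<bar>))"

lemma limsup_norm_bounds:
  "0 \<le> limsup (\<lambda>n. ereal \<bar>apply_bcontfun f n\<bar>)"
  "limsup (\<lambda>n. ereal \<bar>apply_bcontfun f n\<bar>) \<le> ereal (norm f)"
proof -
  have "0 \<le> liminf (\<lambda>n. ereal \<bar>apply_bcontfun f n\<bar>)"
    by (rule Liminf_bounded) simp
  also have "\<dots> \<le> limsup (\<lambda>n. ereal \<bar>apply_bcontfun f n\<bar>)"
    by (rule Liminf_le_Limsup) simp
  finally show "0 \<le> limsup (\<lambda>n. ereal \<bar>apply_bcontfun f n\<bar>)" .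
  have "\<bar>apply_bcontfun f n\<bar> \<le> norm f" for n
    using norm_bounded[of f n] by simp
  then show "limsup (\<lambda>n. ereal \<bar>apply_bcontfun f n\<bar>) \<le> ereal (norm f)"
    by (intro Limsup_bounded) simp
qed

lemma ereal_limsup_norm:
  "ereal (limsup_norm f) = limsup (\<lambda>n. ereal \<bar>apply_bcontfun f n\<bar>)"
proof -
  have "\<bar>limsup (\<lambda>n. ereal \<bar>apply_bcontfun f n\<bar>)\<bar> \<noteq> \<infinity>"
    using limsup_norm_bounds[of f] by auto
  then show ?thesis
    by (simp add: limsup_norm_def ereal_real)
qed

lemma limsup_norm_nonneg: "0 \<le> limsup_norm f"
  using limsup_norm_bounds(1)[of f, folded ereal_limsup_norm] by simp

lemma limsup_norm_eq_0_iff: "limsup_norm f = 0 \<longleftrightarrow> f \<in> c0"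
proof
  assume "limsup_norm f = 0"
  then have lim: "limsup (\<lambda>n. ereal \<bar>apply_bcontfun f n\<bar>) = 0"
    using ereal_limsup_norm[of f] by (simp add: zero_ereal_def)
  have "0 \<le> liminf (\<lambda>n. ereal \<bar>apply_bcontfun f n\<bar>)"
    by (rule Liminf_bounded) simp
  moreover have "liminf (\<lambda>n. ereal \<bar>apply_bcontfun f n\<bar>) \<le> 0"
    using Liminf_le_Limsup[of sequentially "\<lambda>n. ereal \<bar>apply_bcontfun f n\<bar>"] lim by simp
  ultimately have "(\<lambda>n. ereal \<bar>apply_bcontfun f n\<bar>) \<longlonglongrightarrow> ereal 0"
    using lim by (intro Liminf_eq_Limsup) (auto simp: zero_ereal_def)
  then have "(\<lambda>n. \<bar>apply_bcontfun f n\<bar>) \<longlonglongrightarrow> 0"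
    by (simp only: lim_ereal)
  then show "f \<in> c0"
    by (simp add: c0_def tendsto_rabs_zero_iff)
next
  assume "f \<in> c0"
  then have "(\<lambda>n. \<bar>apply_bcontfun f n\<bar>) \<longlonglongrightarrow> 0"
    by (simp add: c0_def tendsto_rabs_zero_iff)
  then have "(\<lambda>n. ereal \<bar>apply_bcontfun f n\<bar>) \<longlonglongrightarrow> ereal 0"
    by (simp only: lim_ereal)
  then have "limsup (\<lambda>n. ereal \<bar>apply_bcontfun f n\<bar>) = ereal 0"
    by (intro lim_imp_Limsup) simp_all
  then show "limsup_norm f = 0"
    using ereal_limsup_norm[of f] by simp
qed

lemma limsup_norm_triangle: "limsup_norm (f + g) \<le> limsup_norm f + limsup_norm g"
proof -
  have "ereal (limsup_norm (f + g))
      \<le> limsup (\<lambda>n. ereal \<bar>apply_bcontfun f n\<bar> + ereal \<bar>apply_bcontfun g n\<bar>)"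
    unfolding ereal_limsup_norm
    by (intro Limsup_mono always_eventually) (auto simp: plus_bcontfun.rep_eq)
  also have "\<dots> \<le> ereal (limsup_norm f) + ereal (limsup_norm g)"
    unfolding ereal_limsup_norm by (rule ereal_limsup_add_mono)
  finally show ?thesis by simp
qed

lemma limsup_norm_scaleR: "limsup_norm (r *\<^sub>R f) = \<bar>r\<bar> * limsup_norm f"
proof -
  have "ereal (limsup_norm (r *\<^sub>R f)) = limsup (\<lambda>n. ereal \<bar>r\<bar> * ereal \<bar>apply_bcontfun f n\<bar>)"
    unfolding ereal_limsup_norm by (simp add: scaleR_bcontfun.rep_eq abs_mult)
  also have "\<dots> = ereal \<bar>r\<bar> * ereal (limsup_norm f)"
    unfolding ereal_limsup_norm by (subst limsup_ereal_mult_left) auto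
  finally show ?thesis by simp
qed

lemma limsup_norm_cong:
  assumes "f - g \<in> c0"
  shows "limsup_norm f = limsup_norm g"
proof -
  have "limsup_norm (f - g) = 0" "limsup_norm (g - f) = 0"
    using assms c0_minus[OF assms] by (simp_all add: limsup_norm_eq_0_iff)
  then show ?thesis
    using limsup_norm_triangle[of "f - g" g] limsup_norm_triangle[of "g - f" f] by simp
qed

instantiation linf_mod_c0 :: real_vector
begin

lift_definition zero_linf_mod_c0 :: linf_mod_c0 is 0 .

lift_definition plus_linf_mod_c0 :: "linf_mod_c0 \<Rightarrow> linf_mod_c0 \<Rightarrow> linf_mod_c0" is "(+)"
proof -
  fix f f' g g' :: linf
  assume "f - f' \<in> c0" "g - g' \<in> c0"
  from c0_add[OF this] show "f + g - (f' + g') \<in> c0"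
    by (simp add: algebra_simps)
qed

lift_definition uminus_linf_mod_c0 :: "linf_mod_c0 \<Rightarrow> linf_mod_c0" is uminus
proof -
  fix f f' :: linf
  assume "f - f' \<in> c0"
  from c0_minus[OF this] show "- f - - f' \<in> c0"
    by simp
qed

lift_definition minus_linf_mod_c0 :: "linf_mod_c0 \<Rightarrow> linf_mod_c0 \<Rightarrow> linf_mod_c0" is "(-)"
proof -
  fix f f' g g' :: linf
  assume "f - f' \<in> c0" "g - g' \<in> c0"
  from c0_diff[OF this] show "f - g - (f' - g') \<in> c0"
    by (simp add: algebra_simps)
qed

lift_definition scaleR_linf_mod_c0 :: "real \<Rightarrow> linf_mod_c0 \<Rightarrow> linf_mod_c0" is scaleR
proof -
  fix r and f f' :: linf
  assume "f - f' \<in> c0"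
  from c0_scaleR[OF this] show "r *\<^sub>R f - r *\<^sub>R f' \<in> c0"
    by (simp add: scaleR_diff_right)
qed

instance
proof
  fix x y z :: linf_mod_c0 and a b :: real
  show "x + y + z = x + (y + z)" "x + y = y + x" "0 + x = x" "- x + x = 0" "x - y = x + - y"
    by (transfer, simp add: c0_zero algebra_simps)+
  show "a *\<^sub>R (x + y) = a *\<^sub>R x + a *\<^sub>R y" "(a + b) *\<^sub>R x = a *\<^sub>R x + b *\<^sub>R x"
    "a *\<^sub>R b *\<^sub>R x = (a * b) *\<^sub>R x" "1 *\<^sub>R x = x"
    by (transfer, simp add: c0_zero algebra_simps)+
qed

end

instantiation linf_mod_c0 :: real_normed_vector
begin

lift_definition norm_linf_mod_c0 :: "linf_mod_c0 \<Rightarrow> real" is limsup_norm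
  by (rule limsup_norm_cong)

definition dist_linf_mod_c0 :: "linf_mod_c0 \<Rightarrow> linf_mod_c0 \<Rightarrow> real" where
  "dist_linf_mod_c0 x y = norm (x - y)"

definition sgn_linf_mod_c0 :: "linf_mod_c0 \<Rightarrow> linf_mod_c0" where
  "sgn_linf_mod_c0 x = x /\<^sub>R norm x"

definition uniformity_linf_mod_c0 :: "(linf_mod_c0 \<times> linf_mod_c0) filter" where
  "uniformity_linf_mod_c0 = (INF e\<in>{0 <..}. principal {(x, y). dist x y < e})"

definition open_linf_mod_c0 :: "linf_mod_c0 set \<Rightarrow> bool" where
  "open_linf_mod_c0 S = (\<forall>x\<in>S. \<forall>\<^sub>F (x', y) in uniformity. x' = x \<longrightarrow> y \<in> S)"

instance
proof
  fix x y :: linf_mod_c0 and a :: real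
  show "norm x = 0 \<longleftrightarrow> x = 0"
    by transfer (simp add: limsup_norm_eq_0_iff)
  show "norm (x + y) \<le> norm x + norm y"
    by transfer (rule limsup_norm_triangle)
  show "norm (a *\<^sub>R x) = \<bar>a\<bar> * norm x"
    by transfer (rule limsup_norm_scaleR)
qed (rule dist_linf_mod_c0_def sgn_linf_mod_c0_def uniformity_linf_mod_c0_def open_linf_mod_c0_def)+

end

lemma Bseq_pr_models: "Bseq (\<lambda>n. pr_models (D n) \<phi>)"
  by (rule BseqI'[where K = 1]) (simp add: pr_models_def)

definition FOC :: "nat \<Rightarrow> (nat \<Rightarrow> 'a struct pmf) \<Rightarrow> linf_mod_c0 set" where
  "FOC d D = {proj_c0 (Bcontfun (\<lambda>n. pr_models (D n) \<phi>)) | \<phi>. fo_sentence d \<phi>}"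

lemma apply_Bcontfun_pr_models:
  fixes D :: "nat \<Rightarrow> 'a struct pmf"
  shows "apply_bcontfun (Bcontfun (\<lambda>n. pr_models (D n) \<phi>)) = (\<lambda>n. pr_models (D n) \<phi>)"
  by (rule Bcontfun_inverse) (simp only: bcontfun_seq_iff Bseq_pr_models)

end

theory Submission
  imports Defs "HOL-Real_Asymp.Real_Asymp"
begin

text \<open>
  Call a tuple isolated if none of its one-element extensions satisfies \<open>P\<close>. Distinct tuples are
  isolated independently, and \<open>p = c ln n / n\<close> makes the probability of this about \<open>n\<close> to the power
  \<open>- c\<close>. So for (i) the number of isolated tuples has mean about 1. For (ii) and (iii),
  quantifying away \<open>r\<close> coordinates of an isolated tuple leaves a directed graph with independent
  arcs of density about \<open>n\<close> to the power \<open>- \<beta>\<close>, where \<open>\<beta> = 1 + 1/k\<close> in (ii). There, the mean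
  number of vertices with \<open>k\<close> out-neighbours is bounded and bounded away from 0.

  For (iii), with \<open>\<beta> < 1\<close>, start from a vertex \<open>b\<close> and repeatedly either replace a set by its
  in-neighbourhood (its size is multiplied by \<open>n\<close> to the power \<open>1 - \<beta>\<close>) or intersect it with the
  out-neighbourhood of a parameter (factor \<open>n\<close> to the power \<open>- \<beta>\<close>). Modulo 1 each step
  rotates the exponent by \<open>1 - \<beta>\<close>, so for rational \<open>\<beta>\<close> one reaches a set of size about \<open>n\<close> to the
  power \<open>\<beta>\<close>, whose in-neighbourhood has constant density. Thus every vertex \<open>w\<close> codes a subset of
  any given small set \<open>B\<close>, all subsets occur, and each of them has so many codes that some tuple
  has as its extensions exactly one code for each member of a given small family of subsets.
  Everything needed for this is a property of the random
  graph which holds for all sets at once by a union bound. So first order sentences can speak about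
  subsets of small sets \<open>B\<close> and about small families of such subsets. They can express that the size
  of \<open>B\<close> belongs to a sequence of tower growth at an index divisible by \<open>k\<close> and that \<open>B\<close> has no
  exponentially larger companion. Since \<open>B\<close> has at most \<open>log n\<close> elements if all its subsets are
  coded, while all sets of size a small power of \<open>log n\<close> are fully coded, the index \<open>l\<close> of the
  largest such \<open>B\<close> is determined for suitable \<open>n\<close>. There the \<open>k\<close>-th sentence holds asymptotically
  almost surely if \<open>k\<close> divides \<open>l\<close> and fails asymptotically almost surely otherwise.
\<close>

section \<open>First order definability\<close>

text \<open>The tower grows by \<open>m + 2 ^ m\<close> because a set and a copy of its power set
  are kept as disjoint parts of one \<open>B\<close>: relations are encoded by two-element sets,
  which forget the order of a pair unless its two sides are disjoint. Families of up to
  \<open>t ^ 2\<close> subsets are needed since such a relation can have that many pairs. What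
  limits \<open>t\<close> is the passage from codes to neighbourhoods. A row meets
  \<open>t ^ 2\<close> prescribed classes of codes and nothing else with probability about
  \<open>n\<close> to the power \<open>- (\<beta> + r)\<close> times
  \<open>exp (- c * t ^ 3)\<close>; there are \<open>n ^ (r + 2)\<close> rows and up to about
  \<open>2 ^ (n * t ^ 2)\<close> families of classes. The union bound works because
  \<open>2 - \<beta> > 1\<close> and \<open>t ^ 3\<close> is small against \<open>ln n\<close>;
  hence \<open>t\<close> is about \<open>ln n powr (1 / 8)\<close>. At
  \<open>n = critical_size l\<close>, a coded tower of index below \<open>l\<close> has a companion,
  one of index \<open>l\<close> is too large to have one, and one of index \<open>l + 1\<close> is
  too large to be coded. Of two distinct positive numbers one does not divide the other, so any two
  of the sentences differ in probability by at least 1/2 at infinitely many such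
  \<open>n\<close>.\<close>

definition definable :: "nat \<Rightarrow> nat \<Rightarrow> ('a struct \<Rightarrow> 'a list \<Rightarrow> bool) \<Rightarrow> bool" where
  "definable d N \<Phi> \<longleftrightarrow> (\<forall>vs. length vs = N \<longrightarrow>
     (\<exists>\<phi>. fo_arity d \<phi> \<and> fo_vars_free \<phi> \<subseteq> set vs \<and> (\<forall>S e. fo_sat S e \<phi> \<longleftrightarrow> \<Phi> S (map e vs))))"

text \<open>A term is a position in the list of values of the context. Quantifiers push the new
  value to the front, so \<open>hd\<close> is the innermost variable and each \<open>tl\<close>
  moves outwards by one quantifier.\<close>

definition var_proj :: "nat \<Rightarrow> ('a list \<Rightarrow> 'a) \<Rightarrow> bool" where
  "var_proj N p \<longleftrightarrow> (\<exists>i<N. \<forall>xs. length xs = N \<longrightarrow> p xs = xs ! i)"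

definition vars_proj :: "nat \<Rightarrow> nat \<Rightarrow> ('a list \<Rightarrow> 'a list) \<Rightarrow> bool" where
  "vars_proj N m ps \<longleftrightarrow>
     (\<exists>is. length is = m \<and> set is \<subseteq> {..<N} \<and> (\<forall>xs. length xs = N \<longrightarrow> ps xs = map ((!) xs) is))"

named_theorems definable_intros

lemma var_proj_hd [definable_intros]: "var_proj (Suc N) hd"
  unfolding var_proj_def by (rule exI[of _ 0]) (auto simp: length_Suc_conv)

lemma var_proj_tl [definable_intros]: "var_proj N p \<Longrightarrow> var_proj (Suc N) (\<lambda>xs. p (tl xs))"
  unfolding var_proj_def
proof (elim exE conjE)
  fix i assume "i < N" "\<forall>xs. length xs = N \<longrightarrow> p xs = xs ! i"
  then show "\<exists>i<Suc N. \<forall>xs. length xs = Suc N \<longrightarrow> p (tl xs) = xs ! i"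
    by (intro exI[of _ "Suc i"]) (auto simp: nth_tl)
qed

lemma vars_proj_tl [definable_intros]: "vars_proj N m p \<Longrightarrow> vars_proj (Suc N) m (\<lambda>xs. p (tl xs))"
  unfolding vars_proj_def
proof (elim exE conjE)
  fix "is" assume *: "length is = m" "set is \<subseteq> {..<N}" "\<forall>xs. length xs = N \<longrightarrow> p xs = map ((!) xs) is"
  show "\<exists>is. length is = m \<and> set is \<subseteq> {..<Suc N} \<and> (\<forall>xs. length xs = Suc N \<longrightarrow> p (tl xs) = map ((!) xs) is)"
    by (rule exI[of _ "map Suc is"]) (use * in \<open>auto simp: nth_tl subset_iff\<close>)
qed

lemma vars_proj_take [definable_intros]: "vars_proj (m + N) m (take m)"
  unfolding vars_proj_def
  by (rule exI[of _ "[0..<m]"]) (auto intro: nth_equalityI)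

lemma var_proj_drop [definable_intros]: "var_proj N p \<Longrightarrow> var_proj (m + N) (\<lambda>xs. p (drop m xs))"
  unfolding var_proj_def
proof (elim exE conjE)
  fix i assume "i < N" "\<forall>xs. length xs = N \<longrightarrow> p xs = xs ! i"
  then show "\<exists>i<m + N. \<forall>xs. length xs = m + N \<longrightarrow> p (drop m xs) = xs ! i"
    by (intro exI[of _ "m + i"]) auto
qed

lemma vars_proj_drop [definable_intros]: "vars_proj N k p \<Longrightarrow> vars_proj (m + N) k (\<lambda>xs. p (drop m xs))"
  unfolding vars_proj_def
proof (elim exE conjE)
  fix "is" assume *: "length is = k" "set is \<subseteq> {..<N}" "\<forall>xs. length xs = N \<longrightarrow> p xs = map ((!) xs) is"
  show "\<exists>is. length is = k \<and> set is \<subseteq> {..<m + N} \<and> (\<forall>xs. length xs = m + N \<longrightarrow> p (drop m xs) = map ((!) xs) is)"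
    by (rule exI[of _ "map ((+) m) is"]) (use * in \<open>auto simp: subset_iff\<close>)
qed

lemma vars_proj_Nil [definable_intros]: "vars_proj N 0 (\<lambda>xs. [])"
  unfolding vars_proj_def by simp

lemma vars_proj_Cons [definable_intros]:
  "var_proj N p \<Longrightarrow> vars_proj N m ps \<Longrightarrow> vars_proj N (Suc m) (\<lambda>xs. p xs # ps xs)"
  unfolding vars_proj_def var_proj_def
proof (elim exE conjE)
  fix i "is" assume *: "length is = m" "set is \<subseteq> {..<N}" "\<forall>xs. length xs = N \<longrightarrow> ps xs = map ((!) xs) is"
     "i < N" "\<forall>xs. length xs = N \<longrightarrow> p xs = xs ! i"
  show "\<exists>is. length is = Suc m \<and> set is \<subseteq> {..<N} \<and> (\<forall>xs. length xs = N \<longrightarrow> p xs # ps xs = map ((!) xs) is)"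
    by (rule exI[of _ "i # is"]) (use * in auto)
qed

lemma vars_proj_append:
  "vars_proj N k ps \<Longrightarrow> vars_proj N m qs \<Longrightarrow> vars_proj N (k + m) (\<lambda>xs. ps xs @ qs xs)"
  unfolding vars_proj_def
proof (elim exE conjE)
  fix "is" js assume *: "length is = k" "set is \<subseteq> {..<N}" "\<forall>xs. length xs = N \<longrightarrow> ps xs = map ((!) xs) is"
     "length js = m" "set js \<subseteq> {..<N}" "\<forall>xs. length xs = N \<longrightarrow> qs xs = map ((!) xs) js"
  show "\<exists>is. length is = k + m \<and> set is \<subseteq> {..<N} \<and> (\<forall>xs. length xs = N \<longrightarrow> ps xs @ qs xs = map ((!) xs) is)"
    by (rule exI[of _ "is @ js"]) (use * in auto)
qed

lemma var_proj_nth: "vars_proj N m ps \<Longrightarrow> i < m \<Longrightarrow> var_proj N (\<lambda>xs. ps xs ! i)"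
  unfolding vars_proj_def var_proj_def
proof (elim exE conjE)
  fix "is" assume *: "length is = m" "set is \<subseteq> {..<N}" "\<forall>xs. length xs = N \<longrightarrow> ps xs = map ((!) xs) is" "i < m"
  show "\<exists>j<N. \<forall>xs. length xs = N \<longrightarrow> ps xs ! i = xs ! j"
    by (rule exI[of _ "is ! i"]) (use * in \<open>auto simp: subset_iff\<close>)
qed

lemma definable_cong:
  assumes "definable d N \<Phi>" "\<And>S xs. length xs = N \<Longrightarrow> \<Phi> S xs \<longleftrightarrow> \<Psi> S xs"
  shows "definable d N \<Psi>"
  using assms(1) unfolding definable_def by (simp add: assms(2))

lemma definable_eq [definable_intros]:
  assumes "var_proj N p" "var_proj N q"
  shows "definable d N (\<lambda>S xs. p xs = q xs)"
proof -
  obtain i j where *: "i < N" "\<forall>xs. length xs = N \<longrightarrow> p xs = xs ! i"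
    "j < N" "\<forall>xs. length xs = N \<longrightarrow> q xs = xs ! j"
    using assms unfolding var_proj_def by blast
  show ?thesis
    unfolding definable_def
  proof (intro allI impI)
    fix vs :: "nat list" assume "length vs = N"
    then show "\<exists>\<phi>. fo_arity d \<phi> \<and> fo_vars_free \<phi> \<subseteq> set vs \<and> (\<forall>S e. fo_sat S e \<phi> \<longleftrightarrow> p (map e vs) = q (map e vs))"
      by (intro exI[of _ "Eq (vs ! i) (vs ! j)"]) (use * in auto)
  qed
qed

lemma definable_rel [definable_intros]:
  assumes "vars_proj N d ps"
  shows "definable d N (\<lambda>S xs. snd S (ps xs))"
proof -
  obtain "is" where *: "length is = d" "set is \<subseteq> {..<N}" "\<forall>xs. length xs = N \<longrightarrow> ps xs = map ((!) xs) is"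
    using assms unfolding vars_proj_def by blast
  show ?thesis
    unfolding definable_def
  proof (intro allI impI)
    fix vs :: "nat list" assume vs: "length vs = N"
    then have eq: "map ((!) (map e vs)) is = map e (map ((!) vs) is)" for e :: "nat \<Rightarrow> 'a"
      using *(2) by (auto simp: subset_iff)
    show "\<exists>\<phi>. fo_arity d \<phi> \<and> fo_vars_free \<phi> \<subseteq> set vs \<and> (\<forall>S e. fo_sat S e \<phi> \<longleftrightarrow> snd S (ps (map e vs)))"
      by (rule exI[of _ "Rel (map ((!) vs) is)"]) (use * vs eq in \<open>auto simp: subset_iff simp del: map_map\<close>)
  qed
qed

lemma definable_not [definable_intros]:
  assumes "definable d N \<Phi>" shows "definable d N (\<lambda>S xs. \<not> \<Phi> S xs)"
  unfolding definable_def
proof (intro allI impI)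
  fix vs :: "nat list" assume "length vs = N"
  then obtain \<phi> where "fo_arity d \<phi>" "fo_vars_free \<phi> \<subseteq> set vs" "\<forall>S e. fo_sat S e \<phi> \<longleftrightarrow> \<Phi> S (map e vs)"
    using assms unfolding definable_def by blast
  then show "\<exists>\<phi>. fo_arity d \<phi> \<and> fo_vars_free \<phi> \<subseteq> set vs \<and> (\<forall>S e. fo_sat S e \<phi> \<longleftrightarrow> \<not> \<Phi> S (map e vs))"
    by (intro exI[of _ "Neg \<phi>"]) auto
qed

lemma definable_conj [definable_intros]:
  assumes "definable d N \<Phi>" "definable d N \<Psi>" shows "definable d N (\<lambda>S xs. \<Phi> S xs \<and> \<Psi> S xs)"
  unfolding definable_def
proof (intro allI impI)
  fix vs :: "nat list" assume vs: "length vs = N"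
  obtain \<phi> where "fo_arity d \<phi>" "fo_vars_free \<phi> \<subseteq> set vs" "\<forall>S e. fo_sat S e \<phi> \<longleftrightarrow> \<Phi> S (map e vs)"
    using assms(1) vs unfolding definable_def by blast
  moreover obtain \<psi> where "fo_arity d \<psi>" "fo_vars_free \<psi> \<subseteq> set vs" "\<forall>S e. fo_sat S e \<psi> \<longleftrightarrow> \<Psi> S (map e vs)"
    using assms(2) vs unfolding definable_def by blast
  ultimately show "\<exists>\<phi>. fo_arity d \<phi> \<and> fo_vars_free \<phi> \<subseteq> set vs \<and> (\<forall>S e. fo_sat S e \<phi> \<longleftrightarrow> \<Phi> S (map e vs) \<and> \<Psi> S (map e vs))"
    by (intro exI[of _ "Conj \<phi> \<psi>"]) auto
qed

text \<open>Here it pays off that \<open>definable\<close> ranges over all variable lists: the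
  hypothesis is instantiated with \<open>v # vs\<close> for a \<open>v\<close> outside
  \<open>vs\<close>, and updating \<open>v\<close> leaves the values of \<open>vs\<close>
  alone.\<close>

lemma definable_ex [definable_intros]:
  assumes "definable d (Suc N) (\<lambda>S xs. \<Phi> S (tl xs) (hd xs))"
  shows "definable d N (\<lambda>S xs. \<exists>a\<in>fst S. \<Phi> S xs a)"
  unfolding definable_def
proof (intro allI impI)
  fix vs :: "nat list" assume vs: "length vs = N"
  obtain v where v: "v \<notin> set vs"
    using infinite_UNIV_nat ex_new_if_finite by blast
  then obtain \<phi> where \<phi>: "fo_arity d \<phi>" "fo_vars_free \<phi> \<subseteq> set (v # vs)"
     "\<forall>S e. fo_sat S e \<phi> \<longleftrightarrow> \<Phi> S (map e vs) (e v)"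
    using assms vs unfolding definable_def
    by (metis (no_types, lifting) length_Cons list.sel(1,3) list.simps(9))
  have [simp]: "map (e(v := a)) vs = map e vs" for e :: "nat \<Rightarrow> 'a" and a
    using v by (simp add: map_fun_upd)
  show "\<exists>\<phi>. fo_arity d \<phi> \<and> fo_vars_free \<phi> \<subseteq> set vs \<and> (\<forall>S e. fo_sat S e \<phi> \<longleftrightarrow> (\<exists>a\<in>fst S. \<Phi> S (map e vs) a))"
    by (intro exI[of _ "Exi v \<phi>"]) (use \<phi> in \<open>auto simp del: map_eq_conv\<close>)
qed

lemma definable_all [definable_intros]:
  assumes "definable d (Suc N) (\<lambda>S xs. \<Phi> S (tl xs) (hd xs))"
  shows "definable d N (\<lambda>S xs. \<forall>a\<in>fst S. \<Phi> S xs a)"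
proof -
  have "definable d N (\<lambda>S xs. \<not> (\<exists>a\<in>fst S. \<not> \<Phi> S xs a))"
    by (intro definable_not definable_ex assms)
  then show ?thesis by simp
qed

lemma definable_disj [definable_intros]:
  assumes "definable d N \<Phi>" "definable d N \<Psi>" shows "definable d N (\<lambda>S xs. \<Phi> S xs \<or> \<Psi> S xs)"
proof -
  have "definable d N (\<lambda>S xs. \<not> (\<not> \<Phi> S xs \<and> \<not> \<Psi> S xs))"
    by (intro definable_not definable_conj assms)
  then show ?thesis by simp
qed

lemma definable_imp [definable_intros]:
  assumes "definable d N \<Phi>" "definable d N \<Psi>" shows "definable d N (\<lambda>S xs. \<Phi> S xs \<longrightarrow> \<Psi> S xs)"
proof -
  have "definable d N (\<lambda>S xs. \<not> \<Phi> S xs \<or> \<Psi> S xs)"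
    by (intro definable_not definable_disj assms)
  then show ?thesis by (rule definable_cong) blast
qed

lemma definable_iff [definable_intros]:
  assumes "definable d N \<Phi>" "definable d N \<Psi>" shows "definable d N (\<lambda>S xs. \<Phi> S xs \<longleftrightarrow> \<Psi> S xs)"
proof -
  have "definable d N (\<lambda>S xs. (\<Phi> S xs \<longrightarrow> \<Psi> S xs) \<and> (\<Psi> S xs \<longrightarrow> \<Phi> S xs))"
    by (intro definable_conj definable_imp assms)
  then show ?thesis by (rule definable_cong) blast
qed

lemma definable_True [definable_intros]: "definable d N (\<lambda>S xs. True)"
  unfolding definable_def
  \<comment> \<open>For \<open>N = 0\<close> no free variable is allowed, so the true formula has to
    be closed; this one holds even over an empty universe.\<close>
  by (intro allI impI exI[of _ "Neg (Exi 0 (Neg (Eq 0 0)))"]) auto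

lemma definable_exs [definable_intros]:
  assumes "definable d (m + N) (\<lambda>S xs. \<Phi> S (drop m xs) (take m xs))"
  shows "definable d N (\<lambda>S xs. \<exists>as. (length as = m \<and> set as \<subseteq> fst S) \<and> \<Phi> S xs as)"
  using assms
proof (induction m arbitrary: \<Phi>)
  case 0
  then show ?case by simp
next
  case (Suc m)
  have "definable d (m + N) (\<lambda>S xs. \<exists>a\<in>fst S. \<Phi> S (drop m xs) (a # take m xs))"
  proof (rule definable_ex)
    show "definable d (Suc (m + N)) (\<lambda>S xs. \<Phi> S (drop m (tl xs)) (hd xs # take m (tl xs)))"
      by (rule definable_cong[OF Suc.prems[simplified]]) (auto simp: length_Suc_conv)
  qed
  from Suc.IH[of "\<lambda>S xs as. \<exists>a\<in>fst S. \<Phi> S xs (a # as)", OF this]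
  show ?case
  proof (rule definable_cong, intro iffI)
    fix S :: "'a struct" and xs
    assume "\<exists>as. (length as = m \<and> set as \<subseteq> fst S) \<and> (\<exists>a\<in>fst S. \<Phi> S xs (a # as))"
    then obtain as a where "length as = m" "set as \<subseteq> fst S" "a \<in> fst S" "\<Phi> S xs (a # as)" by blast
    then show "\<exists>as. (length as = Suc m \<and> set as \<subseteq> fst S) \<and> \<Phi> S xs as"
      by (intro exI[of _ "a # as"]) auto
  next
    fix S :: "'a struct" and xs
    assume "\<exists>as. (length as = Suc m \<and> set as \<subseteq> fst S) \<and> \<Phi> S xs as"
    then show "\<exists>as. (length as = m \<and> set as \<subseteq> fst S) \<and> (\<exists>a\<in>fst S. \<Phi> S xs (a # as))"
      unfolding length_Suc_conv by force
  qed
qed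

lemma definable_sentence:
  assumes "definable d 0 (\<lambda>S xs. \<Phi> S)"
  obtains \<phi> where "fo_sentence d \<phi>" "\<And>S. S \<Turnstile> \<phi> \<longleftrightarrow> \<Phi> S"
proof -
  obtain \<phi> where "fo_arity d \<phi>" "fo_vars_free \<phi> \<subseteq> {}" "\<forall>S e. fo_sat S e \<phi> \<longleftrightarrow> \<Phi> S"
    using assms unfolding definable_def by force
  then show ?thesis
    by (intro that[of \<phi>]) (auto simp: fo_sentence_def models_def)
qed

section \<open>Events depending on disjoint sets of coordinates\<close>

lemma prob_pair_pmf_Times:
  "measure_pmf.prob (pair_pmf M N) (X \<times> Y) = measure_pmf.prob M X * measure_pmf.prob N Y"
proof -
  \<comment> \<open>Cutting down to the supports changes no probability and makes both sides of the
    rectangle countable.\<close>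
  have "measure_pmf.prob (pair_pmf M N) (X \<times> Y)
      = measure_pmf.prob (pair_pmf M N) ((X \<inter> set_pmf M) \<times> (Y \<inter> set_pmf N))"
    by (subst measure_Int_set_pmf[symmetric], rule arg_cong[where f = "measure_pmf.prob _"]) auto
  also have "\<dots> = measure_pmf.prob M (X \<inter> set_pmf M) * measure_pmf.prob N (Y \<inter> set_pmf N)"
    by (rule measure_pmf_prob_product) (auto intro: countable_subset[OF _ countable_set_pmf])
  finally show ?thesis by (simp add: measure_Int_set_pmf)
qed

lemma prob_Pi_pmf_subset:
  assumes "finite A" "B \<subseteq> A" "\<And>f g. (\<forall>x\<in>B. f x = g x) \<Longrightarrow> Q f \<longleftrightarrow> Q g"
  shows "measure_pmf.prob (Pi_pmf A dflt p) {f. Q f} = measure_pmf.prob (Pi_pmf B dflt p) {f. Q f}"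
proof -
  have "Q (\<lambda>x. if x \<in> B then f x else dflt) = Q f" for f
    by (rule assms(3)) auto
  then show ?thesis
    unfolding Pi_pmf_subset[OF assms(1,2)] measure_map_pmf vimage_def by simp
qed

lemma prob_Pi_pmf_conj:
  assumes A: "finite A" "B \<subseteq> A" "C \<subseteq> A" "B \<inter> C = {}"
    and Q: "\<And>f g. (\<forall>x\<in>B. f x = g x) \<Longrightarrow> Q f \<longleftrightarrow> Q g"
    and R: "\<And>f g. (\<forall>x\<in>C. f x = g x) \<Longrightarrow> R f \<longleftrightarrow> R g"
  shows "measure_pmf.prob (Pi_pmf A dflt p) {f. Q f \<and> R f}
       = measure_pmf.prob (Pi_pmf A dflt p) {f. Q f} * measure_pmf.prob (Pi_pmf A dflt p) {f. R f}"
proof -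
  have fin: "finite B" "finite C"
    using A finite_subset by blast+
  have "measure_pmf.prob (Pi_pmf A dflt p) {f. Q f \<and> R f}
      = measure_pmf.prob (Pi_pmf (B \<union> C) dflt p) {f. Q f \<and> R f}"
    by (rule prob_Pi_pmf_subset) (use A Q R in \<open>blast+\<close>)
  also have "\<dots> = measure_pmf.prob (pair_pmf (Pi_pmf B dflt p) (Pi_pmf C dflt p)) ({f. Q f} \<times> {f. R f})"
  proof -
    have "Q (\<lambda>x. if x \<in> B then f x else g x) = Q f" "R (\<lambda>x. if x \<in> B then f x else g x) = R g" for f g
      using A(4) by (auto intro!: Q R)
    then show ?thesis
      unfolding Pi_pmf_union[OF fin A(4)] measure_map_pmf vimage_def
      by (intro arg_cong[where f = "measure_pmf.prob _"]) auto
  qed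
  also have "\<dots> = measure_pmf.prob (Pi_pmf B dflt p) {f. Q f} * measure_pmf.prob (Pi_pmf C dflt p) {f. R f}"
    by (rule prob_pair_pmf_Times)
  also have "\<dots> = measure_pmf.prob (Pi_pmf A dflt p) {f. Q f} * measure_pmf.prob (Pi_pmf A dflt p) {f. R f}"
    using prob_Pi_pmf_subset[OF A(1,2), of Q] prob_Pi_pmf_subset[OF A(1,3), of R] Q R by metis
  finally show ?thesis .
qed

lemma prob_Pi_pmf_blocks:
  assumes "finite A" "finite I" "\<And>i. i \<in> I \<Longrightarrow> blk i \<subseteq> A" "disjoint_family_on blk I"
    "\<And>i f g. i \<in> I \<Longrightarrow> (\<forall>x\<in>blk i. f x = g x) \<Longrightarrow> Q i f \<longleftrightarrow> Q i g"
  shows "measure_pmf.prob (Pi_pmf A dflt p) {f. \<forall>i\<in>I. Q i f}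
       = (\<Prod>i\<in>I. measure_pmf.prob (Pi_pmf A dflt p) {f. Q i f})"
  using assms(2-)
proof (induction I rule: finite_induct)
  case empty
  then show ?case by simp
next
  case (insert j I)
  have "measure_pmf.prob (Pi_pmf A dflt p) {f. Q j f \<and> (\<forall>i\<in>I. Q i f)}
      = measure_pmf.prob (Pi_pmf A dflt p) {f. Q j f} * measure_pmf.prob (Pi_pmf A dflt p) {f. \<forall>i\<in>I. Q i f}"
  proof (rule prob_Pi_pmf_conj[where B = "blk j" and C = "\<Union>i\<in>I. blk i"])
    show "blk j \<inter> (\<Union>i\<in>I. blk i) = {}"
      using insert.prems(2) insert.hyps by (fastforce simp: disjoint_family_on_def)
    show "Q j f \<longleftrightarrow> Q j g" if "\<forall>x\<in>blk j. f x = g x" for f g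
      using insert.prems(3)[OF _ that] by blast
    show "(\<forall>i\<in>I. Q i f) \<longleftrightarrow> (\<forall>i\<in>I. Q i g)" if "\<forall>x\<in>(\<Union>i\<in>I. blk i). f x = g x" for f g
      using insert.prems(3)[of _ f g] that by blast
  qed (use insert assms(1) in auto)
  also have "measure_pmf.prob (Pi_pmf A dflt p) {f. \<forall>i\<in>I. Q i f} = (\<Prod>i\<in>I. measure_pmf.prob (Pi_pmf A dflt p) {f. Q i f})"
    by (rule insert.IH) (use insert.prems in \<open>auto simp: disjoint_family_on_def\<close>)
  finally show ?case using insert.hyps by simp
qed

text \<open>Events that depend on disjoint blocks have again a product Bernoulli law as their joint
  distribution. This gives Chernoff bounds for the number of such events, and later turns the random
  relation into a random digraph.\<close>

lemma map_Pi_pmf_indicators: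
  assumes "finite A" "finite I" "\<And>i. i \<in> I \<Longrightarrow> blk i \<subseteq> A" "disjoint_family_on blk I"
    "\<And>i f g. i \<in> I \<Longrightarrow> (\<forall>x\<in>blk i. f x = g x) \<Longrightarrow> Q i f \<longleftrightarrow> Q i g"
  shows "map_pmf (\<lambda>f i. i \<in> I \<and> Q i f) (Pi_pmf A dflt p)
       = Pi_pmf I False (\<lambda>i. bernoulli_pmf (measure_pmf.prob (Pi_pmf A dflt p) {f. Q i f}))"
proof (rule pmf_eqI)
  fix g :: "'b \<Rightarrow> bool"
  let ?M = "Pi_pmf A dflt p"
  show "pmf (map_pmf (\<lambda>f i. i \<in> I \<and> Q i f) ?M) g
      = pmf (Pi_pmf I False (\<lambda>i. bernoulli_pmf (measure_pmf.prob ?M {f. Q i f}))) g"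
  proof (cases "\<exists>i. i \<notin> I \<and> g i")
    case True
    then have "(\<lambda>f i. i \<in> I \<and> Q i f) -` {g} = {}" by (auto simp: fun_eq_iff)
    moreover have "pmf (Pi_pmf I False (\<lambda>i. bernoulli_pmf (measure_pmf.prob ?M {f. Q i f}))) g = 0"
      using True by (intro pmf_Pi_outside assms(2)) auto
    ultimately show ?thesis by (simp add: pmf_map)
  next
    case False
    then have "(\<lambda>f i. i \<in> I \<and> Q i f) -` {g} = {f. \<forall>i\<in>I. Q i f = g i}"
      by (auto simp: fun_eq_iff)
    then have "pmf (map_pmf (\<lambda>f i. i \<in> I \<and> Q i f) ?M) g = measure_pmf.prob ?M {f. \<forall>i\<in>I. Q i f = g i}"
      by (simp add: pmf_map)
    also have "\<dots> = (\<Prod>i\<in>I. measure_pmf.prob ?M {f. Q i f = g i})"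
      by (rule prob_Pi_pmf_blocks[OF assms(1-4)], assumption, frule (1) assms(5), simp)
    also have "\<dots> = (\<Prod>i\<in>I. pmf (bernoulli_pmf (measure_pmf.prob ?M {f. Q i f})) (g i))"
    proof (rule prod.cong[OF refl])
      fix i
      have "measure_pmf.prob ?M {f. \<not> Q i f} = 1 - measure_pmf.prob ?M {f. Q i f}"
        using measure_pmf.prob_compl[of "{f. Q i f}" ?M] by (simp add: Compl_eq_Diff_UNIV[symmetric] Collect_neg_eq)
      then show "measure_pmf.prob ?M {f. Q i f = g i} = pmf (bernoulli_pmf (measure_pmf.prob ?M {f. Q i f})) (g i)"
        by (cases "g i") simp_all
    qed
    also have "\<dots> = pmf (Pi_pmf I False (\<lambda>i. bernoulli_pmf (measure_pmf.prob ?M {f. Q i f}))) g"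
      using False by (intro pmf_Pi'[symmetric] assms(2)) auto
    finally show ?thesis .
  qed
qed

section \<open>Chernoff bounds for the number of independent events that occur\<close>

lemma expectation_Pi_pmf_card:
  fixes q :: "'a \<Rightarrow> real" and c :: real
  assumes I: "finite I" and q: "\<And>i. i \<in> I \<Longrightarrow> 0 \<le> q i \<and> q i \<le> 1" and c: "0 \<le> c"
  shows "measure_pmf.expectation (Pi_pmf I False (\<lambda>i. bernoulli_pmf (q i))) (\<lambda>x. c ^ card {i\<in>I. x i})
       = (\<Prod>i\<in>I. 1 + (c - 1) * q i)"
proof -
  have "c ^ card {i\<in>I. x i} = (\<Prod>i\<in>I. if x i then c else 1)" for x
    by (simp add: prod.If_cases[OF I] Int_def)
  then have "measure_pmf.expectation (Pi_pmf I False (\<lambda>i. bernoulli_pmf (q i))) (\<lambda>x. c ^ card {i\<in>I. x i})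
     = measure_pmf.expectation (Pi_pmf I False (\<lambda>i. bernoulli_pmf (q i))) (\<lambda>x. \<Prod>i\<in>I. (\<lambda>_ b. if b then c else 1) i (x i))"
    by simp
  also have "\<dots> = (\<Prod>i\<in>I. measure_pmf.expectation (bernoulli_pmf (q i)) (\<lambda>b. if b then c else 1))"
    by (rule expectation_prod_Pi_pmf) (auto intro: I integrable_measure_pmf_finite c)
  also have "\<dots> = (\<Prod>i\<in>I. 1 + (c - 1) * q i)"
    by (rule prod.cong[OF refl]) (use q in \<open>auto simp: algebra_simps\<close>)
  finally show ?thesis .
qed

lemma prod_le_exp:
  fixes q :: "'a \<Rightarrow> real"
  assumes "finite I" "\<And>i. i \<in> I \<Longrightarrow> 0 \<le> 1 + a i" "\<And>i. i \<in> I \<Longrightarrow> a i \<le> b"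
  shows "(\<Prod>i\<in>I. 1 + a i) \<le> exp (real (card I) * b)"
proof -
  have "(\<Prod>i\<in>I. 1 + a i) \<le> (\<Prod>i\<in>I. exp b)"
  proof (rule prod_mono)
    fix i assume i: "i \<in> I"
    have "1 + a i \<le> 1 + b" using assms(3)[OF i] by simp
    also have "\<dots> \<le> exp b" by (rule exp_ge_add_one_self)
    finally show "0 \<le> 1 + a i \<and> 1 + a i \<le> exp b" using assms(2)[OF i] by simp
  qed
  then show ?thesis by (simp add: exp_of_nat_mult)
qed

lemma finite_set_Pi_pmf_bool: "finite I \<Longrightarrow> finite (set_pmf (Pi_pmf I dflt (p :: 'a \<Rightarrow> bool pmf)))"
  by (simp add: set_Pi_pmf finite_PiE_dflt)

lemma Markov_pmf:
  fixes X :: "'a \<Rightarrow> real"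
  assumes "finite (set_pmf M)" "\<And>x. 0 \<le> X x" "0 < c"
  shows "measure_pmf.prob M {x. c \<le> X x} \<le> measure_pmf.expectation M X / c"
  using integral_Markov_inequality_measure[of "measure_pmf M" X UNIV c] assms
  by (simp add: integrable_measure_pmf_finite)

text \<open>Markov's inequality for \<open>exp (- count)\<close>: since \<open>1 - exp (- 1)\<close>
  is at least 1/2, the expectation is at most \<open>exp (- card I * s / 2)\<close>, and the
  threshold gives back half of this exponent.\<close>

lemma prob_Pi_pmf_card_le:
  fixes q :: "'a \<Rightarrow> real" and s :: real
  assumes I: "finite I" and q: "\<And>i. i \<in> I \<Longrightarrow> 0 \<le> q i \<and> q i \<le> 1" and s: "\<And>i. i \<in> I \<Longrightarrow> s \<le> q i"
  shows "measure_pmf.prob (Pi_pmf I False (\<lambda>i. bernoulli_pmf (q i)))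
           {x. real (card {i\<in>I. x i}) \<le> card I * s / 4} \<le> exp (- (card I * s / 4))"
proof -
  let ?M = "Pi_pmf I False (\<lambda>i. bernoulli_pmf (q i))"
  let ?X = "\<lambda>x. exp (-1) ^ card {i\<in>I. x i} :: real"
  let ?a = "card I * s / 4"
  have c: "exp (-1) - 1 \<le> (- 1 / 2 :: real)"
    using exp_ge_add_one_self[of 1] by (simp add: exp_minus field_simps)
  have X: "?X x = exp (- real (card {i\<in>I. x i}))" for x
    by (simp add: exp_of_nat_mult[symmetric])
  have "measure_pmf.prob ?M {x. real (card {i\<in>I. x i}) \<le> ?a}
      = measure_pmf.prob ?M {x. exp (- ?a) \<le> ?X x}"
    by (simp add: X)
  also have "\<dots> \<le> measure_pmf.expectation ?M ?X / exp (- ?a)"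
    by (rule Markov_pmf) (auto intro: finite_set_Pi_pmf_bool I)
  also have "measure_pmf.expectation ?M ?X = (\<Prod>i\<in>I. 1 + (exp (-1) - 1) * q i)"
    by (rule expectation_Pi_pmf_card) (use I q in auto)
  also have "\<dots> \<le> exp (real (card I) * (- s / 2))"
  proof (rule prod_le_exp[OF I])
    fix i assume i: "i \<in> I"
    have "(1 - exp (-1)) * q i \<le> 1 * 1"
      using q[OF i] by (intro mult_mono) auto
    then show "0 \<le> 1 + (exp (-1) - 1) * q i" by (simp add: algebra_simps)
    have "(exp (-1) - 1) * q i \<le> (- 1 / 2) * q i"
      using c q[OF i] by (intro mult_right_mono) auto
    also have "\<dots> \<le> - s / 2" using s[OF i] by simp
    finally show "(exp (-1) - 1) * q i \<le> - s / 2" .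
  qed
  finally have "measure_pmf.prob ?M {x. real (card {i\<in>I. x i}) \<le> ?a} \<le> exp (real (card I) * (- s / 2)) / exp (- ?a)"
    by (simp add: divide_right_mono)
  also have "\<dots> = exp (- ?a)"
    by (simp add: exp_diff[symmetric] field_simps)
  finally show ?thesis .
qed

text \<open>Markov's inequality for \<open>exp count\<close>: since \<open>exp 1 - 1\<close> is at
  most 2, the expectation is at most \<open>exp (2 * card I * s)\<close>, against
  \<open>exp (4 * card I * s)\<close> from the threshold.\<close>

lemma prob_Pi_pmf_card_ge:
  fixes q :: "'a \<Rightarrow> real" and s :: real
  assumes I: "finite I" and q: "\<And>i. i \<in> I \<Longrightarrow> 0 \<le> q i \<and> q i \<le> 1" and s: "\<And>i. i \<in> I \<Longrightarrow> q i \<le> s"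
  shows "measure_pmf.prob (Pi_pmf I False (\<lambda>i. bernoulli_pmf (q i)))
           {x. 4 * (card I * s) \<le> real (card {i\<in>I. x i})} \<le> exp (- (card I * s))"
proof (cases "I = {}")
  case False
  let ?M = "Pi_pmf I False (\<lambda>i. bernoulli_pmf (q i))"
  let ?X = "\<lambda>x. exp 1 ^ card {i\<in>I. x i} :: real"
  let ?a = "4 * (card I * s)"
  have s0: "0 \<le> s" using False q s by force
  have X: "?X x = exp (real (card {i\<in>I. x i}))" for x
    by (simp add: exp_of_nat_mult[symmetric])
  have "measure_pmf.prob ?M {x. ?a \<le> real (card {i\<in>I. x i})}
      = measure_pmf.prob ?M {x. exp ?a \<le> ?X x}"
    by (simp add: X)
  also have "\<dots> \<le> measure_pmf.expectation ?M ?X / exp ?a"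
    by (rule Markov_pmf) (auto intro: finite_set_Pi_pmf_bool I)
  also have "measure_pmf.expectation ?M ?X = (\<Prod>i\<in>I. 1 + (exp 1 - 1) * q i)"
    by (rule expectation_Pi_pmf_card) (use I q in auto)
  also have "\<dots> \<le> exp (real (card I) * (2 * s))"
  proof (rule prod_le_exp[OF I])
    fix i assume i: "i \<in> I"
    show "0 \<le> 1 + (exp 1 - 1) * q i" using q[OF i] by (simp add: mult_nonneg_nonneg add_nonneg_nonneg)
    show "(exp 1 - 1) * q i \<le> 2 * s"
      using exp_le q[OF i] s[OF i] s0 by (intro mult_mono) auto
  qed
  finally have "measure_pmf.prob ?M {x. ?a \<le> real (card {i\<in>I. x i})} \<le> exp (real (card I) * (2 * s)) / exp ?a"
    by (simp add: divide_right_mono)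
  also have "\<dots> \<le> exp (- (card I * s))"
    using s0 by (simp add: exp_diff[symmetric] field_simps)
  finally show ?thesis .
qed simp

lemma
  fixes p :: "'a \<Rightarrow> 'b pmf" and s :: real
  assumes "finite A" "finite I" "\<And>i. i \<in> I \<Longrightarrow> blk i \<subseteq> A" "disjoint_family_on blk I"
    "\<And>i f g. i \<in> I \<Longrightarrow> (\<forall>x\<in>blk i. f x = g x) \<Longrightarrow> Q i f \<longleftrightarrow> Q i g"
  shows prob_blocks_card_le: "(\<And>i. i \<in> I \<Longrightarrow> s \<le> measure_pmf.prob (Pi_pmf A dflt p) {f. Q i f}) \<Longrightarrow>
      measure_pmf.prob (Pi_pmf A dflt p) {f. real (card {i\<in>I. Q i f}) \<le> card I * s / 4} \<le> exp (- (card I * s / 4))"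
    and prob_blocks_card_ge: "(\<And>i. i \<in> I \<Longrightarrow> measure_pmf.prob (Pi_pmf A dflt p) {f. Q i f} \<le> s) \<Longrightarrow>
      measure_pmf.prob (Pi_pmf A dflt p) {f. 4 * (card I * s) \<le> real (card {i\<in>I. Q i f})} \<le> exp (- (card I * s))"
proof -
  let ?M = "Pi_pmf A dflt p"
  have *: "Pi_pmf I False (\<lambda>i. bernoulli_pmf (measure_pmf.prob ?M {f. Q i f}))
      = map_pmf (\<lambda>f i. i \<in> I \<and> Q i f) ?M"
    by (rule map_Pi_pmf_indicators[OF assms(1-4), symmetric], assumption, frule (1) assms(5), simp)
  have eq: "{i \<in> I. i \<in> I \<and> Q i f} = {i\<in>I. Q i f}" for f by auto
  show "measure_pmf.prob ?M {f. real (card {i\<in>I. Q i f}) \<le> card I * s / 4} \<le> exp (- (card I * s / 4))"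
    if "\<And>i. i \<in> I \<Longrightarrow> s \<le> measure_pmf.prob ?M {f. Q i f}"
    using prob_Pi_pmf_card_le[OF assms(2), where q = "\<lambda>i. measure_pmf.prob ?M {f. Q i f}" and s = s] that
    by (simp add: * vimage_def eq del: Collect_mem_eq)
  show "measure_pmf.prob ?M {f. 4 * (card I * s) \<le> real (card {i\<in>I. Q i f})} \<le> exp (- (card I * s))"
    if "\<And>i. i \<in> I \<Longrightarrow> measure_pmf.prob ?M {f. Q i f} \<le> s"
    using prob_Pi_pmf_card_ge[OF assms(2), where q = "\<lambda>i. measure_pmf.prob ?M {f. Q i f}" and s = s] that
    by (simp add: * vimage_def eq del: Collect_mem_eq)
qed

lemma prob_blocks_none:
  assumes "finite A" "finite I" "\<And>i. i \<in> I \<Longrightarrow> blk i \<subseteq> A" "disjoint_family_on blk I"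
    "\<And>i f g. i \<in> I \<Longrightarrow> (\<forall>x\<in>blk i. f x = g x) \<Longrightarrow> Q i f \<longleftrightarrow> Q i g"
  shows "measure_pmf.prob (Pi_pmf A dflt p) {f. \<forall>i\<in>I. \<not> Q i f}
     = (\<Prod>i\<in>I. 1 - measure_pmf.prob (Pi_pmf A dflt p) {f. Q i f})"
proof -
  have "measure_pmf.prob (Pi_pmf A dflt p) {f. \<forall>i\<in>I. \<not> Q i f}
     = (\<Prod>i\<in>I. measure_pmf.prob (Pi_pmf A dflt p) {f. \<not> Q i f})"
    by (rule prob_Pi_pmf_blocks[OF assms(1-4)], assumption, frule (1) assms(5), simp)
  also have "\<dots> = (\<Prod>i\<in>I. 1 - measure_pmf.prob (Pi_pmf A dflt p) {f. Q i f})"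
    using measure_pmf.prob_compl[where M = "Pi_pmf A dflt p"]
    by (intro prod.cong[OF refl]) (simp add: Compl_eq_Diff_UNIV[symmetric] Collect_neg_eq)
  finally show ?thesis .
qed

lemma prob_blocks_none_le:
  fixes s :: real
  assumes "finite A" "finite I" "\<And>i. i \<in> I \<Longrightarrow> blk i \<subseteq> A" "disjoint_family_on blk I"
    "\<And>i f g. i \<in> I \<Longrightarrow> (\<forall>x\<in>blk i. f x = g x) \<Longrightarrow> Q i f \<longleftrightarrow> Q i g"
    "\<And>i. i \<in> I \<Longrightarrow> s \<le> measure_pmf.prob (Pi_pmf A dflt p) {f. Q i f}"
  shows "measure_pmf.prob (Pi_pmf A dflt p) {f. \<forall>i\<in>I. \<not> Q i f} \<le> exp (- (card I * s))"
proof -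
  have "(\<Prod>i\<in>I. 1 + - measure_pmf.prob (Pi_pmf A dflt p) {f. Q i f}) \<le> exp (real (card I) * (- s))"
    by (rule prod_le_exp) (use assms in \<open>auto simp: measure_pmf.prob_le_1\<close>)
  then show ?thesis
    using prob_blocks_none[OF assms(1-5), where p = p and dflt = dflt] by simp
qed

section \<open>Towers of power sets of small coded sets\<close>

text \<open>\<open>E w b\<close> says that \<open>b\<close> belongs to the set coded by \<open>w\<close>. For finite \<open>B\<close>, closure under adding
  single elements amounts to all subsets of \<open>B\<close> being coded, without second order quantifiers.\<close>

definition code_all :: "'a set \<Rightarrow> ('a \<Rightarrow> 'a \<Rightarrow> bool) \<Rightarrow> 'a set \<Rightarrow> bool" where
  "code_all V E B \<longleftrightarrow> (\<exists>w\<in>V. \<forall>b\<in>B. \<not> E w b) \<and>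
     (\<forall>w\<in>V. \<forall>b0\<in>B. \<exists>w'\<in>V. \<forall>b\<in>B. E w' b \<longleftrightarrow> E w b \<or> b = b0)"

text \<open>A relation between two disjoint sets is encoded by a family of two-element sets, the
  elements of \<open>Z\<close> being codes of the members of that family.\<close>

definition linked :: "('a \<Rightarrow> 'a \<Rightarrow> bool) \<Rightarrow> 'a set \<Rightarrow> 'a \<Rightarrow> 'a \<Rightarrow> bool" where
  "linked E Z b' b \<longleftrightarrow> (\<exists>z\<in>Z. E z b' \<and> E z b)"

text \<open>With \<open>U\<close> and \<open>U'\<close> the subsets of \<open>B\<close> coded by \<open>w\<close> and \<open>w'\<close>, the relation encoded by \<open>es\<close>
  is a bijection of \<open>U' - U\<close> with the power set of \<open>U\<close>.\<close>

definition power_step :: "'a set \<Rightarrow> 'e set \<Rightarrow> ('e \<Rightarrow> 'a set) \<Rightarrow> ('a \<Rightarrow> 'a \<Rightarrow> bool) \<Rightarrow> 'a set \<Rightarrow> 'a \<Rightarrow> 'a \<Rightarrow> bool" where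
  "power_step V EP nb E B w w' \<longleftrightarrow> (\<forall>b\<in>B. E w b \<longrightarrow> E w' b) \<and> (\<exists>es\<in>EP.
     (\<forall>v\<in>V. \<exists>b'\<in>B. (E w' b' \<and> \<not> E w b') \<and> (\<forall>b\<in>B. E w b \<longrightarrow> (E v b \<longleftrightarrow> linked E (nb es) b' b))) \<and>
     (\<forall>b'\<in>B. \<forall>b''\<in>B. (E w' b' \<and> \<not> E w b') \<and> (E w' b'' \<and> \<not> E w b'') \<and> \<not> b' = b'' \<longrightarrow>
        (\<exists>b\<in>B. E w b \<and> \<not> (linked E (nb es) b' b \<longleftrightarrow> linked E (nb es) b'' b))))"

primrec power_steps :: "nat \<Rightarrow> 'a set \<Rightarrow> 'e set \<Rightarrow> ('e \<Rightarrow> 'a set) \<Rightarrow> ('a \<Rightarrow> 'a \<Rightarrow> bool) \<Rightarrow> 'a set \<Rightarrow> 'a \<Rightarrow> 'a \<Rightarrow> bool" where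
  "power_steps 0 V EP nb E B w w' \<longleftrightarrow> (\<forall>b\<in>B. E w b \<longleftrightarrow> E w' b)"
| "power_steps (Suc k) V EP nb E B w w' \<longleftrightarrow> (\<exists>v\<in>V. power_step V EP nb E B w v \<and> power_steps k V EP nb E B v w')"

text \<open>Steps from the empty member of the family given by \<open>es\<close> lead through members of sizes
  \<open>tow k, tow (2 * k), \<dots>\<close> and can only end at \<open>B\<close> itself.\<close>

definition tower :: "nat \<Rightarrow> 'a set \<Rightarrow> 'e set \<Rightarrow> ('e \<Rightarrow> 'a set) \<Rightarrow> ('a \<Rightarrow> 'a \<Rightarrow> bool) \<Rightarrow> 'a set \<Rightarrow> bool" where
  "tower k V EP nb E B \<longleftrightarrow> (\<exists>es\<in>EP. (\<exists>y\<in>nb es. \<forall>b\<in>B. \<not> E y b) \<and>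
     (\<forall>y\<in>nb es. (\<forall>b\<in>B. E y b) \<or> (\<exists>y'\<in>nb es. power_steps k V EP nb E B y y')))"

text \<open>The neighbourhood of \<open>es1\<close> is a companion of \<open>B\<close>: through the
  relation encoded by \<open>es2\<close> its elements represent all subsets of \<open>B\<close>, so
  it has at least \<open>2 ^ card B\<close> elements. As it has to be coded as well, it can exist
  only if \<open>V\<close> is doubly exponential in \<open>card B\<close>.\<close>

definition extendable :: "'a set \<Rightarrow> 'c set \<Rightarrow> 'e set \<Rightarrow> ('e \<Rightarrow> 'a set) \<Rightarrow> ('c \<Rightarrow> 'a \<Rightarrow> 'a \<Rightarrow> bool) \<Rightarrow> 'a set \<Rightarrow> bool" where
  "extendable V CP EP nb E B \<longleftrightarrow> (\<exists>cs\<in>CP. \<exists>es1\<in>EP. \<exists>es2\<in>EP. code_all V (E cs) B \<and> code_all V (E cs) (nb es1) \<and>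
     (\<forall>v\<in>V. \<exists>b'\<in>nb es1. \<forall>b\<in>B. E cs v b \<longleftrightarrow> linked (E cs) (nb es2) b' b))"

text \<open>Maximality is expressed by the lack of a companion, which bounds the size of the tower
  from below, while being coded bounds it from above.\<close>

definition max_tower :: "nat \<Rightarrow> 'a set \<Rightarrow> 'c set \<Rightarrow> 'e set \<Rightarrow> ('e \<Rightarrow> 'a set) \<Rightarrow> ('c \<Rightarrow> 'a \<Rightarrow> 'a \<Rightarrow> bool) \<Rightarrow> bool" where
  "max_tower k V CP EP nb E \<longleftrightarrow> (\<exists>cs\<in>CP. \<exists>es\<in>EP. code_all V (E cs) (nb es) \<and>
     tower k V EP nb (E cs) (nb es) \<and> \<not> extendable V CP EP nb E (nb es))"

section \<open>Cardinalities forced by codes, power steps, towers and companions\<close>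

lemma code_all_subset:
  assumes "code_all V E B" "finite B" "\<tau> \<subseteq> B"
  shows "\<exists>w\<in>V. \<forall>b\<in>B. E w b \<longleftrightarrow> b \<in> \<tau>"
  using finite_subset[OF assms(3,2)] assms(3)
proof (induction \<tau> rule: finite_induct)
  case empty
  show ?case using assms(1) by (simp add: code_all_def)
next
  case (insert x F)
  have "F \<subseteq> B" using insert.prems by blast
  then obtain w where w: "w \<in> V" "\<forall>b\<in>B. E w b \<longleftrightarrow> b \<in> F" using insert.IH by blast
  moreover have "x \<in> B" using insert.prems by blast
  ultimately obtain w' where "w' \<in> V" "\<forall>b\<in>B. E w' b \<longleftrightarrow> E w b \<or> b = x"
    using assms(1) unfolding code_all_def by blast
  then show ?case using w by (intro bexI[of _ w']) auto
qed

lemma code_allI: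
  assumes "\<And>\<tau>. \<tau> \<subseteq> B \<Longrightarrow> \<exists>w\<in>V. \<forall>b\<in>B. E w b \<longleftrightarrow> b \<in> \<tau>"
  shows "code_all V E B"
  unfolding code_all_def
proof (intro conjI ballI)
  show "\<exists>w\<in>V. \<forall>b\<in>B. \<not> E w b" using assms[of "{}"] by simp
  fix w b0 assume "b0 \<in> B"
  then show "\<exists>w'\<in>V. \<forall>b\<in>B. E w' b \<longleftrightarrow> E w b \<or> b = b0"
    using assms[of "{b\<in>B. E w b \<or> b = b0}"] by auto
qed

lemma code_all_card:
  assumes "code_all V E B" "finite B" "finite V"
  shows "2 ^ card B \<le> card V"
proof -
  have "Pow B \<subseteq> (\<lambda>w. {b\<in>B. E w b}) ` V"
  proof
    fix \<tau> assume "\<tau> \<in> Pow B"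
    then obtain w where "w \<in> V" "\<forall>b\<in>B. E w b \<longleftrightarrow> b \<in> \<tau>"
      using code_all_subset[OF assms(1,2)] by blast
    then show "\<tau> \<in> (\<lambda>w. {b\<in>B. E w b}) ` V" using \<open>\<tau> \<in> Pow B\<close> by (intro image_eqI[of _ _ w]) auto
  qed
  then have "card (Pow B) \<le> card V"
    using assms(3) surj_card_le by blast
  then show ?thesis using assms(2) by (simp add: card_Pow)
qed

text \<open>Sending \<open>b'\<close> to the elements of the old set linked with it is injective by
  the separation clause. It is onto the power set because the covering clause treats every coded
  trace and \<open>code_all\<close> makes every subset a coded trace.\<close>

lemma power_step_card:
  assumes "code_all V E B" "finite B" "power_step V EP nb E B w w'"
  shows "{b\<in>B. E w b} \<subseteq> {b\<in>B. E w' b}"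
    and "card {b\<in>B. E w' b} = card {b\<in>B. E w b} + 2 ^ card {b\<in>B. E w b}"
proof -
  let ?U = "{b\<in>B. E w b}" let ?U' = "{b\<in>B. E w' b}"
  show sub: "?U \<subseteq> ?U'" using assms(3) unfolding power_step_def by blast
  obtain es where cov: "\<forall>v\<in>V. \<exists>b'\<in>B. (E w' b' \<and> \<not> E w b') \<and> (\<forall>b\<in>B. E w b \<longrightarrow> (E v b \<longleftrightarrow> linked E (nb es) b' b))"
    and inj: "\<forall>b'\<in>B. \<forall>b''\<in>B. (E w' b' \<and> \<not> E w b') \<and> (E w' b'' \<and> \<not> E w b'') \<and> \<not> b' = b'' \<longrightarrow>
        (\<exists>b\<in>B. E w b \<and> \<not> (linked E (nb es) b' b \<longleftrightarrow> linked E (nb es) b'' b))"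
    using assms(3) unfolding power_step_def by blast
  let ?h = "\<lambda>b'. {b\<in>?U. linked E (nb es) b' b}"
  have "bij_betw ?h (?U' - ?U) (Pow ?U)"
    unfolding bij_betw_def
  proof
    show "inj_on ?h (?U' - ?U)"
    proof (rule inj_onI, rule ccontr)
      fix x y assume xy: "x \<in> ?U' - ?U" "y \<in> ?U' - ?U" "?h x = ?h y" "x \<noteq> y"
      then obtain b where "b \<in> B" "E w b" "\<not> (linked E (nb es) x b \<longleftrightarrow> linked E (nb es) y b)"
        using inj by blast
      then show False using xy(3) by blast
    qed
    show "?h ` (?U' - ?U) = Pow ?U"
    proof (intro equalityI subsetI)
      fix \<tau> assume \<tau>: "\<tau> \<in> Pow ?U"
      then obtain v where v: "v \<in> V" "\<forall>b\<in>B. E v b \<longleftrightarrow> b \<in> \<tau>"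
        using code_all_subset[OF assms(1,2), of \<tau>] by blast
      then obtain b' where "b' \<in> B" "E w' b'" "\<not> E w b'" "\<forall>b\<in>B. E w b \<longrightarrow> (E v b \<longleftrightarrow> linked E (nb es) b' b)"
        using cov by blast
      then show "\<tau> \<in> ?h ` (?U' - ?U)"
        using v(2) \<tau> by (intro image_eqI[of _ _ b']) auto
    qed auto
  qed
  then have "card (?U' - ?U) = 2 ^ card ?U"
    using bij_betw_same_card card_Pow[of ?U] assms(2) by fastforce
  moreover have "card (?U' - ?U) = card ?U' - card ?U" "card ?U \<le> card ?U'"
    using sub assms(2) by (auto intro: card_Diff_subset card_mono)
  ultimately show "card ?U' = card ?U + 2 ^ card ?U" by linarith
qed

text \<open>Sizes of iterated power steps: a step keeps the old set and adds a disjoint copy of its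
  power set. The sequence starts 0, 1, 3, 11, 2059.\<close>

definition tow :: "nat \<Rightarrow> nat" where
  "tow l = ((\<lambda>m. m + 2 ^ m) ^^ l) 0"

lemma tow_0 [simp]: "tow 0 = 0" and tow_Suc: "tow (Suc l) = tow l + 2 ^ tow l"
  by (simp_all add: tow_def)

lemma strict_mono_tow: "strict_mono tow"
  unfolding strict_mono_Suc_iff by (simp add: tow_Suc)

lemma le_tow: "l \<le> tow l"
  using strict_mono_tow by (rule strict_mono_imp_increasing)

lemma power_steps_card:
  assumes "code_all V E B" "finite B" "power_steps k V EP nb E B w w'" "card {b\<in>B. E w b} = tow j"
  shows "card {b\<in>B. E w' b} = tow (k + j)"
  using assms(3,4)
proof (induction k arbitrary: w j)
  case 0
  then have "{b\<in>B. E w' b} = {b\<in>B. E w b}" by auto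
  then show ?case using 0 by simp
next
  case (Suc k)
  then obtain v where v: "power_step V EP nb E B w v" "power_steps k V EP nb E B v w'" by auto
  have "card {b\<in>B. E v b} = tow (Suc j)"
    using power_step_card(2)[OF assms(1,2) v(1)] Suc.prems(2) by (simp add: tow_Suc)
  from Suc.IH[OF v(2) this] show ?case by simp
qed

text \<open>If the chain from the empty set never ended at \<open>B\<close>, the family would
  contain subsets of \<open>B\<close> of all sizes \<open>tow (k * j)\<close>, which are unbounded
  for \<open>k \<ge> 1\<close>.\<close>

lemma tower_card:
  assumes "code_all V E B" "finite B" "tower k V EP nb E B" "k \<ge> 1"
  shows "\<exists>j. card B = tow (k * j)"
proof (rule ccontr)
  assume no: "\<nexists>j. card B = tow (k * j)"
  obtain es where base: "\<exists>y\<in>nb es. \<forall>b\<in>B. \<not> E y b"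
    and step: "\<forall>y\<in>nb es. (\<forall>b\<in>B. E y b) \<or> (\<exists>y'\<in>nb es. power_steps k V EP nb E B y y')"
    using assms(3) unfolding tower_def by blast
  have "\<exists>y\<in>nb es. card {b\<in>B. E y b} = tow (k * j)" for j
  proof (induction j)
    case 0
    obtain y where "y \<in> nb es" "\<forall>b\<in>B. \<not> E y b" using base by blast
    then have "{b\<in>B. E y b} = {}" by blast
    then have "card {b\<in>B. E y b} = 0" by (simp only: card.empty)
    then show ?case using \<open>y \<in> nb es\<close> by auto
  next
    case (Suc j)
    then obtain y where y: "y \<in> nb es" "card {b\<in>B. E y b} = tow (k * j)" by blast
    have "\<not> (\<forall>b\<in>B. E y b)"
    proof
      assume "\<forall>b\<in>B. E y b"
      then have "{b\<in>B. E y b} = B" by auto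
      then show False using y(2) no by metis
    qed
    then obtain y' where "y' \<in> nb es" "power_steps k V EP nb E B y y'" using step y(1) by blast
    then show ?case using power_steps_card[OF assms(1,2) _ y(2)] by (intro bexI[of _ y']) auto
  qed
  then obtain y where "card {b\<in>B. E y b} = tow (k * Suc (card B))" by blast
  moreover have "card {b\<in>B. E y b} \<le> card B" using assms(2) by (intro card_mono) auto
  moreover have "Suc (card B) \<le> k * Suc (card B)" using assms(4) by (cases k) auto
  then have "Suc (card B) \<le> tow (k * Suc (card B))"
    using le_tow order_trans by blast
  ultimately show False by simp
qed

text \<open>The companion maps onto the power set of \<open>B\<close>, and being coded it has all
  its own subsets coded by vertices; each of the two facts contributes one exponential.\<close>

lemma extendable_card:
  assumes "extendable V CP EP nb E B" "finite V" "B \<subseteq> V" "\<And>es. es \<in> EP \<Longrightarrow> nb es \<subseteq> V"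
  shows "2 ^ (2 ^ card B) \<le> card V"
proof -
  obtain cs es1 es2 where *: "cs \<in> CP" "es1 \<in> EP" "es2 \<in> EP" "code_all V (E cs) B" "code_all V (E cs) (nb es1)"
    "\<forall>v\<in>V. \<exists>b'\<in>nb es1. \<forall>b\<in>B. E cs v b \<longleftrightarrow> linked (E cs) (nb es2) b' b"
    using assms(1) unfolding extendable_def by blast
  have fin: "finite B" "finite (nb es1)"
    using assms *(2) finite_subset by blast+
  have "Pow B \<subseteq> (\<lambda>b'. {b\<in>B. linked (E cs) (nb es2) b' b}) ` nb es1"
  proof
    fix \<tau> assume \<tau>: "\<tau> \<in> Pow B"
    then obtain v where v: "v \<in> V" "\<forall>b\<in>B. E cs v b \<longleftrightarrow> b \<in> \<tau>"
      using code_all_subset[OF *(4) fin(1)] by blast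
    then obtain b' where "b' \<in> nb es1" "\<forall>b\<in>B. E cs v b \<longleftrightarrow> linked (E cs) (nb es2) b' b"
      using *(6) by blast
    then show "\<tau> \<in> (\<lambda>b'. {b\<in>B. linked (E cs) (nb es2) b' b}) ` nb es1"
      using v \<tau> by (intro image_eqI[of _ _ b']) auto
  qed
  then have "card (Pow B) \<le> card (nb es1)"
    using fin surj_card_le by blast
  then have "2 ^ card B \<le> card (nb es1)"
    using fin by (simp add: card_Pow)
  then have "2 ^ (2 ^ card B) \<le> (2 :: nat) ^ card (nb es1)"
    by (rule power_increasing) simp
  also have "\<dots> \<le> card V" by (rule code_all_card[OF *(5) fin(2) assms(2)])
  finally show ?thesis .
qed

text \<open>The companion of \<open>B\<close> in \<^const>\<open>extendable\<close> has to be disjoint from \<open>B\<close>, since one cannot expect a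
  set of the form \<open>nb es\<close> to contain given elements.\<close>

definition rich :: "nat \<Rightarrow> 'a set \<Rightarrow> 'c set \<Rightarrow> 'e set \<Rightarrow> ('e \<Rightarrow> 'a set) \<Rightarrow> ('c \<Rightarrow> 'a \<Rightarrow> 'a \<Rightarrow> bool) \<Rightarrow> bool" where
  "rich t V CP EP nb E \<longleftrightarrow>
     (\<forall>B\<subseteq>V. card B \<le> t \<longrightarrow> (\<exists>cs\<in>CP. (\<forall>\<tau>\<subseteq>B. \<exists>w\<in>V. \<forall>b\<in>B. E cs w b \<longleftrightarrow> b \<in> \<tau>) \<and>
        (\<forall>T\<subseteq>Pow B. card T \<le> t\<^sup>2 \<longrightarrow> (\<exists>es\<in>EP. (\<lambda>z. {b\<in>B. E cs z b}) ` nb es = T)))) \<and>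
     (\<forall>B\<subseteq>V. card B \<le> t \<longrightarrow> (\<forall>m\<le>t. \<exists>es\<in>EP. card (nb es) = m \<and> nb es \<inter> B = {}))"

section \<open>Realising and refuting the tower sentences in rich structures\<close>

lemma richD:
  assumes "rich t V CP EP nb E" "B \<subseteq> V" "card B \<le> t"
  obtains cs where "cs \<in> CP" "code_all V (E cs) B" "\<And>\<tau>. \<tau> \<subseteq> B \<Longrightarrow> \<exists>w\<in>V. \<forall>b\<in>B. E cs w b \<longleftrightarrow> b \<in> \<tau>"
    "\<And>T. T \<subseteq> Pow B \<Longrightarrow> card T \<le> t\<^sup>2 \<Longrightarrow> \<exists>es\<in>EP. (\<lambda>z. {b\<in>B. E cs z b}) ` nb es = T"
proof -
  obtain cs where *: "cs \<in> CP" "\<forall>\<tau>\<subseteq>B. \<exists>w\<in>V. \<forall>b\<in>B. E cs w b \<longleftrightarrow> b \<in> \<tau>"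
        "\<forall>T\<subseteq>Pow B. card T \<le> t\<^sup>2 \<longrightarrow> (\<exists>es\<in>EP. (\<lambda>z. {b\<in>B. E cs z b}) ` nb es = T)"
    using conjunct1[OF assms(1)[unfolded rich_def], THEN spec, THEN mp, OF assms(2), THEN mp, OF assms(3)] by (elim bexE conjE)
  have "code_all V (E cs) B" by (rule code_allI) (rule *(2)[rule_format])
  then show ?thesis by (rule that[OF *(1) _ *(2)[rule_format] *(3)[rule_format]])
qed

lemma richD_avoiding:
  assumes "rich t V CP EP nb E" "B \<subseteq> V" "card B \<le> t" "m \<le> t"
  obtains es where "es \<in> EP" "card (nb es) = m" "nb es \<inter> B = {}"
  using conjunct2[OF assms(1)[unfolded rich_def], THEN spec, THEN mp, OF assms(2), THEN mp, OF assms(3), THEN spec, THEN mp, OF assms(4)]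
  by (elim bexE conjE)

text \<open>Disjointness of \<open>X\<close> and \<open>Y\<close> is what lets an unordered pair
  \<open>{b', b}\<close> determine which element lies on which side of the relation.\<close>

lemma linked_family:
  assumes "(\<lambda>z. {b\<in>B. E z b}) ` Z = {{b', b} |b' b. (b', b) \<in> R}" "R \<subseteq> X \<times> Y" "X \<subseteq> B" "Y \<subseteq> B" "X \<inter> Y = {}"
    "x \<in> X" "y \<in> Y"
  shows "linked E Z x y \<longleftrightarrow> (x, y) \<in> R"
proof
  assume "linked E Z x y"
  then obtain z where z: "z \<in> Z" "E z x" "E z y" unfolding linked_def by blast
  then have "{b\<in>B. E z b} \<in> {{b', b} |b' b. (b', b) \<in> R}" using assms(1) by blast
  then obtain b' b where b: "{b\<in>B. E z b} = {b', b}" "(b', b) \<in> R" by blast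
  have "x \<in> B" "y \<in> B" "b' \<in> X" "b \<in> Y" using assms(2-7) b(2) by blast+
  then have "x \<in> {b\<in>B. E z b}" "y \<in> {b\<in>B. E z b}" using z by simp_all
  then have "x = b'" "y = b"
    using \<open>b' \<in> X\<close> \<open>b \<in> Y\<close> assms(5-7) unfolding b(1) by blast+
  then show "(x, y) \<in> R" using b by simp
next
  assume "(x, y) \<in> R"
  then have "{x, y} \<in> (\<lambda>z. {b\<in>B. E z b}) ` Z" unfolding assms(1) by blast
  then obtain z where "z \<in> Z" "{x, y} = {b\<in>B. E z b}" by (rule imageE) blast
  then show "linked E Z x y" unfolding linked_def by blast
qed

text \<open>Accounts for the \<open>t\<^sup>2\<close> in \<open>rich\<close>: a relation between two
  sets of at most \<open>t\<close> elements needs no larger family.\<close>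

lemma card_pairs_le:
  assumes "finite X" "finite Y" "R \<subseteq> X \<times> Y"
  shows "card {{b', b} |b' b. (b', b) \<in> R} \<le> card X * card Y"
proof -
  have "{{b', b} |b' b. (b', b) \<in> R} = (\<lambda>(b', b). {b', b}) ` R" by auto
  then have "card {{b', b} |b' b. (b', b) \<in> R} \<le> card R"
    using card_image_le finite_subset[OF assms(3)] assms by (metis finite_cartesian_product)
  also have "\<dots> \<le> card (X \<times> Y)" using assms by (intro card_mono) auto
  finally show ?thesis by (simp add: card_cartesian_product)
qed

text \<open>A bijection \<open>h\<close> of the new part with the power set of \<open>U\<close>
  exists by counting; the membership relation \<open>b \<in> h b'\<close> is small enough to be
  encoded as a family of two-element sets.\<close>

lemma power_stepI:
  assumes fam: "\<And>T. T \<subseteq> Pow B \<Longrightarrow> card T \<le> t\<^sup>2 \<Longrightarrow> \<exists>es\<in>EP. (\<lambda>z. {b\<in>B. E z b}) ` nb es = T"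
    and B: "finite B" "card B \<le> t" and U: "U \<subseteq> U'" "U' \<subseteq> B" "card U' = card U + 2 ^ card U"
    and w: "\<And>b. b \<in> B \<Longrightarrow> E w b \<longleftrightarrow> b \<in> U" "\<And>b. b \<in> B \<Longrightarrow> E w' b \<longleftrightarrow> b \<in> U'"
  shows "power_step V EP nb E B w w'"
proof -
  have fin': "finite U'" by (rule finite_subset[OF U(2) B(1)])
  then have fin: "finite U" "finite U'" using finite_subset[OF U(1)] by simp_all
  have "card (U' - U) = card (Pow U)"
    using U fin by (simp add: card_Diff_subset card_Pow)
  then obtain h where h: "bij_betw h (U' - U) (Pow U)"
    using finite_same_card_bij[of "U' - U" "Pow U"] fin by auto
  define R where "R = {(b', b). b' \<in> U' - U \<and> b \<in> h b'}"
  have R: "R \<subseteq> (U' - U) \<times> U"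
    using bij_betwE[OF h] by (auto simp: R_def)
  have "card {{b', b} |b' b. (b', b) \<in> R} \<le> card (U' - U) * card U"
    using fin R by (intro card_pairs_le) auto
  also have "\<dots> \<le> card B * card B"
    using B U fin by (intro mult_mono card_mono) auto
  also have "\<dots> \<le> t\<^sup>2" using B by (simp add: power2_eq_square mult_mono)
  finally have "card {{b', b} |b' b. (b', b) \<in> R} \<le> t\<^sup>2" .
  moreover have "{{b', b} |b' b. (b', b) \<in> R} \<subseteq> Pow B"
    using R U by auto
  ultimately have "\<exists>X\<in>EP. (\<lambda>z. {b\<in>B. E z b}) ` nb X = {{b', b} |b' b. (b', b) \<in> R}"
    by (intro fam)
  then obtain es where es: "es \<in> EP" "(\<lambda>z. {b\<in>B. E z b}) ` nb es = {{b', b} |b' b. (b', b) \<in> R}"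
    by (elim bexE)
  have lk: "linked E (nb es) b' b \<longleftrightarrow> b \<in> h b'" if "b' \<in> U' - U" "b \<in> U" for b' b
    using linked_family[OF es(2) R _ _ _ that] U that by (auto simp: R_def)
  show ?thesis
    unfolding power_step_def
  proof (intro conjI bexI[OF _ es(1)] ballI impI)
    show "E w' b" if "b \<in> B" "E w b" for b using w U that by blast
  next
    fix v assume "v \<in> V"
    obtain b' where b': "b' \<in> U' - U" "h b' = {b\<in>U. E v b}"
      using bij_betw_imp_surj_on[OF h] by (metis (no_types, lifting) Pow_iff imageE mem_Collect_eq subsetI)
    show "\<exists>b'\<in>B. (E w' b' \<and> \<not> E w b') \<and> (\<forall>b\<in>B. E w b \<longrightarrow> (E v b \<longleftrightarrow> linked E (nb es) b' b))"
      by (rule bexI[of _ b']) (use b' w U lk in auto)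
  next
    fix b' b'' assume b: "b' \<in> B" "b'' \<in> B" "(E w' b' \<and> \<not> E w b') \<and> (E w' b'' \<and> \<not> E w b'') \<and> \<not> b' = b''"
    then have b': "b' \<in> U' - U" "b'' \<in> U' - U" using w by auto
    then have "h b' \<noteq> h b''" using b bij_betw_imp_inj_on[OF h] by (simp add: inj_on_eq_iff)
    moreover have "h b' \<subseteq> U" "h b'' \<subseteq> U" using bij_betwE[OF h] b' by auto
    ultimately obtain b where "b \<in> U" "\<not> (b \<in> h b' \<longleftrightarrow> b \<in> h b'')" by blast
    then show "\<exists>b\<in>B. E w b \<and> \<not> (linked E (nb es) b' b \<longleftrightarrow> linked E (nb es) b'' b)"
      using lk b' w U by (intro bexI[of _ b]) auto
  qed
qed

lemma power_stepsI:
  assumes codes: "\<And>\<tau>. \<tau> \<subseteq> B \<Longrightarrow> \<exists>w\<in>V. \<forall>b\<in>B. E w b \<longleftrightarrow> b \<in> \<tau>"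
    and fam: "\<And>T. T \<subseteq> Pow B \<Longrightarrow> card T \<le> t\<^sup>2 \<Longrightarrow> \<exists>es\<in>EP. (\<lambda>z. {b\<in>B. E z b}) ` nb es = T"
    and B: "finite B" "card B \<le> t"
    and U: "\<And>i. i \<le> k + j \<Longrightarrow> U i \<subseteq> B \<and> card (U i) = tow i" "\<And>i. i < k + j \<Longrightarrow> U i \<subseteq> U (Suc i)"
    and w: "\<And>b. b \<in> B \<Longrightarrow> E w b \<longleftrightarrow> b \<in> U j" "\<And>b. b \<in> B \<Longrightarrow> E w' b \<longleftrightarrow> b \<in> U (k + j)"
  shows "power_steps k V EP nb E B w w'"
  using U w
proof (induction k arbitrary: w j)
  case 0
  then show ?case by simp
next
  case (Suc k)
  obtain v where v: "v \<in> V" "\<forall>b\<in>B. E v b \<longleftrightarrow> b \<in> U (Suc j)"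
    using codes[of "U (Suc j)"] Suc.prems(1)[of "Suc j"] by auto
  have "power_step V EP nb E B w v"
  proof (rule power_stepI[OF fam B])
    show "U j \<subseteq> U (Suc j)" "U (Suc j) \<subseteq> B" using Suc.prems(1,2) by auto
    show "card (U (Suc j)) = card (U j) + 2 ^ card (U j)" using Suc.prems(1)[of j] Suc.prems(1)[of "Suc j"] by (simp add: tow_Suc)
  qed (use v Suc.prems in auto)
  moreover have "power_steps k V EP nb E B v w'"
    by (rule Suc.IH[of "Suc j"]) (use Suc.prems v in auto)
  ultimately show ?case using v(1) by auto
qed

lemma tower_chain:
  assumes "finite B" "card B = tow l"
  obtains U where "\<And>i. i \<le> l \<Longrightarrow> U i \<subseteq> B \<and> card (U i) = tow i" "\<And>i. i < l \<Longrightarrow> U i \<subseteq> U (Suc i)" "U l = B"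
proof -
  obtain f where f: "bij_betw f {..<card B} B"
    using ex_bij_betw_nat_finite[OF assms(1)] by (auto simp: atLeast0LessThan)
  have mono: "tow i \<le> tow j" if "i \<le> j" for i j
    using strict_mono_tow that by (simp add: strict_mono_less_eq)
  show ?thesis
  proof (rule that[of "\<lambda>i. f ` {..<tow i}"])
    fix i assume i: "i \<le> l"
    have "{..<tow i} \<subseteq> {..<card B}" using mono[OF i] assms by auto
    then show "f ` {..<tow i} \<subseteq> B \<and> card (f ` {..<tow i}) = tow i"
      using f by (metis bij_betw_def card_image card_lessThan image_mono inj_on_subset)
  next
    show "f ` {..<tow i} \<subseteq> f ` {..<tow (Suc i)}" for i
      using mono[of i "Suc i"] by (intro image_mono) auto
    show "f ` {..<tow l} = B" using f assms by (simp add: bij_betw_def)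
  qed
qed

text \<open>The witness is any neighbourhood of exactly \<open>tow l\<close> elements. It carries a
  full chain of power steps, and it has no companion because \<open>V\<close> has fewer than
  \<open>2 ^ (2 ^ tow l)\<close> elements.\<close>

lemma rich_max_tower:
  assumes V: "finite V" "\<And>es. es \<in> EP \<Longrightarrow> nb es \<subseteq> V" and rich: "rich t V CP EP nb E"
    and l: "2 * tow l \<le> t" "l \<ge> 1" and n: "card V < 2 ^ (2 ^ tow l)" and k: "k dvd l"
  shows "max_tower k V CP EP nb E"
proof -
  have t: "tow l \<le> t" "Suc l \<le> t\<^sup>2"
  proof -
    show "tow l \<le> t" using l by simp
    have "Suc l \<le> 2 * tow l" using le_tow[of l] l(2) by simp
    also have "\<dots> \<le> t" by fact
    also have "\<dots> \<le> t\<^sup>2" by (simp add: power2_nat_le_imp_le self_le_ge2_pow)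
    finally show "Suc l \<le> t\<^sup>2" .
  qed
  obtain es0 where es0: "es0 \<in> EP" "card (nb es0) = tow l"
    using richD_avoiding[OF rich, of "{}" "tow l"] t by auto
  define B where "B = nb es0"
  have B: "B \<subseteq> V" "finite B" "card B = tow l" "card B \<le> t"
    using V(2)[OF es0(1)] finite_subset[OF _ V(1)] es0 t by (auto simp: B_def)
  obtain cs where cs: "cs \<in> CP" "code_all V (E cs) B" "\<And>\<tau>. \<tau> \<subseteq> B \<Longrightarrow> \<exists>w\<in>V. \<forall>b\<in>B. E cs w b \<longleftrightarrow> b \<in> \<tau>"
    "\<And>T. T \<subseteq> Pow B \<Longrightarrow> card T \<le> t\<^sup>2 \<Longrightarrow> \<exists>es\<in>EP. (\<lambda>z. {b\<in>B. E cs z b}) ` nb es = T"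
    by (rule richD[OF rich B(1,4)]) blast
  obtain U where U: "\<And>i. i \<le> l \<Longrightarrow> U i \<subseteq> B \<and> card (U i) = tow i" "\<And>i. i < l \<Longrightarrow> U i \<subseteq> U (Suc i)" "U l = B"
    by (rule tower_chain[OF B(2,3)]) blast
  \<comment> \<open>Only the links with index divisible by \<open>k\<close> are taken; as
    \<open>k\<close> divides \<open>l\<close>, the last of them is \<open>U l = B\<close>.\<close>
  define T where "T = U ` {i. i \<le> l \<and> k dvd i}"
  have "card T \<le> card {..l}" unfolding T_def
    by (rule order_trans[OF card_image_le card_mono]) auto
  then have "card T \<le> t\<^sup>2" using t by simp
  moreover have "T \<subseteq> Pow B" using U by (auto simp: T_def)
  ultimately have "\<exists>X\<in>EP. (\<lambda>z. {b\<in>B. E cs z b}) ` nb X = T"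
    by (intro cs(4))
  then obtain es where es: "es \<in> EP" "(\<lambda>z. {b\<in>B. E cs z b}) ` nb es = T"
    by (elim bexE)
  have "tower k V EP nb (E cs) B"
    unfolding tower_def
  proof (intro bexI[OF _ es(1)] conjI ballI)
    have "U 0 \<in> T" by (auto simp: T_def)
    then obtain y where y: "y \<in> nb es" "U 0 = {b\<in>B. E cs y b}" using es(2) by blast
    have "U 0 = {}" using U(1)[of 0] B(2) finite_subset[of "U 0" B] by simp
    then show "\<exists>y\<in>nb es. \<forall>b\<in>B. \<not> E cs y b" using y by blast
  next
    fix y assume y: "y \<in> nb es"
    then have "{b\<in>B. E cs y b} \<in> T" using es(2) by blast
    then obtain i where i: "i \<le> l" "k dvd i" "{b\<in>B. E cs y b} = U i" by (auto simp: T_def)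
    show "(\<forall>b\<in>B. E cs y b) \<or> (\<exists>y'\<in>nb es. power_steps k V EP nb (E cs) B y y')"
    proof (cases "i = l")
      case True
      then show ?thesis using i U(3) by blast
    next
      case False
      \<comment> \<open>A positive multiple of \<open>k\<close> remains up to \<open>l\<close>, so a
        jump of \<open>k\<close> power steps cannot overshoot.\<close>
      have "k dvd l - i" using i k by simp
      then have "k \<le> l - i" using False i by (intro dvd_imp_le) auto
      then have il: "k + i \<le> l" using i False by simp
      have "U (k + i) \<in> T" using il i by (auto simp: T_def)
      then obtain y' where y': "y' \<in> nb es" "U (k + i) = {b\<in>B. E cs y' b}" using es(2) by blast
      have "power_steps k V EP nb (E cs) B y y'"
        by (rule power_stepsI[OF cs(3,4) B(2,4), where U = U and j = i]) (use U il i y' in auto)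
      then show ?thesis using y' by blast
    qed
  qed
  moreover have "\<not> extendable V CP EP nb E B"
  proof
    assume "extendable V CP EP nb E B"
    from extendable_card[OF this V(1) B(1) V(2)] show False using n B(3) by simp
  qed
  ultimately show ?thesis
    unfolding max_tower_def B_def using cs(2)[unfolded B_def]
    by (intro bexI[OF _ cs(1)] bexI[OF _ es0(1)] conjI)
qed

text \<open>A coded tower has size \<open>tow (k * j)\<close>, and this is below
  \<open>2 ^ tow l\<close>, hence below \<open>tow (Suc l)\<close>. So \<open>k * j \<le> l\<close>,
  with equality excluded by \<open>k\<close> not dividing \<open>l\<close>. Then \<open>B\<close>
  and a disjoint set of \<open>2 ^ card B\<close> elements have together at most
  \<open>tow l \<le> t\<close> elements, so that richness codes their union and makes the second set
  a companion of \<open>B\<close>.\<close>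

lemma rich_not_max_tower:
  assumes V: "finite V" "\<And>es. es \<in> EP \<Longrightarrow> nb es \<subseteq> V" and rich: "rich t V CP EP nb E"
    and l: "2 * tow l \<le> t" "l \<ge> 1" and n: "card V < 2 ^ (2 ^ tow l)" and k: "k \<ge> 1" "\<not> k dvd l"
  shows "\<not> max_tower k V CP EP nb E"
proof
  assume "max_tower k V CP EP nb E"
  then obtain cs0 es0 where *: "cs0 \<in> CP" "es0 \<in> EP" "code_all V (E cs0) (nb es0)"
    "tower k V EP nb (E cs0) (nb es0)" "\<not> extendable V CP EP nb E (nb es0)"
    unfolding max_tower_def by (elim bexE conjE) (rule that)
  define B where "B = nb es0"
  have B: "B \<subseteq> V" "finite B" using V(2)[OF *(2)] finite_subset[OF _ V(1)] by (auto simp: B_def)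
  obtain j where j: "card B = tow (k * j)"
    using tower_card[OF _ _ *(4) k(1)] *(3) B by (auto simp: B_def)
  have "2 ^ card B \<le> card V" using code_all_card[OF *(3)] B V by (simp add: B_def)
  then have "(2::nat) ^ card B < 2 ^ (2 ^ tow l)" using n by linarith
  then have "tow (k * j) < 2 ^ tow l" using j by simp
  also have "\<dots> \<le> tow (Suc l)" by (simp add: tow_Suc)
  finally have "k * j < Suc l" using strict_mono_less[OF strict_mono_tow] by blast
  moreover have "k * j \<noteq> l" using k(2) by auto
  ultimately have kj: "Suc (k * j) \<le> l" by simp
  have "card B + 2 ^ card B = tow (Suc (k * j))" using j by (simp add: tow_Suc)
  also have "\<dots> \<le> tow l" using kj strict_mono_less_eq[OF strict_mono_tow] by blast
  finally have small: "card B + 2 ^ card B \<le> tow l" .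
  then have "card B \<le> t" "2 ^ card B \<le> t" using l by linarith+
  then obtain es1 where es1: "es1 \<in> EP" "card (nb es1) = 2 ^ card B" "nb es1 \<inter> B = {}"
    using richD_avoiding[OF rich B(1)] by blast
  define B' where "B' = nb es1"
  have B': "B' \<subseteq> V" "finite B'" "card B' = 2 ^ card B" "B' \<inter> B = {}"
    using V(2)[OF es1(1)] finite_subset[OF _ V(1)] es1 by (auto simp: B'_def)
  have "card (B \<union> B') \<le> card B + card B'" by (rule card_Un_le)
  then have cu: "card (B \<union> B') \<le> t" using small B' l by linarith
  obtain cs where cs: "cs \<in> CP" "code_all V (E cs) (B \<union> B')" "\<And>\<tau>. \<tau> \<subseteq> B \<union> B' \<Longrightarrow> \<exists>w\<in>V. \<forall>b\<in>B \<union> B'. E cs w b \<longleftrightarrow> b \<in> \<tau>"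
    "\<And>T. T \<subseteq> Pow (B \<union> B') \<Longrightarrow> card T \<le> t\<^sup>2 \<Longrightarrow> \<exists>es\<in>EP. (\<lambda>z. {b\<in>B \<union> B'. E cs z b}) ` nb es = T"
    by (rule richD[OF rich Un_least[OF B(1) B'(1)] cu]) blast
  have codes: "code_all V (E cs) B" "code_all V (E cs) B'"
  proof -
    show "code_all V (E cs) B"
    proof (rule code_allI)
      fix \<tau> assume "\<tau> \<subseteq> B" then show "\<exists>w\<in>V. \<forall>b\<in>B. E cs w b \<longleftrightarrow> b \<in> \<tau>" using cs(3)[of \<tau>] by blast
    qed
    show "code_all V (E cs) B'"
    proof (rule code_allI)
      fix \<tau> assume "\<tau> \<subseteq> B'" then show "\<exists>w\<in>V. \<forall>b\<in>B'. E cs w b \<longleftrightarrow> b \<in> \<tau>" using cs(3)[of \<tau>] by blast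
    qed
  qed
  have "card B' = card (Pow B)" using B B' by (simp add: card_Pow)
  then obtain h where h: "bij_betw h B' (Pow B)"
    using finite_same_card_bij[of B' "Pow B"] B B' by auto
  define R where "R = {(b', b). b' \<in> B' \<and> b \<in> h b'}"
  have R: "R \<subseteq> B' \<times> B" using bij_betwE[OF h] by (auto simp: R_def)
  have "card {{b', b} |b' b. (b', b) \<in> R} \<le> card B' * card B"
    by (rule card_pairs_le[OF B'(2) B(2) R])
  also have "\<dots> \<le> t * t" using B'(3) \<open>card B \<le> t\<close> \<open>2 ^ card B \<le> t\<close> by (intro mult_le_mono) simp_all
  finally have "card {{b', b} |b' b. (b', b) \<in> R} \<le> t\<^sup>2" by (simp add: power2_eq_square)
  moreover have "{{b', b} |b' b. (b', b) \<in> R} \<subseteq> Pow (B \<union> B')" using R by auto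
  ultimately have "\<exists>X\<in>EP. (\<lambda>z. {b\<in>B \<union> B'. E cs z b}) ` nb X = {{b', b} |b' b. (b', b) \<in> R}"
    by (intro cs(4))
  then obtain es2 where es2: "es2 \<in> EP" "(\<lambda>z. {b\<in>B \<union> B'. E cs z b}) ` nb es2 = {{b', b} |b' b. (b', b) \<in> R}"
    by (elim bexE)
  have lk: "linked (E cs) (nb es2) b' b \<longleftrightarrow> b \<in> h b'" if "b' \<in> B'" "b \<in> B" for b' b
    using linked_family[OF es2(2) R _ _ _ that] B' that by (auto simp: R_def)
  have "\<exists>b'\<in>B'. \<forall>b\<in>B. E cs v b \<longleftrightarrow> linked (E cs) (nb es2) b' b" for v
  proof -
    obtain b' where "b' \<in> B'" "h b' = {b\<in>B. E cs v b}"
      using bij_betw_imp_surj_on[OF h] by (metis (no_types, lifting) Pow_iff imageE mem_Collect_eq subsetI)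
    then show ?thesis using lk by (intro bexI[of _ b']) auto
  qed
  with codes have "extendable V CP EP nb E B"
    unfolding extendable_def B'_def
    by (intro bexI[OF _ cs(1)] bexI[OF _ es1(1)] bexI[OF _ es2(1)] conjI ballI) simp_all
  then show False using *(5) by (simp add: B_def)
qed

section \<open>The digraph of isolated tuples\<close>

definition tuples :: "nat \<Rightarrow> 'a set \<Rightarrow> 'a list set" where
  "tuples m V = {as. length as = m \<and> set as \<subseteq> V}"

text \<open>Here the relation itself is used, not isolation: a row \<open>es\<close> has on average
  only of order \<open>ln n\<close> neighbours, so a neighbourhood can be small and can serve as a
  quantifiable finite set.\<close>

definition nbr :: "'a struct \<Rightarrow> 'a list \<Rightarrow> 'a set" where
  "nbr S es = {z\<in>fst S. snd S (es @ [z])}"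

text \<open>Reads off isolated tuples \<open>x # us @ [y]\<close>. A single one is isolated with
  probability about \<open>n\<close> to the power \<open>- (\<beta> + r)\<close>, and the
  \<open>n ^ r\<close> choices of \<open>us\<close> raise this to about \<open>n\<close> to the
  power \<open>- \<beta>\<close>.\<close>

definition arc :: "nat \<Rightarrow> 'a struct \<Rightarrow> 'a \<Rightarrow> 'a \<Rightarrow> bool" where
  "arc r S x y \<longleftrightarrow> (\<exists>us\<in>tuples r (fst S). \<forall>z\<in>fst S. \<not> snd S (x # us @ [y, z]))"

text \<open>The list \<open>ops\<close> is read from its end to its head; the entry of \<open>cs\<close> at a growing step is not used.\<close>

primrec reach :: "nat \<Rightarrow> bool list \<Rightarrow> 'a struct \<Rightarrow> 'a list \<Rightarrow> 'a \<Rightarrow> 'a \<Rightarrow> bool" where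
  "reach r [] S cs b y \<longleftrightarrow> y = b"
| "reach r (grow # ops) S cs b y \<longleftrightarrow>
     (if grow then \<exists>x\<in>fst S. reach r ops S (tl cs) b x \<and> arc r S y x
      else reach r ops S (tl cs) b y \<and> arc r S (hd cs) y)"

text \<open>The parameters \<open>cs\<close> are shared by all \<open>b\<close>, so that one tuple
  \<open>cs\<close> makes every vertex \<open>w\<close> the code of a subset of a whole set
  \<open>B\<close>.\<close>

definition code :: "nat \<Rightarrow> bool list \<Rightarrow> 'a struct \<Rightarrow> 'a list \<Rightarrow> 'a \<Rightarrow> 'a \<Rightarrow> bool" where
  "code r ops S cs w b \<longleftrightarrow> (\<exists>x\<in>fst S. reach r ops S cs b x \<and> arc r S w x)"

section \<open>Definability of arcs, codes and the tower sentences\<close>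

lemma definable_rel_append [definable_intros]:
  assumes "vars_proj N m ps" "Suc m = d" "var_proj N p"
  shows "definable d N (\<lambda>S xs. snd S (ps xs @ [p xs]))"
proof (rule definable_rel)
  have "vars_proj N (m + Suc 0) (\<lambda>xs. ps xs @ [p xs])"
    by (intro vars_proj_append definable_intros assms)
  then show "vars_proj N d (\<lambda>xs. ps xs @ [p xs])" using assms(2) by simp
qed

lemma definable_ex_tuples [definable_intros]:
  assumes "definable d (m + N) (\<lambda>S xs. \<Phi> S (drop m xs) (take m xs))"
  shows "definable d N (\<lambda>S xs. \<exists>as\<in>tuples m (fst S). \<Phi> S xs as)"
  using definable_exs[OF assms] by (simp add: tuples_def Bex_def)

lemma definable_ex_nbr [definable_intros]:
  assumes "vars_proj N (r + 2) es" "definable (r + 3) (Suc N) (\<lambda>S xs. \<Phi> S (tl xs) (hd xs))"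
  shows "definable (r + 3) N (\<lambda>S xs. \<exists>a\<in>nbr S (es xs). \<Phi> S xs a)"
proof -
  have "definable (r + 3) N (\<lambda>S xs. \<exists>a\<in>fst S. snd S (es xs @ [a]) \<and> \<Phi> S xs a)"
    by (intro definable_ex definable_conj definable_rel_append[where m = "r + 2"] vars_proj_tl var_proj_hd assms) simp
  then show ?thesis by (rule definable_cong) (auto simp: nbr_def)
qed

lemma definable_all_nbr [definable_intros]:
  assumes "vars_proj N (r + 2) es" "definable (r + 3) (Suc N) (\<lambda>S xs. \<Phi> S (tl xs) (hd xs))"
  shows "definable (r + 3) N (\<lambda>S xs. \<forall>a\<in>nbr S (es xs). \<Phi> S xs a)"
proof -
  have "definable (r + 3) N (\<lambda>S xs. \<not> (\<exists>a\<in>nbr S (es xs). \<not> \<Phi> S xs a))"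
    by (intro definable_not definable_ex_nbr assms)
  then show ?thesis by simp
qed

lemma definable_arc [definable_intros]:
  assumes "var_proj N p" "var_proj N q"
  shows "definable (r + 3) N (\<lambda>S xs. arc r S (p xs) (q xs))"
proof -
  have rel: "definable (r + 3) M (\<lambda>S xs. snd S (p xs # us xs @ [q xs, z xs]))"
    if "var_proj M p" "var_proj M q" "var_proj M z" "vars_proj M r us" for M and p q z :: "'a list \<Rightarrow> 'a" and us
  proof -
    have "vars_proj M (Suc (r + Suc (Suc 0))) (\<lambda>xs. p xs # us xs @ [q xs, z xs])"
      by (intro vars_proj_append definable_intros that)
    moreover have "Suc (r + Suc (Suc 0)) = r + 3" by simp
    ultimately show ?thesis by (intro definable_rel) (simp only:)
  qed
  show ?thesis
    unfolding arc_def
    by (intro definable_ex_tuples definable_all definable_not rel var_proj_hd var_proj_tl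
      vars_proj_tl vars_proj_take var_proj_drop assms)
qed

lemma var_proj_hd_vars [definable_intros]: "vars_proj N (Suc m) cs \<Longrightarrow> var_proj N (\<lambda>xs. hd (cs xs))"
  and vars_proj_tl_vars [definable_intros]: "vars_proj N (Suc m) cs \<Longrightarrow> vars_proj N m (\<lambda>xs. tl (cs xs))"
proof -
  assume "vars_proj N (Suc m) cs"
  then obtain "is" where *: "length is = Suc m" "set is \<subseteq> {..<N}" "\<forall>xs. length xs = N \<longrightarrow> cs xs = map ((!) xs) is"
    unfolding vars_proj_def by blast
  then obtain i js where ijs: "is = i # js" by (cases "is") auto
  show "var_proj N (\<lambda>xs. hd (cs xs))"
    unfolding var_proj_def by (rule exI[of _ i]) (use * ijs in auto)
  show "vars_proj N m (\<lambda>xs. tl (cs xs))"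
    unfolding vars_proj_def by (rule exI[of _ js]) (use * ijs in auto)
qed

lemma definable_reach [definable_intros]:
  assumes "vars_proj N (length ops) cs" "var_proj N p" "var_proj N q"
  shows "definable (r + 3) N (\<lambda>S xs. reach r ops S (cs xs) (p xs) (q xs))"
  using assms
proof (induction ops arbitrary: N cs p q)
  case Nil
  then show ?case by (auto intro!: definable_intros)
next
  case (Cons grow ops)
  have tl: "vars_proj N (length ops) (\<lambda>xs. tl (cs xs))" and hd: "var_proj N (\<lambda>xs. hd (cs xs))"
    using Cons.prems(1) by (auto intro: var_proj_hd_vars vars_proj_tl_vars)
  show ?case
  proof (cases grow)
    case True
    have "definable (r + 3) N (\<lambda>S xs. \<exists>x\<in>fst S. reach r ops S (tl (cs xs)) (p xs) x \<and> arc r S (q xs) x)"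
      by (intro definable_ex definable_conj Cons.IH definable_arc var_proj_hd var_proj_tl vars_proj_tl tl hd Cons.prems)
    then show ?thesis using True by simp
  next
    case False
    have "definable (r + 3) N (\<lambda>S xs. reach r ops S (tl (cs xs)) (p xs) (q xs) \<and> arc r S (hd (cs xs)) (q xs))"
      by (intro definable_conj Cons.IH definable_arc tl hd Cons.prems)
    then show ?thesis using False by simp
  qed
qed

lemma definable_code [definable_intros]:
  assumes "vars_proj N (length ops) cs" "var_proj N p" "var_proj N q"
  shows "definable (r + 3) N (\<lambda>S xs. code r ops S (cs xs) (p xs) (q xs))"
  unfolding code_def
  by (intro definable_ex definable_conj definable_reach definable_arc var_proj_hd var_proj_tl vars_proj_tl assms)

lemmas var_intros = var_proj_hd var_proj_tl vars_proj_tl vars_proj_take var_proj_drop vars_proj_drop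
lemmas connective_intros = definable_ex definable_all definable_ex_tuples definable_ex_nbr definable_all_nbr
  definable_conj definable_disj definable_imp definable_iff definable_not definable_eq definable_code

lemma definable_code_all:
  assumes "vars_proj N (length ops) cs" "vars_proj N (r + 2) es"
  shows "definable (r + 3) N (\<lambda>S xs. code_all (fst S) (code r ops S (cs xs)) (nbr S (es xs)))"
  unfolding code_all_def by (intro connective_intros var_intros assms)

lemma definable_linked:
  assumes "vars_proj N (length ops) cs" "vars_proj N (r + 2) es" "var_proj N p" "var_proj N q"
  shows "definable (r + 3) N (\<lambda>S xs. linked (code r ops S (cs xs)) (nbr S (es xs)) (p xs) (q xs))"
  unfolding linked_def by (intro connective_intros var_intros assms)

lemma definable_power_step:
  assumes "vars_proj N (length ops) cs" "vars_proj N (r + 2) es" "var_proj N p" "var_proj N q"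
  shows "definable (r + 3) N (\<lambda>S xs. power_step (fst S) (tuples (r + 2) (fst S)) (nbr S)
           (code r ops S (cs xs)) (nbr S (es xs)) (p xs) (q xs))"
  unfolding power_step_def by (intro connective_intros definable_linked var_intros assms)

lemma definable_power_steps:
  assumes "vars_proj N (length ops) cs" "vars_proj N (r + 2) es" "var_proj N p" "var_proj N q"
  shows "definable (r + 3) N (\<lambda>S xs. power_steps k (fst S) (tuples (r + 2) (fst S)) (nbr S)
           (code r ops S (cs xs)) (nbr S (es xs)) (p xs) (q xs))"
  using assms
proof (induction k arbitrary: N cs es p q)
  case 0
  show ?case unfolding power_steps.simps by (intro connective_intros var_intros 0)
next
  case (Suc k)
  show ?case unfolding power_steps.simps
    by (intro definable_ex definable_conj definable_power_step Suc.IH var_intros Suc.prems)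
qed

lemma definable_tower:
  assumes "vars_proj N (length ops) cs" "vars_proj N (r + 2) es"
  shows "definable (r + 3) N (\<lambda>S xs. tower k (fst S) (tuples (r + 2) (fst S)) (nbr S)
           (code r ops S (cs xs)) (nbr S (es xs)))"
  unfolding tower_def by (intro connective_intros definable_power_steps var_intros assms)

lemma definable_extendable:
  assumes "vars_proj N (r + 2) es"
  shows "definable (r + 3) N (\<lambda>S xs. extendable (fst S) (tuples (length ops) (fst S)) (tuples (r + 2) (fst S))
           (nbr S) (code r ops S) (nbr S (es xs)))"
  unfolding extendable_def by (intro definable_ex_tuples definable_conj definable_code_all
    definable_linked connective_intros var_intros assms)

lemma definable_max_tower:
  "definable (r + 3) N (\<lambda>S xs. max_tower k (fst S) (tuples (length ops) (fst S)) (tuples (r + 2) (fst S))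
     (nbr S) (code r ops S))"
  unfolding max_tower_def
  by (intro definable_ex_tuples definable_conj definable_not definable_code_all definable_tower
    definable_extendable var_intros)

section \<open>Union bounds for random digraphs\<close>

lemma prob_Pi_bernoulli_component:
  fixes p :: real
  assumes "finite A" "x \<in> A" "0 \<le> p" "p \<le> 1"
  shows "measure_pmf.prob (Pi_pmf A False (\<lambda>_. bernoulli_pmf p)) {f. f x} = p"
    and "measure_pmf.prob (Pi_pmf A False (\<lambda>_. bernoulli_pmf p)) {f. \<not> f x} = 1 - p"
proof -
  let ?M = "Pi_pmf A False (\<lambda>_. bernoulli_pmf p)"
  have *: "map_pmf (\<lambda>f. f x) ?M = bernoulli_pmf p"
    using assms by (simp add: Pi_pmf_component)
  have "measure_pmf.prob ?M {f. f x} = measure_pmf.prob (map_pmf (\<lambda>f. f x) ?M) {True}"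
    by (simp add: vimage_def)
  also have "\<dots> = p" unfolding * using assms by (simp add: measure_pmf_single)
  finally show "measure_pmf.prob ?M {f. f x} = p" .
  have "measure_pmf.prob ?M {f. \<not> f x} = measure_pmf.prob (map_pmf (\<lambda>f. f x) ?M) {False}"
    by (simp add: vimage_def)
  also have "\<dots> = 1 - p" unfolding * using assms by (simp add: measure_pmf_single)
  finally show "measure_pmf.prob ?M {f. \<not> f x} = 1 - p" .
qed

lemma prob_Pi_bernoulli_none:
  fixes p :: real
  assumes "finite A" "finite Z" "inj_on g Z" "g ` Z \<subseteq> A" "0 \<le> p" "p \<le> 1"
  shows "measure_pmf.prob (Pi_pmf A False (\<lambda>_. bernoulli_pmf p)) {f. \<forall>z\<in>Z. \<not> f (g z)} = (1 - p) ^ card Z"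
proof -
  let ?M = "Pi_pmf A False (\<lambda>_. bernoulli_pmf p)"
  have "measure_pmf.prob ?M {f. \<forall>z\<in>Z. \<not> f (g z)} = (\<Prod>z\<in>Z. measure_pmf.prob ?M {f. \<not> f (g z)})"
    by (rule prob_Pi_pmf_blocks[where blk = "\<lambda>z. {g z}"])
      (use assms in \<open>auto simp: disjoint_family_on_def inj_on_eq_iff\<close>)
  also have "\<dots> = (\<Prod>z\<in>Z. 1 - p)"
    by (rule prod.cong[OF refl], rule prob_Pi_bernoulli_component) (use assms in auto)
  finally show ?thesis by simp
qed

text \<open>The events that \<open>y\<close> is the only element hit are disjoint for different
  \<open>y\<close>, so their probabilities add up.\<close>

lemma prob_Pi_bernoulli_unique:
  fixes p :: real
  assumes "finite A" "finite Y" "inj_on g Y" "g ` Y \<subseteq> A" "0 \<le> p" "p \<le> 1"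
  shows "card Y * p * (1 - p) ^ card Y
     \<le> measure_pmf.prob (Pi_pmf A False (\<lambda>_. bernoulli_pmf p)) {f. \<exists>!y. y \<in> Y \<and> f (g y)}"
proof -
  let ?M = "Pi_pmf A False (\<lambda>_. bernoulli_pmf p)"
  let ?E = "\<lambda>y. {f. f (g y) \<and> (\<forall>z\<in>Y - {y}. \<not> f (g z))}"
  have E: "p * (1 - p) ^ card Y \<le> measure_pmf.prob ?M (?E y)" if y: "y \<in> Y" for y
  proof -
    have "measure_pmf.prob ?M (?E y) = measure_pmf.prob ?M {f. f (g y)} * measure_pmf.prob ?M {f. \<forall>z\<in>Y - {y}. \<not> f (g z)}"
      by (rule prob_Pi_pmf_conj[where B = "{g y}" and C = "g ` (Y - {y})"])
        (use assms y in \<open>auto simp: inj_on_eq_iff\<close>)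
    also have "\<dots> = p * (1 - p) ^ card (Y - {y})"
      using assms y by (subst prob_Pi_bernoulli_none) (auto simp: prob_Pi_bernoulli_component inj_on_diff)
    also have "\<dots> \<ge> p * (1 - p) ^ card Y"
      using assms by (intro mult_left_mono power_decreasing card_mono) auto
    finally show ?thesis .
  qed
  have "card Y * p * (1 - p) ^ card Y = (\<Sum>y\<in>Y. p * (1 - p) ^ card Y)" by simp
  also have "\<dots> \<le> (\<Sum>y\<in>Y. measure_pmf.prob ?M (?E y))" by (intro sum_mono E)
  also have "\<dots> = measure_pmf.prob ?M (\<Union>y\<in>Y. ?E y)"
    by (rule measure_pmf.finite_measure_finite_Union[symmetric]) (use assms in \<open>auto simp: disjoint_family_on_def\<close>)
  also have "(\<Union>y\<in>Y. ?E y) = {f. \<exists>!y. y \<in> Y \<and> f (g y)}" by blast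
  finally show ?thesis .
qed

text \<open>Hitting each \<open>Y i\<close> exactly once, instead of at least once, has a lower
  bound by a plain sum and later gives neighbourhoods of an exactly prescribed size.\<close>

definition pattern :: "('b \<Rightarrow> bool) \<Rightarrow> 'b set \<Rightarrow> 'i set \<Rightarrow> ('i \<Rightarrow> 'b set) \<Rightarrow> bool" where
  "pattern N Z I Y \<longleftrightarrow> (\<forall>z\<in>Z. \<not> N z) \<and> (\<forall>i\<in>I. \<exists>!y. y \<in> Y i \<and> N y)"

lemma pattern_cong: "(\<And>z. z \<in> Z \<union> (\<Union>i\<in>I. Y i) \<Longrightarrow> N z = N' z) \<Longrightarrow> pattern N Z I Y = pattern N' Z I Y"
proof -
  assume *: "\<And>z. z \<in> Z \<union> (\<Union>i\<in>I. Y i) \<Longrightarrow> N z = N' z"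
  have "(\<exists>!y. y \<in> Y i \<and> N y) \<longleftrightarrow> (\<exists>!y. y \<in> Y i \<and> N' y)" if "i \<in> I" for i
    using * that by (metis UN_iff UnI2)
  moreover have "N z = N' z" if "z \<in> Z" for z using * that by blast
  ultimately show ?thesis unfolding pattern_def by simp
qed

text \<open>The sets \<open>Z\<close> and \<open>Y i\<close> are pairwise disjoint, so the
  probabilities multiply. Each \<open>Y i\<close> contributes at least \<open>a\<close>, and all
  inspected coordinates together contribute at least \<open>(1 - p) ^ u\<close> for their
  absence.\<close>

lemma prob_pattern:
  fixes p a :: real
  assumes "finite A" "finite V" "inj_on g V" "g ` V \<subseteq> A" "0 \<le> p" "p \<le> 1"
    and "finite I" "Z \<subseteq> V" "\<And>i. i \<in> I \<Longrightarrow> Y i \<subseteq> V - Z" "disjoint_family_on Y I"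
    and a: "0 \<le> a" "\<And>i. i \<in> I \<Longrightarrow> a \<le> card (Y i) * p" and u: "card Z + (\<Sum>i\<in>I. card (Y i)) \<le> u"
  shows "a ^ card I * (1 - p) ^ u
     \<le> measure_pmf.prob (Pi_pmf A False (\<lambda>_. bernoulli_pmf p)) {f. pattern (\<lambda>y. f (g y)) Z I Y}"
proof -
  let ?M = "Pi_pmf A False (\<lambda>_. bernoulli_pmf p)"
  have fin: "finite Z" "\<And>i. i \<in> I \<Longrightarrow> finite (Y i)"
    using assms(2,8,9) by (auto intro: finite_subset)
  have sub: "inj_on g X" "g ` X \<subseteq> A" if "X \<subseteq> V" for X
    using that assms(3,4) by (auto intro: inj_on_subset)
  have YV: "Y i \<subseteq> V" if "i \<in> I" for i using assms(9)[OF that] by blast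
  have inj: "g x = g y \<longleftrightarrow> x = y" if "x \<in> V" "y \<in> V" for x y
    using that assms(3) by (simp add: inj_on_eq_iff)
  have "a ^ card I * (1 - p) ^ u \<le> a ^ card I * (1 - p) ^ (card Z + (\<Sum>i\<in>I. card (Y i)))"
    using assms by (intro mult_left_mono power_decreasing) auto
  also have "\<dots> = (1 - p) ^ card Z * (\<Prod>i\<in>I. a * (1 - p) ^ card (Y i))"
    by (simp add: power_add power_sum prod.distrib mult_ac)
  also have "\<dots> \<le> (1 - p) ^ card Z * (\<Prod>i\<in>I. measure_pmf.prob ?M {f. \<exists>!y. y \<in> Y i \<and> f (g y)})"
  proof (intro mult_left_mono prod_mono conjI)
    fix i assume i: "i \<in> I"
    have "a * (1 - p) ^ card (Y i) \<le> card (Y i) * p * (1 - p) ^ card (Y i)"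
      using a(2)[OF i] assms(6) by (intro mult_right_mono) auto
    also have "\<dots> \<le> measure_pmf.prob ?M {f. \<exists>!y. y \<in> Y i \<and> f (g y)}"
      by (rule prob_Pi_bernoulli_unique) (use assms fin i sub[OF YV[OF i]] in auto)
    finally show "a * (1 - p) ^ card (Y i) \<le> measure_pmf.prob ?M {f. \<exists>!y. y \<in> Y i \<and> f (g y)}" .
  qed (use assms in auto)
  also have "(\<Prod>i\<in>I. measure_pmf.prob ?M {f. \<exists>!y. y \<in> Y i \<and> f (g y)})
      = measure_pmf.prob ?M {f. \<forall>i\<in>I. \<exists>!y. y \<in> Y i \<and> f (g y)}"
  proof (rule prob_Pi_pmf_blocks[symmetric, where blk = "\<lambda>i. g ` Y i"])
    show "disjoint_family_on (\<lambda>i. g ` Y i) I"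
      unfolding disjoint_family_on_def
    proof (intro ballI impI)
      fix i j assume ij: "i \<in> I" "j \<in> I" "i \<noteq> j"
      then have "Y i \<inter> Y j = {}" using assms(10) by (auto simp: disjoint_family_on_def)
      then have "g ` (Y i \<inter> Y j) = {}" by simp
      then show "g ` Y i \<inter> g ` Y j = {}"
        using inj_on_image_Int[OF assms(3) YV[OF ij(1)] YV[OF ij(2)]] by simp
    qed
    show "g ` Y i \<subseteq> A" if "i \<in> I" for i using sub(2)[OF YV[OF that]] .
    show "(\<exists>!y. y \<in> Y i \<and> f (g y)) \<longleftrightarrow> (\<exists>!y. y \<in> Y i \<and> f' (g y))" if "\<forall>x\<in>g ` Y i. f x = f' x" for i f f'
      using that by (metis imageI)
  qed (use assms in auto)
  also have "(1 - p) ^ card Z = measure_pmf.prob ?M {f. \<forall>z\<in>Z. \<not> f (g z)}"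
    by (rule prob_Pi_bernoulli_none[symmetric]) (use assms fin sub[OF assms(8)] in auto)
  also have "measure_pmf.prob ?M {f. \<forall>z\<in>Z. \<not> f (g z)} * measure_pmf.prob ?M {f. \<forall>i\<in>I. \<exists>!y. y \<in> Y i \<and> f (g y)}
     = measure_pmf.prob ?M {f. (\<forall>z\<in>Z. \<not> f (g z)) \<and> (\<forall>i\<in>I. \<exists>!y. y \<in> Y i \<and> f (g y))}"
  proof (rule prob_Pi_pmf_conj[symmetric, where B = "g ` Z" and C = "g ` (\<Union>i\<in>I. Y i)"])
    have UV: "(\<Union>i\<in>I. Y i) \<subseteq> V" "Z \<inter> (\<Union>i\<in>I. Y i) = {}" using assms(9) by blast+
    show "g ` (\<Union>i\<in>I. Y i) \<subseteq> A" by (rule sub(2)[OF UV(1)])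
    show "g ` Z \<subseteq> A" by (rule sub(2)[OF assms(8)])
    show "g ` Z \<inter> g ` (\<Union>i\<in>I. Y i) = {}"
      using inj_on_image_Int[OF assms(3,8) UV(1)] UV(2) by simp
    show "(\<forall>i\<in>I. \<exists>!y. y \<in> Y i \<and> f (g y)) \<longleftrightarrow> (\<forall>i\<in>I. \<exists>!y. y \<in> Y i \<and> f' (g y))"
      if "\<forall>x\<in>g ` (\<Union>i\<in>I. Y i). f x = f' x" for f f'
    proof (rule ball_cong[OF refl])
      fix i assume "i \<in> I"
      then have "f (g y) = f' (g y)" if "y \<in> Y i" for y
        using that \<open>\<forall>x\<in>g ` (\<Union>i\<in>I. Y i). f x = f' x\<close> by blast
      then show "(\<exists>!y. y \<in> Y i \<and> f (g y)) \<longleftrightarrow> (\<exists>!y. y \<in> Y i \<and> f' (g y))" by metis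
    qed
  qed (use assms in auto)
  finally show ?thesis unfolding pattern_def .
qed

text \<open>A set of at most \<open>k\<close> elements is listed by a word of length
  \<open>k\<close> over \<open>V\<close> and one padding symbol, here \<open>None\<close>.\<close>

lemma card_small_subsets:
  assumes "finite V"
  shows "card {S. S \<subseteq> V \<and> card S \<le> k} \<le> (card V + 1) ^ k"
proof -
  let ?W = "insert None (Some ` V)"
  have "{S. S \<subseteq> V \<and> card S \<le> k} \<subseteq> (\<lambda>xs. {v. Some v \<in> set xs}) ` {xs. set xs \<subseteq> ?W \<and> length xs = k}"
  proof safe
    fix S assume S: "S \<subseteq> V" "card S \<le> k"
    then obtain xs where xs: "set xs = S" "distinct xs"
      using finite_distinct_list finite_subset[OF _ assms] by metis
    have "length xs \<le> k" using S xs distinct_card by fastforce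
    then show "S \<in> (\<lambda>xs. {v. Some v \<in> set xs}) ` {xs. set xs \<subseteq> ?W \<and> length xs = k}"
      using xs S by (intro image_eqI[of _ _ "map Some xs @ replicate (k - length xs) None"]) auto
  qed
  moreover have "finite {xs. set xs \<subseteq> ?W \<and> length xs = k}"
    using assms by (intro finite_lists_length_eq) auto
  ultimately have "card {S. S \<subseteq> V \<and> card S \<le> k} \<le> card {xs. set xs \<subseteq> ?W \<and> length xs = k}"
    by (rule surj_card_le[rotated])
  also have "\<dots> = (card V + 1) ^ k"
    using assms by (subst card_lists_length_eq) (auto simp: card_image)
  finally show ?thesis .
qed

lemma prob_union_le:
  fixes c e :: real
  assumes "finite X" "\<And>x. x \<in> X \<Longrightarrow> measure_pmf.prob M {f. Q x f} \<le> e" "real (card X) \<le> c" "0 \<le> e"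
  shows "measure_pmf.prob M {f. \<exists>x\<in>X. Q x f} \<le> c * e"
proof -
  have "measure_pmf.prob M {f. \<exists>x\<in>X. Q x f} = measure_pmf.prob M (\<Union>x\<in>X. {f. Q x f})"
    by (rule arg_cong[where f = "measure_pmf.prob M"]) auto
  also have "\<dots> \<le> (\<Sum>x\<in>X. measure_pmf.prob M {f. Q x f})"
    by (rule measure_pmf.finite_measure_subadditive_finite) (use assms in auto)
  also have "\<dots> \<le> card X * e" using assms(2) by (rule sum_bounded_above)
  also have "\<dots> \<le> c * e" by (rule mult_right_mono) (use assms in auto)
  finally show ?thesis .
qed

abbreviation rand_digraph :: "'a set \<Rightarrow> real \<Rightarrow> ('a \<times> 'a \<Rightarrow> bool) pmf" where
  "rand_digraph V \<rho> \<equiv> Pi_pmf (V \<times> V) False (\<lambda>_. bernoulli_pmf \<rho>)"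

section \<open>Bad events in a random digraph\<close>

lemma disjoint_rows: "disjoint_family_on (\<lambda>x. {x} \<times> V) I"
  by (auto simp: disjoint_family_on_def)

lemma prob_large_in_degree:
  fixes \<rho> :: real
  assumes "finite V" "0 \<le> \<rho>" "\<rho> \<le> 1"
  shows "measure_pmf.prob (rand_digraph V \<rho>) {f. \<exists>x\<in>V. 4 * (card V * \<rho>) \<le> card {y\<in>V. f (y, x)}}
     \<le> card V * exp (- (card V * \<rho>))"
proof (rule prob_union_le)
  fix x assume x: "x \<in> V"
  show "measure_pmf.prob (rand_digraph V \<rho>) {f. 4 * (card V * \<rho>) \<le> card {y\<in>V. f (y, x)}} \<le> exp (- (card V * \<rho>))"
    by (rule prob_blocks_card_ge[where blk = "\<lambda>y. {(y, x)}"])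
      (use assms x in \<open>auto simp: disjoint_family_on_def prob_Pi_bernoulli_component\<close>)
qed (use assms in auto)

lemma prob_few_patterns:
  fixes a \<rho> :: real
  assumes V: "finite V" and \<rho>: "0 \<le> \<rho>" "\<rho> \<le> 1"
    and "finite I" "Z \<subseteq> V" "\<And>i. i \<in> I \<Longrightarrow> Y i \<subseteq> V - Z" "disjoint_family_on Y I"
    and a: "0 \<le> a" "\<And>i. i \<in> I \<Longrightarrow> a \<le> card (Y i) * \<rho>" and u: "card Z + (\<Sum>i\<in>I. card (Y i)) \<le> u"
  shows "measure_pmf.prob (rand_digraph V \<rho>) {f. real (card {w\<in>V. pattern (\<lambda>y. f (w, y)) Z I Y})
       \<le> card V * (a ^ card I * (1 - \<rho>) ^ u) / 4}
     \<le> exp (- (card V * (a ^ card I * (1 - \<rho>) ^ u) / 4))"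
proof (rule prob_blocks_card_le[where blk = "\<lambda>w. {w} \<times> V"])
  show "pattern (\<lambda>y. f (w, y)) Z I Y = pattern (\<lambda>y. g (w, y)) Z I Y"
    if "w \<in> V" "\<forall>x\<in>{w} \<times> V. f x = g x" for w f g
    by (rule pattern_cong) (use assms(5,6) that in fastforce)
  show "a ^ card I * (1 - \<rho>) ^ u \<le> measure_pmf.prob (rand_digraph V \<rho>) {f. pattern (\<lambda>y. f (w, y)) Z I Y}" if "w \<in> V" for w
    by (rule prob_pattern[where V = V]) (use assms that in \<open>auto simp: inj_on_def\<close>)
qed (use V in \<open>auto simp: disjoint_rows\<close>)

lemma one_minus_power_ge_half:
  fixes \<rho> :: real
  assumes "0 \<le> \<rho>" "\<rho> \<le> 1" "real u * \<rho> \<le> 1 / 2"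
  shows "1 / 2 \<le> (1 - \<rho>) ^ u"
  using Bernoulli_inequality[of "- \<rho>" u] assms by simp

text \<open>For \<open>card S = k\<close> there are at most
  \<open>(card V + 1) ^ ((1 + L) * k)\<close> pairs \<open>(S, Z)\<close>, and each is bad with
  probability at most \<open>exp (- k * card V * \<rho> / 8)\<close>. Both exponents are linear in
  \<open>k\<close>, so the condition \<open>e \<le> 0\<close> per element of \<open>S\<close>
  suffices, and the sum over \<open>k\<close> costs a factor \<open>card V\<close>.\<close>

lemma prob_not_expanding:
  fixes L :: nat and \<rho> :: real
  assumes V: "finite V" and \<rho>: "0 \<le> \<rho>" "\<rho> \<le> 1"
    and e: "(1 + real L) * ln (card V + 1) - card V * \<rho> / 8 = e" "e \<le> 0"
  shows "measure_pmf.prob (rand_digraph V \<rho>)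
     {f. \<exists>S\<subseteq>V. \<exists>Z\<subseteq>V - S. 1 \<le> card S \<and> card Z \<le> L * card S \<and> card S * (1 + real L) * \<rho> \<le> 1 / 2 \<and>
         real (card {y\<in>V. (\<exists>x\<in>S. f (y, x)) \<and> (\<forall>x\<in>Z. \<not> f (y, x))}) \<le> card V * \<rho> * card S / 8}
     \<le> card V * exp e" (is "?lhs \<le> _")
proof -
  let ?M = "rand_digraph V \<rho>"
  let ?Q = "\<lambda>k (S, Z) f. Z \<subseteq> V - S \<and> card S = k \<and> real k * (1 + real L) * \<rho> \<le> 1 / 2 \<and>
         real (card {y\<in>V. (\<exists>x\<in>S. f (y, x)) \<and> (\<forall>x\<in>Z. \<not> f (y, x))}) \<le> card V * \<rho> * k / 8"
  let ?F = "\<lambda>k. {S. S \<subseteq> V \<and> card S \<le> k} \<times> {Z. Z \<subseteq> V \<and> card Z \<le> L * k}"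
  have finF: "finite (?F k)" for k using V by auto
  have cardF: "real (card (?F k)) \<le> exp (k * ((1 + real L) * ln (card V + 1)))" for k
  proof -
    have "card (?F k) \<le> (card V + 1) ^ k * (card V + 1) ^ (L * k)"
      unfolding card_cartesian_product by (intro mult_le_mono card_small_subsets V)
    then have "real (card (?F k)) \<le> real ((card V + 1) ^ k * (card V + 1) ^ (L * k))"
      by (rule of_nat_mono)
    also have "\<dots> = exp (ln (card V + 1)) ^ (k + L * k)" by (simp add: power_add)
    also have "\<dots> = exp (k * ((1 + real L) * ln (card V + 1)))"
      by (subst exp_of_nat_mult[symmetric]) (simp add: algebra_simps)
    finally show ?thesis .
  qed
  have single: "measure_pmf.prob ?M {f. ?Q k SZ f} \<le> exp (- (k * (card V * \<rho> / 8)))"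
    if SZ: "SZ \<in> ?F k" for k SZ
  proof (cases "snd SZ \<subseteq> V - fst SZ \<and> card (fst SZ) = k \<and> real k * (1 + real L) * \<rho> \<le> 1 / 2")
    case False
    then have "{f. ?Q k SZ f} = {}" by (auto simp: case_prod_beta)
    then show ?thesis by simp
  next
    case True
    obtain S Z where eq: "SZ = (S, Z)" by (cases SZ)
    have SZ': "S \<subseteq> V" "Z \<subseteq> V - S" "card S = k" "card Z \<le> L * k" "real k * (1 + real L) * \<rho> \<le> 1 / 2"
      using True SZ eq by auto
    \<comment> \<open>The one-element index set \<open>{()}\<close> asks for exactly one arc into
      \<open>S\<close> and none into \<open>Z\<close>. The bound on
      \<open>k * (1 + L) * \<rho>\<close> keeps the factor for absent arcs above 1/2.\<close>
    let ?s = "(k * \<rho>) ^ card {()} * (1 - \<rho>) ^ (k + L * k)"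
    have "1 / 2 \<le> (1 - \<rho>) ^ (k + L * k)"
      by (rule one_minus_power_ge_half) (use \<rho> SZ' in \<open>simp_all add: algebra_simps\<close>)
    then have "(k * \<rho>) * (1 / 2) \<le> ?s"
      using \<rho> mult_left_mono[of "1/2" "(1 - \<rho>) ^ (k + L * k)" "k * \<rho>"] by simp
    then have s: "card V * \<rho> * k / 8 \<le> card V * ?s / 4"
      using mult_left_mono[of "(k * \<rho>) * (1 / 2)" ?s "card V / 4"] by (simp add: mult_ac)
    have "measure_pmf.prob ?M {f. ?Q k SZ f}
       \<le> measure_pmf.prob ?M {f. real (card {w\<in>V. pattern (\<lambda>y. f (w, y)) Z {()} (\<lambda>_. S)}) \<le> card V * ?s / 4}"
    proof (rule measure_pmf.finite_measure_mono, rule subsetI)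
      fix f assume "f \<in> {f. ?Q k SZ f}"
      then have Q: "?Q k SZ f" by simp
      have "card {w\<in>V. pattern (\<lambda>y. f (w, y)) Z {()} (\<lambda>_. S)}
          \<le> card {y\<in>V. (\<exists>x\<in>S. f (y, x)) \<and> (\<forall>x\<in>Z. \<not> f (y, x))}"
        by (rule card_mono) (use V in \<open>auto simp: pattern_def\<close>)
      then have "real (card {w\<in>V. pattern (\<lambda>y. f (w, y)) Z {()} (\<lambda>_. S)})
          \<le> card {y\<in>V. (\<exists>x\<in>S. f (y, x)) \<and> (\<forall>x\<in>Z. \<not> f (y, x))}" by simp
      also have "\<dots> \<le> card V * \<rho> * k / 8" using Q eq by simp
      also note s
      finally show "f \<in> {f. real (card {w\<in>V. pattern (\<lambda>y. f (w, y)) Z {()} (\<lambda>_. S)}) \<le> card V * ?s / 4}"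
        by simp
    qed simp
    also have "\<dots> \<le> exp (- (card V * ?s / 4))"
    proof (rule prob_few_patterns[OF V \<rho>])
      show "card Z + (\<Sum>i\<in>{()}. card S) \<le> k + L * k" using SZ' by simp
      show "0 \<le> real k * \<rho>" using \<rho> by simp
      show "real k * \<rho> \<le> card S * \<rho>" using SZ' by simp
    qed (use SZ' in \<open>auto simp: disjoint_family_on_def\<close>)
    also have "\<dots> \<le> exp (- (k * (card V * \<rho> / 8)))"
      using s by (simp add: mult_ac)
    finally show ?thesis .
  qed
  have level: "measure_pmf.prob ?M {f. \<exists>SZ\<in>?F k. ?Q k SZ f} \<le> exp e" if "k \<ge> 1" for k
  proof -
    have "measure_pmf.prob ?M {f. \<exists>SZ\<in>?F k. ?Q k SZ f}
       \<le> exp (k * ((1 + real L) * ln (card V + 1))) * exp (- (k * (card V * \<rho> / 8)))"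
      by (rule prob_union_le[OF finF single cardF]) auto
    also have "\<dots> = exp (k * e)" unfolding e(1)[symmetric] by (simp add: exp_add[symmetric] algebra_simps)
    also have "\<dots> \<le> exp e" using e(2) that mult_right_mono_neg[of 1 "real k" e] by simp
    finally show ?thesis .
  qed
  have "?lhs \<le> measure_pmf.prob ?M {f. \<exists>k\<in>{1..card V}. \<exists>SZ\<in>?F k. ?Q k SZ f}"
  proof (rule measure_pmf.finite_measure_mono, safe)
    fix f S Z assume *: "S \<subseteq> V" "Z \<subseteq> V - S" "1 \<le> card S" "card Z \<le> L * card S" "card S * (1 + real L) * \<rho> \<le> 1 / 2"
       "real (card {y\<in>V. (\<exists>x\<in>S. f (y, x)) \<and> (\<forall>x\<in>Z. \<not> f (y, x))}) \<le> card V * \<rho> * card S / 8"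
    have "card S \<le> card V" using * V by (intro card_mono)
    then show "\<exists>k\<in>{1..card V}. \<exists>SZ\<in>?F k. ?Q k SZ f"
      using * by (intro bexI[of _ "card S"] bexI[of _ "(S, Z)"]) auto
  qed simp
  also have "\<dots> \<le> card V * exp e"
    by (rule prob_union_le) (use level in auto)
  finally show ?thesis .
qed

text \<open>\<open>X b\<close> will be a whole reached set, to be kept small, and \<open>Y b\<close>
  its private part, to be kept large. A single \<open>c\<close> works for all \<open>b\<close> with
  probability at least 1/2, and different \<open>c\<close> have independent rows, so all fail with
  probability at most \<open>exp (- card V / 2)\<close>. This pays for the choice of
  \<open>B\<close>, \<open>X\<close> and \<open>Y\<close> as long as
  \<open>t * hi * ln (card V)\<close> is small against \<open>card V\<close>.\<close>

lemma prob_no_selector: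
  fixes hi t :: nat and lo \<rho> :: real
  assumes V: "finite V" and \<rho>: "0 \<le> \<rho>" "\<rho> \<le> 1"
    and t: "2 * real t * exp (- (lo * \<rho> / 4)) \<le> 1 / 2" and lo: "0 \<le> lo" "lo \<le> hi"
  shows "measure_pmf.prob (rand_digraph V \<rho>)
     {f. \<exists>B\<subseteq>V. card B \<le> t \<and> (\<exists>X Y. (\<forall>b\<in>B. X b \<subseteq> V \<and> card (X b) \<le> hi \<and> Y b \<subseteq> V \<and> card (Y b) \<le> hi \<and> lo \<le> card (Y b)) \<and>
         \<not> (\<exists>c\<in>V. \<forall>b\<in>B. real (card {y\<in>X b. f (c, y)}) < 4 * (hi * \<rho>) \<and> lo * \<rho> / 4 < card {y\<in>Y b. f (c, y)}))}
     \<le> (card V + 1) ^ (t + 2 * t * hi) * exp (- (card V / 2))" (is "?lhs \<le> _")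
proof -
  let ?M = "rand_digraph V \<rho>"
  let ?good = "\<lambda>B X Y c f. \<forall>b\<in>B. real (card {y\<in>X b. f (c, y)}) < 4 * (hi * \<rho>) \<and> lo * \<rho> / 4 < card {y\<in>Y b. f (c, y)}"
  let ?adm = "\<lambda>B X Y. \<forall>b\<in>B. X b \<subseteq> V \<and> card (X b) \<le> hi \<and> Y b \<subseteq> V \<and> card (Y b) \<le> hi \<and> lo \<le> card (Y b)"
  have half: "1 / 2 \<le> measure_pmf.prob ?M {f. ?good B X Y c f}"
    if B: "B \<subseteq> V" "card B \<le> t" and adm: "?adm B X Y" and c: "c \<in> V" for B X Y c
  proof -
    have finB: "finite B" using B V finite_subset by blast
    have one: "measure_pmf.prob ?M {f. \<not> (real (card {y\<in>X b. f (c, y)}) < 4 * (hi * \<rho>) \<and> lo * \<rho> / 4 < card {y\<in>Y b. f (c, y)})}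
        \<le> 2 * exp (- (lo * \<rho> / 4))" if b: "b \<in> B" for b
    proof -
      have X: "X b \<subseteq> V" "card (X b) \<le> hi" "finite (X b)" and Y: "Y b \<subseteq> V" "lo \<le> card (Y b)" "finite (Y b)"
        using adm b V finite_subset by blast+
      have pc: "measure_pmf.prob ?M {f. f (c, y)} = \<rho>" if "y \<in> V" for y
        by (rule prob_Pi_bernoulli_component) (use V \<rho> c that in auto)
      have up: "measure_pmf.prob ?M {f. 4 * (hi * \<rho>) \<le> real (card {y\<in>X b. f (c, y)})} \<le> exp (- (lo * \<rho> / 4))"
      proof (cases "X b = {} \<or> \<rho> = 0")
        case True
        show ?thesis
        proof (cases "lo * \<rho> = 0")
          case True
          then have "exp (- (lo * \<rho> / 4)) = 1" by (simp only:) simp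
          then show ?thesis by (simp only: measure_pmf.prob_le_1)
        next
          case False
          then have "0 < lo * \<rho>" using lo \<rho> by (simp add: less_le)
          then have pos: "0 < hi * \<rho>" using lo \<rho> mult_right_mono[of lo hi \<rho>] by linarith
          have "X b = {}" using True False by auto
          then have "{f. 4 * (hi * \<rho>) \<le> real (card {y\<in>X b. f (c, y)})} = {}" using pos by (simp add: not_le mult.commute)
          then show ?thesis by simp
        qed
      next
        case False
        then have ne: "0 < card (X b)" using X by (auto simp: card_gt_0_iff)
        \<comment> \<open>The bound is spread over \<open>X b\<close> so that the mean becomes
          \<open>hi * \<rho>\<close> even when \<open>X b\<close> is much smaller than
          \<open>hi\<close>; otherwise the tail bound would be too weak.\<close>
        have "measure_pmf.prob ?M {f. 4 * (card (X b) * (hi * \<rho> / card (X b))) \<le> real (card {y\<in>X b. f (c, y)})}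
            \<le> exp (- (card (X b) * (hi * \<rho> / card (X b))))"
        proof (rule prob_blocks_card_ge[where blk = "\<lambda>y. {(c, y)}"])
          show "measure_pmf.prob ?M {f. f (c, y)} \<le> hi * \<rho> / card (X b)" if "y \<in> X b" for y
          proof -
            have "card (X b) * \<rho> \<le> hi * \<rho>" using X \<rho> by (intro mult_right_mono) auto
            then show ?thesis using pc[of y] that X ne by (auto simp: field_simps)
          qed
        qed (use V X c in \<open>auto simp: disjoint_family_on_def\<close>)
        then have "measure_pmf.prob ?M {f. 4 * (hi * \<rho>) \<le> real (card {y\<in>X b. f (c, y)})} \<le> exp (- (hi * \<rho>))"
          using ne by simp
        also have "\<dots> \<le> exp (- (lo * \<rho> / 4))"
        proof -
          have "lo * \<rho> \<le> hi * \<rho>" "0 \<le> lo * \<rho>" using lo \<rho> by (auto intro: mult_right_mono)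
          then show ?thesis by simp
        qed
        finally show ?thesis .
      qed
      have down: "measure_pmf.prob ?M {f. real (card {y\<in>Y b. f (c, y)}) \<le> lo * \<rho> / 4} \<le> exp (- (lo * \<rho> / 4))"
      proof -
        have le: "lo * \<rho> / 4 \<le> card (Y b) * \<rho> / 4" using Y \<rho> by (auto intro: mult_right_mono)
        have "measure_pmf.prob ?M {f. real (card {y\<in>Y b. f (c, y)}) \<le> lo * \<rho> / 4}
            \<le> measure_pmf.prob ?M {f. real (card {y\<in>Y b. f (c, y)}) \<le> card (Y b) * \<rho> / 4}"
          by (rule measure_pmf.finite_measure_mono) (use le in auto)
        also have "\<dots> \<le> exp (- (card (Y b) * \<rho> / 4))"
          by (rule prob_blocks_card_le[where blk = "\<lambda>y. {(c, y)}"])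
            (use V Y c pc in \<open>auto simp: disjoint_family_on_def\<close>)
        also have "\<dots> \<le> exp (- (lo * \<rho> / 4))" using le by simp
        finally show ?thesis .
      qed
      have "measure_pmf.prob ?M {f. \<not> (real (card {y\<in>X b. f (c, y)}) < 4 * (hi * \<rho>) \<and> lo * \<rho> / 4 < card {y\<in>Y b. f (c, y)})}
         \<le> measure_pmf.prob ?M ({f. 4 * (hi * \<rho>) \<le> real (card {y\<in>X b. f (c, y)})} \<union> {f. real (card {y\<in>Y b. f (c, y)}) \<le> lo * \<rho> / 4})"
        by (rule measure_pmf.finite_measure_mono) auto
      also have "\<dots> \<le> exp (- (lo * \<rho> / 4)) + exp (- (lo * \<rho> / 4))"
        by (rule order_trans[OF measure_Un_le]) (use up down in auto)
      finally show ?thesis by simp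
    qed
    have "measure_pmf.prob ?M {f. \<exists>b\<in>B. \<not> (real (card {y\<in>X b. f (c, y)}) < 4 * (hi * \<rho>) \<and> lo * \<rho> / 4 < card {y\<in>Y b. f (c, y)})}
        \<le> t * (2 * exp (- (lo * \<rho> / 4)))"
      by (rule prob_union_le[OF finB one]) (use B in auto)
    also have "\<dots> \<le> 1 / 2" using t by simp
    also have "{f. \<exists>b\<in>B. \<not> (real (card {y\<in>X b. f (c, y)}) < 4 * (hi * \<rho>) \<and> lo * \<rho> / 4 < card {y\<in>Y b. f (c, y)})} = UNIV - {f. ?good B X Y c f}"
      by auto
    finally show ?thesis
      using measure_pmf.prob_compl[of "{f. ?good B X Y c f}" ?M] by simp
  qed
  have fixed: "measure_pmf.prob ?M {f. \<forall>c\<in>V. \<not> ?good B X Y c f} \<le> exp (- (card V / 2))"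
    if B: "B \<subseteq> V" "card B \<le> t" and adm: "?adm B X Y" for B X Y
  proof -
    have "measure_pmf.prob ?M {f. \<forall>c\<in>V. \<not> ?good B X Y c f} \<le> exp (- (card V * (1 / 2)))"
    proof (rule prob_blocks_none_le[where blk = "\<lambda>w. {w} \<times> V" and Q = "?good B X Y"])
      show "?good B X Y c f = ?good B X Y c g" if "c \<in> V" "\<forall>x\<in>{c} \<times> V. f x = g x" for c f g
      proof (rule ball_cong[OF refl])
        fix b assume "b \<in> B"
        then have "{y\<in>X b. f (c, y)} = {y\<in>X b. g (c, y)}" "{y\<in>Y b. f (c, y)} = {y\<in>Y b. g (c, y)}"
          using adm that by (auto simp: subset_iff)
        then show "(real (card {y\<in>X b. f (c, y)}) < 4 * (hi * \<rho>) \<and> lo * \<rho> / 4 < card {y\<in>Y b. f (c, y)})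
           \<longleftrightarrow> (real (card {y\<in>X b. g (c, y)}) < 4 * (hi * \<rho>) \<and> lo * \<rho> / 4 < card {y\<in>Y b. g (c, y)})" by simp
      qed
      show "1 / 2 \<le> measure_pmf.prob ?M {f. ?good B X Y c f}" if "c \<in> V" for c by (rule half[OF B adm that])
    qed (use V in \<open>auto simp: disjoint_rows\<close>)
    then show ?thesis by simp
  qed
  let ?S = "{S. S \<subseteq> V \<and> card S \<le> hi}"
  \<comment> \<open>Only the values of \<open>X\<close> and \<open>Y\<close> on \<open>B\<close>
    matter, so extensional functions suffice and the union is finite.\<close>
  let ?F = "Sigma {B. B \<subseteq> V \<and> card B \<le> t} (\<lambda>B. (B \<rightarrow>\<^sub>E ?S) \<times> (B \<rightarrow>\<^sub>E ?S))"
  have finS: "finite ?S" using V by auto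
  have finF: "finite ?F"
    using V finS by (intro finite_SigmaI finite_cartesian_product finite_PiE) (auto intro: finite_subset)
  have cardS: "card ?S \<le> (card V + 1) ^ hi" by (rule card_small_subsets[OF V])
  have "card ?F = (\<Sum>B\<in>{B. B \<subseteq> V \<and> card B \<le> t}. card ((B \<rightarrow>\<^sub>E ?S) \<times> (B \<rightarrow>\<^sub>E ?S)))"
    using V by (intro card_SigmaI ballI finite_cartesian_product finite_PiE finS) (auto intro: finite_subset)
  also have "\<dots> \<le> (\<Sum>B\<in>{B. B \<subseteq> V \<and> card B \<le> t}. (card V + 1) ^ (2 * t * hi))"
  proof (rule sum_mono)
    fix B assume B: "B \<in> {B. B \<subseteq> V \<and> card B \<le> t}"
    then have finB: "finite B" using V finite_subset by blast
    have h1: "card (B \<rightarrow>\<^sub>E ?S) = card ?S ^ card B" using finB by (simp add: card_PiE)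
    have h2: "card ?S ^ card B \<le> ((card V + 1) ^ hi) ^ card B" by (rule power_mono[OF cardS]) simp
    have h3: "((card V + 1) ^ hi) ^ card B \<le> (card V + 1) ^ (t * hi)"
      unfolding mult.commute[of t hi] power_mult by (rule power_increasing) (use B in auto)
    have "card (B \<rightarrow>\<^sub>E ?S) \<le> (card V + 1) ^ (t * hi)" unfolding h1 by (rule order_trans[OF h2 h3])
    from mult_le_mono[OF this this]
    have "card ((B \<rightarrow>\<^sub>E ?S) \<times> (B \<rightarrow>\<^sub>E ?S)) \<le> (card V + 1) ^ (t * hi) * (card V + 1) ^ (t * hi)"
      unfolding card_cartesian_product .
    also have "\<dots> = (card V + 1) ^ (2 * t * hi)" by (simp add: power_add[symmetric] mult_2[symmetric] mult.assoc)
    finally show "card ((B \<rightarrow>\<^sub>E ?S) \<times> (B \<rightarrow>\<^sub>E ?S)) \<le> (card V + 1) ^ (2 * t * hi)" .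
  qed
  also have "\<dots> \<le> (card V + 1) ^ t * (card V + 1) ^ (2 * t * hi)"
    using card_small_subsets[OF V, of t] by simp
  finally have cardF: "card ?F \<le> (card V + 1) ^ (t + 2 * t * hi)" by (simp add: power_add)
  have "?lhs \<le> measure_pmf.prob ?M {f. \<exists>(B, X, Y)\<in>?F. ?adm B X Y \<and> (\<forall>c\<in>V. \<not> ?good B X Y c f)}"
  proof (rule measure_pmf.finite_measure_mono, safe)
    fix f B X Y assume *: "B \<subseteq> V" "card B \<le> t" "?adm B X Y" "\<not> (\<exists>c\<in>V. ?good B X Y c f)"
    show "\<exists>(B, X, Y)\<in>?F. ?adm B X Y \<and> (\<forall>c\<in>V. \<not> ?good B X Y c f)"
    proof (rule bexI[of _ "(B, restrict X B, restrict Y B)"])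
      have "?adm B (restrict X B) (restrict Y B)" using *(3) by auto
      moreover have "?good B (restrict X B) (restrict Y B) c f = ?good B X Y c f" for c by auto
      ultimately show "case (B, restrict X B, restrict Y B) of (B, X, Y) \<Rightarrow> ?adm B X Y \<and> (\<forall>c\<in>V. \<not> ?good B X Y c f)"
        using *(4) by auto
      show "(B, restrict X B, restrict Y B) \<in> ?F" using * by auto
    qed
  qed simp
  also have "\<dots> \<le> real ((card V + 1) ^ (t + 2 * t * hi)) * exp (- (card V / 2))"
  proof (rule prob_union_le[OF finF])
    fix x assume x: "x \<in> ?F"
    obtain B X Y where eq: "x = (B, X, Y)" by (cases x)
    show "measure_pmf.prob ?M {f. case x of (B, X, Y) \<Rightarrow> ?adm B X Y \<and> (\<forall>c\<in>V. \<not> ?good B X Y c f)} \<le> exp (- (card V / 2))"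
    proof (cases "?adm B X Y")
      case True
      have "measure_pmf.prob ?M {f. \<forall>c\<in>V. \<not> ?good B X Y c f} \<le> exp (- (card V / 2))"
        by (rule fixed[OF _ _ True]) (use x eq in auto)
      then show ?thesis using True eq by simp
    next
      case False
      then have empty: "{f. ?adm B X Y \<and> (\<forall>c\<in>V. \<not> ?good B X Y c f)} = {}" by blast
      show ?thesis unfolding eq prod.case empty by simp
    qed
  qed (use cardF in \<open>auto simp del: of_nat_power\<close>)
  finally show ?thesis by simp
qed

text \<open>Each row realises a given pattern with probability at least
  \<open>a ^ t * (1 - \<rho>) ^ u\<close>, and the rows are independent. The union bound over all
  \<open>\<tau>\<close>, \<open>Z\<close>, \<open>Y\<close> is affordable when
  \<open>t * u * ln (card V)\<close> is small against the expected number of such rows.\<close>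

lemma prob_few_codes:
  fixes a \<rho> :: real and t u :: nat
  assumes V: "finite V" and \<rho>: "0 \<le> \<rho>" "\<rho> \<le> 1" and a: "0 \<le> a" "a \<le> 1"
  shows "measure_pmf.prob (rand_digraph V \<rho>)
     {f. \<exists>\<tau>\<subseteq>V. card \<tau> \<le> t \<and> (\<exists>Z Y. Z \<subseteq> V \<and> (\<forall>i\<in>\<tau>. Y i \<subseteq> V - Z \<and> a \<le> card (Y i) * \<rho>) \<and> disjoint_family_on Y \<tau> \<and>
         card Z + (\<Sum>i\<in>\<tau>. card (Y i)) \<le> u \<and>
         real (card {w\<in>V. pattern (\<lambda>y. f (w, y)) Z \<tau> Y}) \<le> card V * (a ^ t * (1 - \<rho>) ^ u) / 4)}
     \<le> (card V + 1) ^ (t + u + t * u) * exp (- (card V * (a ^ t * (1 - \<rho>) ^ u) / 4))" (is "?lhs \<le> _")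
proof -
  let ?M = "rand_digraph V \<rho>"
  let ?adm = "\<lambda>\<tau> Z Y. (\<forall>i\<in>\<tau>. Y i \<subseteq> V - Z \<and> a \<le> card (Y i) * \<rho>) \<and> disjoint_family_on Y \<tau> \<and> card Z + (\<Sum>i\<in>\<tau>. card (Y i)) \<le> u"
  let ?s = "card V * (a ^ t * (1 - \<rho>) ^ u) / 4"
  let ?few = "\<lambda>\<tau> Z Y f. real (card {w\<in>V. pattern (\<lambda>y. f (w, y)) Z \<tau> Y}) \<le> ?s"
  let ?S = "{S. S \<subseteq> V \<and> card S \<le> u}"
  let ?T = "{S. S \<subseteq> V \<and> card S \<le> t}"
  let ?F = "Sigma ?T (\<lambda>\<tau>. ?S \<times> (\<tau> \<rightarrow>\<^sub>E ?S))"
  have fin: "finite ?S" "finite ?T" using V by auto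
  have finT: "finite \<tau>" if "\<tau> \<in> ?T" for \<tau> using that V finite_subset by blast
  have finF: "finite ?F"
    by (intro finite_SigmaI finite_cartesian_product finite_PiE fin finT)
  have cardS: "card ?S \<le> (card V + 1) ^ u" by (rule card_small_subsets[OF V])
  have cF: "card (?S \<times> (\<tau> \<rightarrow>\<^sub>E ?S)) \<le> (card V + 1) ^ (u + t * u)" if \<tau>: "\<tau> \<in> ?T" for \<tau>
  proof -
    have h1: "card (\<tau> \<rightarrow>\<^sub>E ?S) = card ?S ^ card \<tau>" using finT[OF \<tau>] by (simp add: card_PiE)
    have h2: "card ?S ^ card \<tau> \<le> ((card V + 1) ^ u) ^ card \<tau>" by (rule power_mono[OF cardS]) simp
    have h3: "((card V + 1) ^ u) ^ card \<tau> \<le> (card V + 1) ^ (t * u)"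
      unfolding mult.commute[of t u] power_mult by (rule power_increasing) (use \<tau> in auto)
    have "card (\<tau> \<rightarrow>\<^sub>E ?S) \<le> (card V + 1) ^ (t * u)" unfolding h1 by (rule order_trans[OF h2 h3])
    then show ?thesis
      unfolding card_cartesian_product power_add by (rule mult_le_mono[OF cardS])
  qed
  have "card ?F = (\<Sum>\<tau>\<in>?T. card (?S \<times> (\<tau> \<rightarrow>\<^sub>E ?S)))"
    by (intro card_SigmaI ballI finite_cartesian_product finite_PiE fin finT)
  also have "\<dots> \<le> card ?T * (card V + 1) ^ (u + t * u)"
    using sum_bounded_above[of ?T "\<lambda>\<tau>. card (?S \<times> (\<tau> \<rightarrow>\<^sub>E ?S))" "(card V + 1) ^ (u + t * u)"] cF by simp
  also have "\<dots> \<le> (card V + 1) ^ t * (card V + 1) ^ (u + t * u)"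
    by (rule mult_le_mono1) (rule card_small_subsets[OF V])
  finally have cardF: "card ?F \<le> (card V + 1) ^ (t + u + t * u)" by (simp add: power_add mult.assoc)
  have "?lhs \<le> measure_pmf.prob ?M {f. \<exists>(\<tau>, Z, Y)\<in>?F. ?adm \<tau> Z Y \<and> ?few \<tau> Z Y f}"
  proof (rule measure_pmf.finite_measure_mono, safe)
    fix f \<tau> Z Y assume *: "\<tau> \<subseteq> V" "card \<tau> \<le> t" "Z \<subseteq> V" "\<forall>i\<in>\<tau>. Y i \<subseteq> V - Z \<and> a \<le> card (Y i) * \<rho>"
      "disjoint_family_on Y \<tau>" "card Z + (\<Sum>i\<in>\<tau>. card (Y i)) \<le> u" "?few \<tau> Z Y f"
    have fin\<tau>: "finite \<tau>" using * V finite_subset by blast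
    have Yu: "card (Y i) \<le> u" if "i \<in> \<tau>" for i
      using member_le_sum[OF that, of "\<lambda>i. card (Y i)"] fin\<tau> *(6) by simp
    show "\<exists>(\<tau>, Z, Y)\<in>?F. ?adm \<tau> Z Y \<and> ?few \<tau> Z Y f"
    proof (rule bexI[of _ "(\<tau>, Z, restrict Y \<tau>)"])
      have "?adm \<tau> Z (restrict Y \<tau>)" using *(4-6) by (auto simp: disjoint_family_on_def)
      moreover have "pattern (\<lambda>y. f (w, y)) Z \<tau> (restrict Y \<tau>) = pattern (\<lambda>y. f (w, y)) Z \<tau> Y" for w
        by (simp add: pattern_def)
      ultimately show "case (\<tau>, Z, restrict Y \<tau>) of (\<tau>, Z, Y) \<Rightarrow> ?adm \<tau> Z Y \<and> ?few \<tau> Z Y f"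
        using *(7) by simp
      have "restrict Y \<tau> \<in> \<tau> \<rightarrow>\<^sub>E ?S" using *(4) Yu by auto
      then show "(\<tau>, Z, restrict Y \<tau>) \<in> ?F" using * by simp
    qed
  qed simp
  also have "\<dots> \<le> real ((card V + 1) ^ (t + u + t * u)) * exp (- ?s)"
  proof (rule prob_union_le[OF finF])
    fix x assume x: "x \<in> ?F"
    obtain \<tau> Z Y where eq: "x = (\<tau>, Z, Y)" by (cases x)
    show "measure_pmf.prob ?M {f. case x of (\<tau>, Z, Y) \<Rightarrow> ?adm \<tau> Z Y \<and> ?few \<tau> Z Y f} \<le> exp (- ?s)"
    proof (cases "?adm \<tau> Z Y")
      case True
      have \<tau>: "\<tau> \<subseteq> V" "card \<tau> \<le> t" "finite \<tau>" "Z \<subseteq> V"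
        using x finT[of \<tau>] unfolding eq by simp_all
      let ?s' = "card V * (a ^ card \<tau> * (1 - \<rho>) ^ u) / 4"
      have ss: "?s \<le> ?s'"
        using \<tau>(2) \<rho> a by (intro divide_right_mono mult_left_mono mult_right_mono power_decreasing) auto
      have "measure_pmf.prob ?M {f. ?few \<tau> Z Y f} \<le> measure_pmf.prob ?M {f. real (card {w\<in>V. pattern (\<lambda>y. f (w, y)) Z \<tau> Y}) \<le> ?s'}"
        by (rule measure_pmf.finite_measure_mono) (use ss in auto)
      also have "\<dots> \<le> exp (- ?s')"
        by (rule prob_few_patterns[OF V \<rho> \<tau>(3,4)]) (use True a in auto)
      also have "\<dots> \<le> exp (- ?s)" using ss by simp
      finally show ?thesis using True eq by simp
    next
      case False
      then have empty: "{f. ?adm \<tau> Z Y \<and> ?few \<tau> Z Y f} = {}" by blast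
      show ?thesis unfolding eq prod.case empty by simp
    qed
  qed (use cardF in \<open>auto simp del: of_nat_power\<close>)
  finally show ?thesis by simp
qed

lemma finite_tuples: "finite V \<Longrightarrow> finite (tuples m V)"
  and card_tuples: "finite V \<Longrightarrow> card (tuples m V) = card V ^ m"
proof -
  have "tuples m V = {as. set as \<subseteq> V \<and> length as = m}" by (auto simp: tuples_def)
  then show "finite V \<Longrightarrow> finite (tuples m V)" "finite V \<Longrightarrow> card (tuples m V) = card V ^ m"
    by (simp_all add: finite_lists_length_eq card_lists_length_eq)
qed

lemma tuples_snoc: "es \<in> tuples m V \<Longrightarrow> z \<in> V \<Longrightarrow> es @ [z] \<in> tuples (Suc m) V"
  by (auto simp: tuples_def)

text \<open>Here the events range over the \<open>n ^ m\<close> rows \<open>es\<close>, so that the union bound over arbitrary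
  families of subsets is affordable although the probability of a single row being suitable
  is polynomially small.\<close>

lemma prob_no_transversal:
  fixes a p :: real and K m :: nat
  assumes V: "finite V" and p: "0 \<le> p" "p \<le> 1" and a: "0 \<le> a" "a \<le> 1"
  shows "measure_pmf.prob (Pi_pmf (tuples (Suc m) V) False (\<lambda>_. bernoulli_pmf p))
     {f. \<exists>k\<le>K. \<exists>Y. (\<forall>i<k. Y i \<subseteq> V \<and> a \<le> card (Y i) * p) \<and> disjoint_family_on Y {..<k} \<and>
         \<not> (\<exists>es\<in>tuples m V. pattern (\<lambda>z. f (es @ [z])) (V - (\<Union>i<k. Y i)) {..<k} Y)}
     \<le> (real K + 1) * 2 ^ (card V * K) * exp (- (real (card V) ^ m * (a ^ K * (1 - p) ^ card V)))" (is "?lhs \<le> _")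
proof -
  let ?M = "Pi_pmf (tuples (Suc m) V) False (\<lambda>_. bernoulli_pmf p)"
  let ?adm = "\<lambda>k Y. (\<forall>i<k. Y i \<subseteq> V \<and> a \<le> card (Y i) * p) \<and> disjoint_family_on Y {..<k}"
  let ?good = "\<lambda>k Y es f. pattern (\<lambda>z. f (es @ [z])) (V - (\<Union>i<k. Y i)) {..<k} Y"
  let ?e = "exp (- (real (card V) ^ m * (a ^ K * (1 - p) ^ card V)))"
  let ?F = "Sigma {..K} (\<lambda>k. {..<k} \<rightarrow>\<^sub>E Pow V)"
  have finF: "finite ?F" using V by (intro finite_SigmaI finite_PiE) auto
  have "card ?F = (\<Sum>k\<le>K. card ({..<k} \<rightarrow>\<^sub>E Pow V))"
    using V by (intro card_SigmaI ballI finite_PiE) auto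
  also have "\<dots> \<le> (\<Sum>k\<le>K. 2 ^ (card V * K))"
  proof (rule sum_mono)
    fix k assume "k \<in> {..K}"
    then have "(2 ^ card V) ^ k \<le> ((2::nat) ^ card V) ^ K" by (intro power_increasing) auto
    then show "card ({..<k} \<rightarrow>\<^sub>E Pow V) \<le> 2 ^ (card V * K)"
      by (simp add: card_PiE card_Pow V power_mult)
  qed
  also have "\<dots> = (K + 1) * 2 ^ (card V * K)" by simp
  finally have "real (card ?F) \<le> real ((K + 1) * 2 ^ (card V * K))" by (rule of_nat_mono)
  then have cardF: "real (card ?F) \<le> (real K + 1) * 2 ^ (card V * K)" by (simp add: algebra_simps)
  have fixed: "measure_pmf.prob ?M {f. \<forall>es\<in>tuples m V. \<not> ?good k Y es f} \<le> ?e"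
    if k: "k \<le> K" and adm: "?adm k Y" for k Y
  proof -
    let ?U = "\<Union>i<k. Y i"
    have finY: "finite (Y i)" if "i < k" for i using adm that V finite_subset by blast
    have "measure_pmf.prob ?M {f. \<forall>es\<in>tuples m V. \<not> ?good k Y es f}
        \<le> exp (- (card (tuples m V) * (a ^ K * (1 - p) ^ card V)))"
    proof (rule prob_blocks_none_le[where blk = "\<lambda>es. (\<lambda>z. es @ [z]) ` V" and Q = "?good k Y"])
      show "?good k Y es f = ?good k Y es g" if "\<forall>x\<in>(\<lambda>z. es @ [z]) ` V. f x = g x" for es f g
        by (rule pattern_cong) (use that adm in auto)
      fix es assume es: "es \<in> tuples m V"
      \<comment> \<open>The forbidden set is the whole complement of the \<open>Y i\<close>, since
        the row must have no other extension; hence all of \<open>V\<close> is inspected and the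
        exponent of \<open>1 - p\<close> is \<open>card V\<close>.\<close>
      have "card (V - ?U) + (\<Sum>i<k. card (Y i)) = card (V - ?U) + card ?U"
        using adm finY by (subst card_UN_disjoint') auto
      also have "\<dots> = card V"
      proof -
        have sub: "?U \<subseteq> V" using adm by blast
        then have "finite ?U" using V finite_subset by blast
        then show ?thesis using sub V by (simp add: card_Diff_subset card_mono)
      qed
      finally have tot: "card (V - ?U) + (\<Sum>i<k. card (Y i)) \<le> card V" by simp
      have "a ^ K * (1 - p) ^ card V \<le> a ^ card {..<k} * (1 - p) ^ card V"
        using k a p by (intro mult_right_mono power_decreasing) auto
      also have "\<dots> \<le> measure_pmf.prob ?M {f. ?good k Y es f}"
      proof (rule prob_pattern[where V = V])
        show "(\<lambda>z. es @ [z]) ` V \<subseteq> tuples (Suc m) V" using es by (auto intro: tuples_snoc)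
        show "Y i \<subseteq> V - (V - ?U)" if "i \<in> {..<k}" for i using adm that by blast
      qed (use V p a adm tot in \<open>auto simp: finite_tuples inj_on_def\<close>)
      finally show "a ^ K * (1 - p) ^ card V \<le> measure_pmf.prob ?M {f. ?good k Y es f}" .
    qed (use V in \<open>auto simp: finite_tuples tuples_snoc disjoint_family_on_def\<close>)
    then show ?thesis by (simp add: card_tuples V)
  qed
  have "?lhs \<le> measure_pmf.prob ?M {f. \<exists>(k, Y)\<in>?F. ?adm k Y \<and> (\<forall>es\<in>tuples m V. \<not> ?good k Y es f)}"
  proof (rule measure_pmf.finite_measure_mono, rule subsetI)
    fix f assume "f \<in> {f. \<exists>k\<le>K. \<exists>Y. (\<forall>i<k. Y i \<subseteq> V \<and> a \<le> card (Y i) * p) \<and> disjoint_family_on Y {..<k} \<and>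
         \<not> (\<exists>es\<in>tuples m V. pattern (\<lambda>z. f (es @ [z])) (V - (\<Union>i<k. Y i)) {..<k} Y)}"
    then obtain k Y where *: "k \<le> K" "?adm k Y" "\<forall>es\<in>tuples m V. \<not> ?good k Y es f" by auto
    have "\<exists>(k, Y)\<in>?F. ?adm k Y \<and> (\<forall>es\<in>tuples m V. \<not> ?good k Y es f)"
    proof (rule bexI[of _ "(k, restrict Y {..<k})"])
      have "?adm k (restrict Y {..<k})" using *(2) by (auto simp: disjoint_family_on_def)
      moreover have "?good k (restrict Y {..<k}) es f = ?good k Y es f" for es
        by (simp add: pattern_def)
      ultimately show "case (k, restrict Y {..<k}) of (k, Y) \<Rightarrow> ?adm k Y \<and> (\<forall>es\<in>tuples m V. \<not> ?good k Y es f)"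
        using *(3) by simp
      show "(k, restrict Y {..<k}) \<in> ?F" using *(1,2) by auto
    qed
    then show "f \<in> {f. \<exists>(k, Y)\<in>?F. ?adm k Y \<and> (\<forall>es\<in>tuples m V. \<not> ?good k Y es f)}" by simp
  qed simp
  also have "\<dots> \<le> (real K + 1) * 2 ^ (card V * K) * ?e"
  proof (rule prob_union_le[OF finF])
    fix x assume x: "x \<in> ?F"
    obtain k Y where eq: "x = (k, Y)" by (cases x)
    show "measure_pmf.prob ?M {f. case x of (k, Y) \<Rightarrow> ?adm k Y \<and> (\<forall>es\<in>tuples m V. \<not> ?good k Y es f)} \<le> ?e"
    proof (cases "?adm k Y")
      case True
      have "measure_pmf.prob ?M {f. \<forall>es\<in>tuples m V. \<not> ?good k Y es f} \<le> ?e"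
        by (rule fixed[OF _ True]) (use x eq in auto)
      then show ?thesis using True eq by simp
    next
      case False
      then have empty: "{f. ?adm k Y \<and> (\<forall>es\<in>tuples m V. \<not> ?good k Y es f)} = {}" by blast
      show ?thesis unfolding eq prod.case empty by simp
    qed
  qed (use cardF in auto)
  finally show ?thesis .
qed

section \<open>Coding in pseudo-random digraphs\<close>

text \<open>The factor 4 comes from the upper Chernoff bound; in \<open>size_lo\<close>, 1/8 is the
  expansion constant of a growing step and 1/4 comes from the lower Chernoff bound of a selecting
  step.\<close>

primrec size_hi :: "real \<Rightarrow> real \<Rightarrow> bool list \<Rightarrow> real" where
  "size_hi n \<rho> [] = 1"
| "size_hi n \<rho> (grow # ops) = 4 * ((if grow then n * \<rho> else \<rho>) * size_hi n \<rho> ops)"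

primrec size_lo :: "real \<Rightarrow> real \<Rightarrow> bool list \<Rightarrow> real" where
  "size_lo n \<rho> [] = 1"
| "size_lo n \<rho> (grow # ops) = (if grow then n * \<rho> / 8 else \<rho> / 4) * size_lo n \<rho> ops"

text \<open>This and the next four properties are the complements of the bad events bounded in the
  preceding section, written for an arbitrary digraph or structure.\<close>

definition few_in :: "'a set \<Rightarrow> real \<Rightarrow> ('a \<Rightarrow> 'a \<Rightarrow> bool) \<Rightarrow> bool" where
  "few_in V \<rho> G \<longleftrightarrow> (\<forall>x\<in>V. real (card {y\<in>V. G y x}) < 4 * (real (card V) * \<rho>))"

definition expanding :: "'a set \<Rightarrow> real \<Rightarrow> nat \<Rightarrow> ('a \<Rightarrow> 'a \<Rightarrow> bool) \<Rightarrow> bool" where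
  "expanding V \<rho> L G \<longleftrightarrow> (\<forall>S\<subseteq>V. \<forall>Z\<subseteq>V - S. 1 \<le> card S \<and> card Z \<le> L * card S \<and> real (card S) * (1 + real L) * \<rho> \<le> 1 / 2 \<longrightarrow>
     real (card V) * \<rho> * card S / 8 < card {y\<in>V. (\<exists>x\<in>S. G y x) \<and> (\<forall>x\<in>Z. \<not> G y x)})"

definition selecting :: "'a set \<Rightarrow> real \<Rightarrow> nat \<Rightarrow> nat \<Rightarrow> real \<Rightarrow> ('a \<Rightarrow> 'a \<Rightarrow> bool) \<Rightarrow> bool" where
  "selecting V \<rho> t hi lo G \<longleftrightarrow> (\<forall>B\<subseteq>V. card B \<le> t \<longrightarrow> (\<forall>X Y.
     (\<forall>b\<in>B. X b \<subseteq> V \<and> card (X b) \<le> hi \<and> Y b \<subseteq> V \<and> card (Y b) \<le> hi \<and> lo \<le> card (Y b)) \<longrightarrow>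
     (\<exists>c\<in>V. \<forall>b\<in>B. real (card {y\<in>X b. G c y}) < 4 * (real hi * \<rho>) \<and> lo * \<rho> / 4 < card {y\<in>Y b. G c y})))"

definition coding :: "'a set \<Rightarrow> real \<Rightarrow> nat \<Rightarrow> real \<Rightarrow> nat \<Rightarrow> ('a \<Rightarrow> 'a \<Rightarrow> bool) \<Rightarrow> bool" where
  "coding V \<rho> t a u G \<longleftrightarrow> (\<forall>\<tau>\<subseteq>V. card \<tau> \<le> t \<longrightarrow> (\<forall>Z Y. Z \<subseteq> V \<and> (\<forall>i\<in>\<tau>. Y i \<subseteq> V - Z \<and> a \<le> real (card (Y i)) * \<rho>) \<and>
     disjoint_family_on Y \<tau> \<and> card Z + (\<Sum>i\<in>\<tau>. card (Y i)) \<le> u \<longrightarrow>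
     real (card V) * (a ^ t * (1 - \<rho>) ^ u) / 4 < card {w\<in>V. pattern (G w) Z \<tau> Y}))"

definition transversal :: "nat \<Rightarrow> 'a struct \<Rightarrow> nat \<Rightarrow> real \<Rightarrow> real \<Rightarrow> bool" where
  "transversal m S K a p \<longleftrightarrow> (\<forall>k\<le>K. \<forall>Y. (\<forall>i<k. Y i \<subseteq> fst S \<and> a \<le> real (card (Y i)) * p) \<and> disjoint_family_on Y {..<k} \<longrightarrow>
     (\<exists>es\<in>tuples m (fst S). pattern (\<lambda>z. snd S (es @ [z])) (fst S - (\<Union>i<k. Y i)) {..<k} Y))"

text \<open>The first inequality makes the union of the sets reached from all other elements of
  \<open>B\<close> at most \<open>L\<close> times a private part, and the second one keeps the sets
  sparse; both are what \<open>expanding\<close> asks for.\<close>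

primrec sizes_ok :: "real \<Rightarrow> real \<Rightarrow> nat \<Rightarrow> nat \<Rightarrow> bool list \<Rightarrow> bool" where
  "sizes_ok n \<rho> t L [] \<longleftrightarrow> True"
| "sizes_ok n \<rho> t L (grow # ops) \<longleftrightarrow> sizes_ok n \<rho> t L ops \<and> real t * size_hi n \<rho> ops \<le> real L * size_lo n \<rho> ops \<and>
     (grow \<longrightarrow> size_hi n \<rho> ops * (1 + real L) * \<rho> \<le> 1 / 2)"

primrec selecting_all :: "'a set \<Rightarrow> real \<Rightarrow> nat \<Rightarrow> bool list \<Rightarrow> ('a \<Rightarrow> 'a \<Rightarrow> bool) \<Rightarrow> bool" where
  "selecting_all V \<rho> t [] G \<longleftrightarrow> True"
| "selecting_all V \<rho> t (grow # ops) G \<longleftrightarrow> selecting_all V \<rho> t ops G \<and>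
     (grow \<or> selecting V \<rho> t (nat \<lfloor>size_hi (card V) \<rho> ops\<rfloor>) (size_lo (card V) \<rho> ops) G)"

lemma size_pos: "0 < n \<Longrightarrow> 0 < \<rho> \<Longrightarrow> 0 < size_hi n \<rho> ops \<and> 0 < size_lo n \<rho> ops"
  by (induction ops) auto

lemma card_UN_le_mult:
  fixes h :: real
  assumes "finite B" "card B \<le> t" "\<And>b. b \<in> B \<Longrightarrow> real (card (X b)) \<le> h" "0 \<le> h"
  shows "real (card (\<Union>b\<in>B. X b)) \<le> t * h"
proof -
  have "real (card (\<Union>b\<in>B. X b)) \<le> (\<Sum>b\<in>B. real (card (X b)))"
    using card_UN_le[OF assms(1), of X] by (simp flip: of_nat_sum)
  also have "\<dots> \<le> card B * h" using assms(3) by (rule sum_bounded_above)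
  also have "\<dots> \<le> t * h" using assms by (intro mult_right_mono) auto
  finally show ?thesis .
qed

text \<open>The sets reached from distinct elements of \<open>B\<close> may overlap; \<open>Y b\<close> is a large part
  of the set reached from \<open>b\<close> that is private to \<open>b\<close>.\<close>

lemma reach_sizes:
  fixes \<rho> :: real
  assumes V: "finite V" "V \<noteq> {}" "fst S = V" and \<rho>: "0 < \<rho>" and B: "B \<subseteq> V" "card B \<le> t"
    and few: "few_in V \<rho> (arc r S)" and exp: "expanding V \<rho> L (arc r S)"
    and sel: "selecting_all V \<rho> t ops (arc r S)" and ok: "sizes_ok (card V) \<rho> t L ops"
  shows "\<exists>cs\<in>tuples (length ops) V. \<exists>Y. \<forall>b\<in>B.
     card {y\<in>V. reach r ops S cs b y} \<le> size_hi (card V) \<rho> ops \<and> Y b \<subseteq> {y\<in>V. reach r ops S cs b y} \<and>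
     size_lo (card V) \<rho> ops \<le> card (Y b) \<and> (\<forall>b'\<in>B. b' \<noteq> b \<longrightarrow> Y b \<inter> {y\<in>V. reach r ops S cs b' y} = {})"
  using sel ok
proof (induction ops)
  case Nil
  have "{y\<in>V. y = b} = {b}" if "b \<in> B" for b using B that by blast
  then show ?case
    by (intro bexI[of _ "[]"] exI[of _ "\<lambda>b. {b}"]) (auto simp: tuples_def)
next
  case (Cons grow ops)
  define n where "n = real (card V)"
  have n: "0 < n" using V by (simp add: n_def card_gt_0_iff)
  have finB: "finite B" using B V finite_subset by blast
  define hi where "hi = size_hi n \<rho> ops"
  define lo where "lo = size_lo n \<rho> ops"
  have pos: "0 < hi" "0 < lo" using size_pos[OF n \<rho>] by (auto simp: hi_def lo_def)
  obtain cs Y where cs: "cs \<in> tuples (length ops) V" and inv: "\<forall>b\<in>B.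
     card {y\<in>V. reach r ops S cs b y} \<le> hi \<and> Y b \<subseteq> {y\<in>V. reach r ops S cs b y} \<and>
     lo \<le> card (Y b) \<and> (\<forall>b'\<in>B. b' \<noteq> b \<longrightarrow> Y b \<inter> {y\<in>V. reach r ops S cs b' y} = {})"
    using Cons.IH Cons.prems by (auto simp: hi_def lo_def n_def)
  define X where "X b = {y\<in>V. reach r ops S cs b y}" for b
  have XV: "X b \<subseteq> V" "finite (X b)" for b using V by (auto simp: X_def)
  have Xhi: "card (X b) \<le> hi" and YX: "Y b \<subseteq> X b" and Ylo: "lo \<le> card (Y b)"
    and priv: "\<And>b'. b' \<in> B \<Longrightarrow> b' \<noteq> b \<Longrightarrow> Y b \<inter> X b' = {}" if "b \<in> B" for b
    using inv that by (auto simp: X_def)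
  have Yhi: "card (Y b) \<le> card (X b)" if "b \<in> B" for b
    using YX[OF that] XV by (intro card_mono) auto
  show ?case
  proof (cases grow)
    case True
    obtain c where c: "c \<in> V" using V by blast
    have eqX: "{y\<in>V. reach r (grow # ops) S (c # cs) b y} = {y\<in>V. \<exists>x\<in>X b. arc r S y x}" for b
      using True V(3) by (auto simp: X_def)
    \<comment> \<open>Vertices with an arc into a set reached from another element of
      \<open>B\<close> are discarded, so that the new part is private again; expansion relative to
      \<open>Z\<close> says that enough vertices survive.\<close>
    define Y' where "Y' b = {y\<in>V. (\<exists>x\<in>Y b. arc r S y x) \<and> (\<forall>x\<in>(\<Union>b'\<in>B - {b}. X b'). \<not> arc r S y x)}" for b
    have "card {y\<in>V. \<exists>x\<in>X b. arc r S y x} \<le> 4 * (n * \<rho> * hi)" if b: "b \<in> B" for b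
    proof -
      have eq: "{y\<in>V. \<exists>x\<in>X b. arc r S y x} = (\<Union>x\<in>X b. {y\<in>V. arc r S y x})" by blast
      have "real (card (\<Union>x\<in>X b. {y\<in>V. arc r S y x})) \<le> card (X b) * (4 * (n * \<rho>))"
      proof (rule card_UN_le_mult)
        fix x assume "x \<in> X b"
        then show "real (card {y\<in>V. arc r S y x}) \<le> 4 * (n * \<rho>)"
          using few XV[of b] unfolding few_in_def n_def by (meson less_imp_le subsetD)
      qed (use XV n \<rho> in auto)
      also have "\<dots> \<le> hi * (4 * (n * \<rho>))" using Xhi[OF b] n \<rho> by (intro mult_right_mono) auto
      finally show ?thesis unfolding eq by (simp add: mult_ac)
    qed
    moreover have "n * \<rho> / 8 * lo \<le> card (Y' b)" if b: "b \<in> B" for b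
    proof -
      let ?Z = "\<Union>b'\<in>B - {b}. X b'"
      have YV: "Y b \<subseteq> V" using YX[OF b] XV by blast
      have Z: "?Z \<subseteq> V - Y b" using XV priv[OF b] by blast
      have "real (card ?Z) \<le> t * hi"
      proof (rule card_UN_le_mult)
        have "card (B - {b}) \<le> card B" using finB by (intro card_mono) auto
        then show "card (B - {b}) \<le> t" using B by linarith
      qed (use finB Xhi pos in auto)
      also have "\<dots> \<le> L * lo" using Cons.prems(2) by (simp add: hi_def lo_def n_def)
      also have "\<dots> \<le> real L * real (card (Y b))" using Ylo[OF b] by (intro mult_left_mono) auto
      finally have cZ: "card ?Z \<le> L * card (Y b)" by (simp flip: of_nat_mult)
      have "0 < real (card (Y b))" using pos Ylo[OF b] by linarith
      then have c1: "1 \<le> card (Y b)" by simp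
      have "card (Y b) * (1 + real L) * \<rho> \<le> hi * (1 + real L) * \<rho>"
        using Yhi[OF b] Xhi[OF b] \<rho> by (intro mult_right_mono) auto
      also have "\<dots> \<le> 1 / 2" using Cons.prems(2) True by (simp add: hi_def n_def)
      finally have "n * \<rho> * card (Y b) / 8 < card (Y' b)"
        using exp YV Z c1 cZ unfolding expanding_def n_def Y'_def by blast
      moreover have "n * \<rho> * lo \<le> n * \<rho> * card (Y b)" using Ylo[OF b] n \<rho> by (intro mult_left_mono) auto
      ultimately show ?thesis by simp
    qed
    moreover have "Y' b \<subseteq> {y\<in>V. \<exists>x\<in>X b. arc r S y x}" if "b \<in> B" for b
      using YX[OF that] by (auto simp: Y'_def)
    moreover have "Y' b \<inter> {y\<in>V. \<exists>x\<in>X b'. arc r S y x} = {}" if "b \<in> B" "b' \<in> B" "b' \<noteq> b" for b b'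
      using that by (auto simp: Y'_def)
    moreover have "c # cs \<in> tuples (length (grow # ops)) V" using c cs by (auto simp: tuples_def)
    ultimately show ?thesis
      unfolding eqX[symmetric] using True
      by (intro bexI[of _ "c # cs"] exI[of _ Y']) (auto simp del: reach.simps simp: hi_def lo_def n_def)
  next
    case False
    \<comment> \<open>\<open>selecting\<close> takes a natural number as its size bound, so
      \<open>hi\<close> is rounded down; cardinalities do not notice.\<close>
    have cnat: "card A \<le> nat \<lfloor>hi\<rfloor>" if "real (card A) \<le> hi" for A :: "'a set" using that by linarith
    have "\<forall>b\<in>B. X b \<subseteq> V \<and> card (X b) \<le> nat \<lfloor>hi\<rfloor> \<and> Y b \<subseteq> V \<and> card (Y b) \<le> nat \<lfloor>hi\<rfloor> \<and> lo \<le> card (Y b)"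
    proof
      fix b assume b: "b \<in> B"
      have "real (card (Y b)) \<le> hi" using Yhi[OF b] Xhi[OF b] by linarith
      then show "X b \<subseteq> V \<and> card (X b) \<le> nat \<lfloor>hi\<rfloor> \<and> Y b \<subseteq> V \<and> card (Y b) \<le> nat \<lfloor>hi\<rfloor> \<and> lo \<le> card (Y b)"
        using XV YX[OF b] Ylo[OF b] cnat[OF Xhi[OF b]] cnat by blast
    qed
    moreover have "selecting V \<rho> t (nat \<lfloor>hi\<rfloor>) lo (arc r S)"
      using Cons.prems(1) False by (simp add: hi_def lo_def n_def)
    ultimately obtain c where c: "c \<in> V"
      and cc: "\<forall>b\<in>B. real (card {y\<in>X b. arc r S c y}) < 4 * (nat \<lfloor>hi\<rfloor> * \<rho>) \<and> lo * \<rho> / 4 < card {y\<in>Y b. arc r S c y}"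
      using B unfolding selecting_def by blast
    have eqX: "{y\<in>V. reach r (grow # ops) S (c # cs) b y} = {y\<in>X b. arc r S c y}" for b
      using False by (auto simp: X_def)
    have "real (card {y\<in>X b. arc r S c y}) \<le> 4 * (\<rho> * hi)" if "b \<in> B" for b
    proof -
      have "nat \<lfloor>hi\<rfloor> * \<rho> \<le> hi * \<rho>" using pos \<rho> by (intro mult_right_mono) auto
      then show ?thesis using cc that by (fastforce simp: mult.commute)
    qed
    moreover have "\<rho> / 4 * lo \<le> card {y\<in>Y b. arc r S c y}" if "b \<in> B" for b
      using cc that by (fastforce simp: mult.commute)
    moreover have "c # cs \<in> tuples (length (grow # ops)) V" using c cs by (auto simp: tuples_def)
    moreover have "{y\<in>Y b. arc r S c y} \<subseteq> {y\<in>X b. arc r S c y}" if "b \<in> B" for b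
      using YX[OF that] by blast
    moreover have "{y\<in>Y b. arc r S c y} \<inter> {y\<in>X b'. arc r S c y} = {}" if "b \<in> B" "b' \<in> B" "b' \<noteq> b" for b b'
      using priv that by blast
    ultimately show ?thesis
      unfolding eqX[symmetric] using False
      by (intro bexI[of _ "c # cs"] exI[of _ "\<lambda>b. {y\<in>Y b. arc r S c y}"]) (auto simp del: reach.simps simp: hi_def lo_def n_def)
  qed
qed

text \<open>A vertex codes exactly \<open>\<tau>\<close> if it has no arc into the sets reached from
  \<open>B - \<tau>\<close> and hits the private part of each \<open>b \<in> \<tau>\<close>. Private
  parts avoid the sets reached from the other elements, so these demands do not conflict and form a
  pattern.\<close>

lemma many_codes:
  fixes \<rho> a :: real
  assumes V: "finite V" "V \<noteq> {}" "fst S = V" and \<rho>: "0 < \<rho>" and B: "B \<subseteq> V" "card B \<le> t"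
    and few: "few_in V \<rho> (arc r S)" and exp: "expanding V \<rho> L (arc r S)"
    and sel: "selecting_all V \<rho> t ops (arc r S)" and ok: "sizes_ok (card V) \<rho> t L ops"
    and cod: "coding V \<rho> t a u (arc r S)" and a: "a \<le> size_lo (card V) \<rho> ops * \<rho>" and u: "t * size_hi (card V) \<rho> ops \<le> u"
  shows "\<exists>cs\<in>tuples (length ops) V. \<forall>\<tau>\<subseteq>B.
     card V * (a ^ t * (1 - \<rho>) ^ u) / 4 < card {w\<in>V. \<forall>b\<in>B. code r ops S cs w b \<longleftrightarrow> b \<in> \<tau>}"
proof -
  obtain cs Y where cs: "cs \<in> tuples (length ops) V" and inv: "\<forall>b\<in>B.
     card {y\<in>V. reach r ops S cs b y} \<le> size_hi (card V) \<rho> ops \<and> Y b \<subseteq> {y\<in>V. reach r ops S cs b y} \<and>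
     size_lo (card V) \<rho> ops \<le> card (Y b) \<and> (\<forall>b'\<in>B. b' \<noteq> b \<longrightarrow> Y b \<inter> {y\<in>V. reach r ops S cs b' y} = {})"
    using reach_sizes[OF V \<rho> B few exp sel ok] by blast
  define X where "X b = {y\<in>V. reach r ops S cs b y}" for b
  have XV: "X b \<subseteq> V" "finite (X b)" for b using V by (auto simp: X_def)
  have Xhi: "card (X b) \<le> size_hi (card V) \<rho> ops" and YX: "Y b \<subseteq> X b" and Ylo: "size_lo (card V) \<rho> ops \<le> card (Y b)"
    and priv: "\<And>b'. b' \<in> B \<Longrightarrow> b' \<noteq> b \<Longrightarrow> Y b \<inter> X b' = {}" if "b \<in> B" for b
    using inv that by (auto simp: X_def)
  have code: "code r ops S cs w b \<longleftrightarrow> (\<exists>x\<in>X b. arc r S w x)" for w b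
    using V(3) by (auto simp: code_def X_def)
  have finB: "finite B" using B V finite_subset by blast
  show ?thesis
  proof (rule bexI[OF _ cs], intro allI impI)
    fix \<tau> assume \<tau>: "\<tau> \<subseteq> B"
    let ?Z = "\<Union>b\<in>B - \<tau>. X b"
    have fin: "finite \<tau>" "finite (B - \<tau>)" using finB \<tau> finite_subset by auto
    have "card ?Z \<le> (\<Sum>b\<in>B - \<tau>. card (X b))" by (rule card_UN_le[OF fin(2)])
    moreover have "(\<Sum>b\<in>\<tau>. card (Y b)) \<le> (\<Sum>b\<in>\<tau>. card (X b))"
    proof (rule sum_mono)
      fix b assume "b \<in> \<tau>"
      then show "card (Y b) \<le> card (X b)" using \<tau> YX[of b] by (intro card_mono XV) auto
    qed
    ultimately have "card ?Z + (\<Sum>i\<in>\<tau>. card (Y i)) \<le> (\<Sum>b\<in>B - \<tau>. card (X b)) + (\<Sum>b\<in>\<tau>. card (X b))"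
      by (rule add_mono)
    also have "\<dots> = (\<Sum>b\<in>B. card (X b))" using sum.subset_diff[OF \<tau> finB, of "\<lambda>b. card (X b)"] by simp
    finally have "real (card ?Z + (\<Sum>i\<in>\<tau>. card (Y i))) \<le> (\<Sum>b\<in>B. real (card (X b)))"
      by (simp flip: of_nat_sum)
    also have "\<dots> \<le> card B * size_hi (card V) \<rho> ops" using Xhi by (rule sum_bounded_above)
    also have "\<dots> \<le> t * size_hi (card V) \<rho> ops"
      using B size_pos[of "real (card V)" \<rho> ops] V \<rho> by (intro mult_right_mono) (auto simp: card_gt_0_iff)
    finally have cu: "card ?Z + (\<Sum>i\<in>\<tau>. card (Y i)) \<le> u"
      using u by (simp only: of_nat_le_iff[where 'a = real, symmetric])
    have "card \<tau> \<le> t" using card_mono[OF finB \<tau>] B by simp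
    moreover have "Y i \<subseteq> V - ?Z" if "i \<in> \<tau>" for i using that \<tau> YX XV priv by blast
    moreover have "a \<le> card (Y i) * \<rho>" if "i \<in> \<tau>" for i
    proof -
      have "size_lo (card V) \<rho> ops * \<rho> \<le> card (Y i) * \<rho>" using Ylo that \<tau> \<rho> by (intro mult_right_mono) auto
      then show ?thesis using a by linarith
    qed
    moreover have "disjoint_family_on Y \<tau>"
      unfolding disjoint_family_on_def
    proof (intro ballI impI)
      fix i j assume ij: "i \<in> \<tau>" "j \<in> \<tau>" "i \<noteq> j"
      then have "i \<in> B" "j \<in> B" using \<tau> by auto
      then show "Y i \<inter> Y j = {}" using priv[of i j] YX[of j] ij by blast
    qed
    moreover have "\<tau> \<subseteq> V" "?Z \<subseteq> V" using \<tau> B XV by blast+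
    ultimately have "card V * (a ^ t * (1 - \<rho>) ^ u) / 4 < card {w\<in>V. pattern (arc r S w) ?Z \<tau> Y}"
      using cod cu unfolding coding_def by simp
    also have "card {w\<in>V. pattern (arc r S w) ?Z \<tau> Y} \<le> card {w\<in>V. \<forall>b\<in>B. code r ops S cs w b \<longleftrightarrow> b \<in> \<tau>}"
    proof (rule card_mono)
      show "{w\<in>V. pattern (arc r S w) ?Z \<tau> Y} \<subseteq> {w\<in>V. \<forall>b\<in>B. code r ops S cs w b \<longleftrightarrow> b \<in> \<tau>}"
      proof safe
        fix w b assume w: "pattern (arc r S w) ?Z \<tau> Y" and b: "b \<in> B"
        show "b \<in> \<tau>" if "code r ops S cs w b"
          using that w b unfolding code pattern_def by blast
        show "code r ops S cs w b" if "b \<in> \<tau>"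
          using that w b YX[OF b] unfolding code pattern_def by blast
      qed
    qed (use V in simp)
    finally show "card V * (a ^ t * (1 - \<rho>) ^ u) / 4 < card {w\<in>V. \<forall>b\<in>B. code r ops S cs w b \<longleftrightarrow> b \<in> \<tau>}"
      by simp
  qed
qed

lemma disjoint_subsets:
  assumes "finite W" "m * s \<le> card W"
  obtains Y :: "nat \<Rightarrow> 'a set" where "\<And>i. i < m \<Longrightarrow> Y i \<subseteq> W \<and> card (Y i) = s" "disjoint_family_on Y {..<m}"
proof -
  obtain f where f: "bij_betw f {..<card W} W"
    using ex_bij_betw_nat_finite[OF assms(1)] by (auto simp: atLeast0LessThan)
  have inj: "inj_on f {..<card W}" using f by (rule bij_betw_imp_inj_on)
  have sub: "{i * s..<Suc i * s} \<subseteq> {..<card W}" if "i < m" for i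
  proof -
    have "Suc i * s \<le> m * s" using that by (intro mult_le_mono1) simp
    then show ?thesis using assms(2) by auto
  qed
  show ?thesis
  proof (rule that[of "\<lambda>i. f ` {i * s..<Suc i * s}"])
    fix i assume i: "i < m"
    show "f ` {i * s..<Suc i * s} \<subseteq> W \<and> card (f ` {i * s..<Suc i * s}) = s"
      using sub[OF i] f inj_on_subset[OF inj sub[OF i]] by (auto simp: card_image bij_betw_def)
  next
    show "disjoint_family_on (\<lambda>i. f ` {i * s..<Suc i * s}) {..<m}"
      unfolding disjoint_family_on_def
    proof (intro ballI impI)
      fix i j :: nat assume ij: "i \<in> {..<m}" "j \<in> {..<m}" "i \<noteq> j"
      have "{i * s..<Suc i * s} \<inter> {j * s..<Suc j * s} = {}"
      proof (cases "i < j")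
        case True
        then have "Suc i * s \<le> j * s" by (intro mult_le_mono1) simp
        then show ?thesis by auto
      next
        case False
        then have "Suc j * s \<le> i * s" using ij by (intro mult_le_mono1) simp
        then show ?thesis by auto
      qed
      moreover have "f ` ({i * s..<Suc i * s} \<inter> {j * s..<Suc j * s}) = f ` {i * s..<Suc i * s} \<inter> f ` {j * s..<Suc j * s}"
        by (rule inj_on_image_Int[OF inj]) (use sub ij in simp_all)
      ultimately show "f ` {i * s..<Suc i * s} \<inter> f ` {j * s..<Suc j * s} = {}"
        by (simp only: image_empty)
    qed
  qed
qed

text \<open>For a family \<open>T\<close> the classes of codes of its members are disjoint and
  large. A row that hits each class once and nothing else has a neighbourhood coding exactly
  \<open>T\<close>.\<close>

lemma rich_if_pseudorandom:
  fixes \<rho> a a' p :: real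
  assumes V: "finite V" "V \<noteq> {}" "fst S = V" and \<rho>: "0 < \<rho>" "\<rho> \<le> 1" and p: "0 < p"
    and few: "few_in V \<rho> (arc r S)" and exp: "expanding V \<rho> L (arc r S)"
    and sel: "selecting_all V \<rho> t ops (arc r S)" and ok: "sizes_ok (card V) \<rho> t L ops"
    and cod: "coding V \<rho> t a u (arc r S)" and a: "0 \<le> a" "a \<le> size_lo (card V) \<rho> ops * \<rho>"
    and u: "t * size_hi (card V) \<rho> ops \<le> u"
    and trans: "transversal (r + 2) S (t\<^sup>2) a' p" and a': "a' \<le> card V * (a ^ t * (1 - \<rho>) ^ u) / 4 * p"
    and s: "a' \<le> real s * p" "t * s + t \<le> card V"
  shows "rich t V (tuples (length ops) V) (tuples (r + 2) V) (nbr S) (code r ops S)"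
  unfolding rich_def
proof (intro conjI allI impI)
  fix B assume B: "B \<subseteq> V" "card B \<le> t"
  have finB: "finite B" using B V finite_subset by blast
  obtain cs where cs: "cs \<in> tuples (length ops) V" and many: "\<forall>\<tau>\<subseteq>B.
     card V * (a ^ t * (1 - \<rho>) ^ u) / 4 < card {w\<in>V. \<forall>b\<in>B. code r ops S cs w b \<longleftrightarrow> b \<in> \<tau>}"
    using many_codes[OF V \<rho>(1) B few exp sel ok cod a(2) u] by blast
  show "\<exists>cs\<in>tuples (length ops) V. (\<forall>\<tau>\<subseteq>B. \<exists>w\<in>V. \<forall>b\<in>B. code r ops S cs w b \<longleftrightarrow> b \<in> \<tau>) \<and>
        (\<forall>T\<subseteq>Pow B. card T \<le> t\<^sup>2 \<longrightarrow> (\<exists>es\<in>tuples (r + 2) V. (\<lambda>z. {b\<in>B. code r ops S cs z b}) ` nbr S es = T))"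
  proof (rule bexI[OF _ cs], intro conjI allI impI)
    fix \<tau> assume "\<tau> \<subseteq> B"
    have "0 \<le> card V * (a ^ t * (1 - \<rho>) ^ u) / 4" using a \<rho> by simp
    then have "0 < real (card {w\<in>V. \<forall>b\<in>B. code r ops S cs w b \<longleftrightarrow> b \<in> \<tau>})"
      using many[rule_format, OF \<open>\<tau> \<subseteq> B\<close>] by linarith
    then have "{w\<in>V. \<forall>b\<in>B. code r ops S cs w b \<longleftrightarrow> b \<in> \<tau>} \<noteq> {}"
      by (intro notI) simp
    then show "\<exists>w\<in>V. \<forall>b\<in>B. code r ops S cs w b \<longleftrightarrow> b \<in> \<tau>" by blast
  next
    fix T assume T: "T \<subseteq> Pow B" "card T \<le> t\<^sup>2"
    have finT: "finite T" by (rule finite_subset[OF T(1)]) (simp add: finB)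
    obtain e where e: "bij_betw e {..<card T} T"
      using ex_bij_betw_nat_finite[OF finT] by (auto simp: atLeast0LessThan)
    let ?Y = "\<lambda>i. {w\<in>V. \<forall>b\<in>B. code r ops S cs w b \<longleftrightarrow> b \<in> e i}"
    have eB: "e i \<in> T" "e i \<subseteq> B" if "i < card T" for i
      using bij_betwE[OF e] that T(1) by auto
    have type: "{b\<in>B. code r ops S cs w b} = e i" if "i < card T" "w \<in> ?Y i" for i w
      using eB(2)[OF that(1)] that(2) by blast
    have large: "\<forall>i<card T. ?Y i \<subseteq> V \<and> a' \<le> card (?Y i) * p"
    proof (intro allI impI conjI)
      fix i assume i: "i < card T"
      have "card V * (a ^ t * (1 - \<rho>) ^ u) / 4 * p \<le> card (?Y i) * p"
        using many[rule_format, OF eB(2)[OF i]] p by (intro mult_right_mono) auto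
      then show "a' \<le> card (?Y i) * p" using a' by linarith
    qed auto
    have disj: "disjoint_family_on ?Y {..<card T}"
      unfolding disjoint_family_on_def
    proof (intro ballI impI)
      fix i j assume ij: "i \<in> {..<card T}" "j \<in> {..<card T}" "i \<noteq> j"
      then have "e i \<noteq> e j" using bij_betw_imp_inj_on[OF e] by (simp add: inj_on_eq_iff)
      then show "?Y i \<inter> ?Y j = {}" using type[of i] type[of j] ij by blast
    qed
    obtain es where es: "es \<in> tuples (r + 2) V"
      and pat: "pattern (\<lambda>z. snd S (es @ [z])) (V - (\<Union>i<card T. ?Y i)) {..<card T} ?Y"
      using trans[unfolded transversal_def V(3), THEN spec, THEN mp, OF T(2), THEN spec, THEN mp, OF conjI[OF large disj]]
      by (elim bexE)
    have none: "\<not> snd S (es @ [z])" if "z \<in> V - (\<Union>i<card T. ?Y i)" for z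
      using pat[unfolded pattern_def, THEN conjunct1, THEN bspec, OF that] .
    have ex: "\<exists>z. z \<in> ?Y i \<and> snd S (es @ [z])" if "i < card T" for i
      using pat[unfolded pattern_def, THEN conjunct2, THEN bspec, of i, THEN ex1_implies_ex] that by simp
    have "(\<lambda>z. {b\<in>B. code r ops S cs z b}) ` nbr S es = T"
    proof (intro equalityI subsetI)
      fix x assume "x \<in> (\<lambda>z. {b\<in>B. code r ops S cs z b}) ` nbr S es"
      then obtain z where z: "z \<in> nbr S es" "x = {b\<in>B. code r ops S cs z b}" by (rule imageE) blast
      then have "z \<in> V" "snd S (es @ [z])" using V(3) by (auto simp: nbr_def)
      have "z \<in> (\<Union>i<card T. ?Y i)"
      proof (rule ccontr)
        assume "z \<notin> (\<Union>i<card T. ?Y i)"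
        from none[OF DiffI[OF \<open>z \<in> V\<close> this]] show False using \<open>snd S (es @ [z])\<close> by (rule notE)
      qed
      then obtain i where "i < card T" "z \<in> ?Y i" by (rule UN_E) simp
      then have "x = e i" unfolding z(2) by (rule type)
      then show "x \<in> T" using eB(1)[OF \<open>i < card T\<close>] by simp
    next
      fix x assume "x \<in> T"
      then obtain i where i: "i < card T" "x = e i" using bij_betw_imp_surj_on[OF e] by auto
      obtain z where z: "z \<in> ?Y i" "snd S (es @ [z])" using ex[OF i(1)] by (elim exE conjE)
      have "z \<in> nbr S es" using z V(3) by (simp add: nbr_def)
      moreover have "x = {b\<in>B. code r ops S cs z b}" using type[OF i(1) z(1)] i(2) by simp
      ultimately show "x \<in> (\<lambda>z. {b\<in>B. code r ops S cs z b}) ` nbr S es" by (rule rev_image_eqI)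
    qed
    then show "\<exists>es\<in>tuples (r + 2) V. (\<lambda>z. {b\<in>B. code r ops S cs z b}) ` nbr S es = T" using es by blast
  qed
next
  fix B m assume B: "B \<subseteq> V" "card B \<le> t" and m: "m \<le> t"
  have finB: "finite B" using B V finite_subset by blast
  have "m * s \<le> t * s" using m by simp
  also have "\<dots> \<le> card V - card B" using s(2) B(2) by linarith
  also have "\<dots> = card (V - B)" using B finB by (simp add: card_Diff_subset)
  \<comment> \<open>A row hitting \<open>m\<close> disjoint sets outside \<open>B\<close> once each,
    and nothing else, has a neighbourhood of exactly \<open>m\<close> elements avoiding
    \<open>B\<close>.\<close>
  finally obtain Y :: "nat \<Rightarrow> 'a set" where Y: "\<And>i. i < m \<Longrightarrow> Y i \<subseteq> V - B \<and> card (Y i) = s" "disjoint_family_on Y {..<m}"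
    using disjoint_subsets[of "V - B" m s] V by blast
  have mt: "m \<le> t\<^sup>2" unfolding power2_eq_square by (rule order_trans[OF m le_square])
  have large: "\<forall>i<m. Y i \<subseteq> V \<and> a' \<le> card (Y i) * p" using Y(1) s(1) by auto
  obtain es where es: "es \<in> tuples (r + 2) V"
      and pat: "pattern (\<lambda>z. snd S (es @ [z])) (V - (\<Union>i<m. Y i)) {..<m} Y"
    using trans[unfolded transversal_def V(3), THEN spec, THEN mp, OF mt, THEN spec, THEN mp, OF conjI[OF large Y(2)]]
    by (elim bexE)
  have nb: "z \<in> nbr S es \<longleftrightarrow> z \<in> V \<and> snd S (es @ [z])" for z using V(3) by (auto simp: nbr_def)
  have sub: "nbr S es \<subseteq> (\<Union>i<m. Y i)" using pat nb unfolding pattern_def by blast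
  have uniq: "\<exists>!y. y \<in> Y i \<and> snd S (es @ [y])" if "i < m" for i
    using pat[unfolded pattern_def, THEN conjunct2, THEN bspec, of i] that by simp
  define g where "g i = (THE y. y \<in> Y i \<and> snd S (es @ [y]))" for i
  have g: "g i \<in> Y i" "snd S (es @ [g i])" if "i < m" for i
    using theI'[OF uniq[OF that]] by (simp_all add: g_def)
  have g_eq: "y = g i" if "i < m" "y \<in> Y i" "snd S (es @ [y])" for i y
    using the1_equality[OF uniq[OF that(1)], of y] that by (simp add: g_def)
  have "bij_betw g {..<m} (nbr S es)"
    unfolding bij_betw_def
  proof
    show "inj_on g {..<m}"
    proof (rule inj_onI, rule ccontr)
      fix i j assume ij: "i \<in> {..<m}" "j \<in> {..<m}" "g i = g j" "i \<noteq> j"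
      then have "Y i \<inter> Y j = {}" using Y(2) by (auto simp: disjoint_family_on_def)
      moreover have "g i \<in> Y i" "g j \<in> Y j" using g(1)[of i] g(1)[of j] ij by simp_all
      ultimately show False using ij(3) by (metis IntI empty_iff)
    qed
    show "g ` {..<m} = nbr S es"
    proof (intro equalityI subsetI)
      fix x assume "x \<in> g ` {..<m}"
      then obtain i where "i < m" "x = g i" by auto
      then show "x \<in> nbr S es" using g[of i] Y(1)[of i] nb by auto
    next
      fix x assume x: "x \<in> nbr S es"
      then obtain i where "i < m" "x \<in> Y i" using sub by blast
      then have "x = g i" using nb x by (intro g_eq) simp_all
      then show "x \<in> g ` {..<m}" using \<open>i < m\<close> by blast
    qed
  qed
  then have "card (nbr S es) = m" using bij_betw_same_card by fastforce
  moreover have "nbr S es \<inter> B = {}" using sub Y(1) by blast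
  ultimately show "\<exists>es\<in>tuples (r + 2) V. card (nbr S es) = m \<and> nbr S es \<inter> B = {}" using es by blast
qed

section \<open>From the random relation to the random digraph of arcs\<close>

definition arc_prob :: "nat \<Rightarrow> nat \<Rightarrow> real \<Rightarrow> real" where
  "arc_prob r n p = 1 - (1 - (1 - p) ^ n) ^ (n ^ r)"

abbreviation rand_rel :: "nat \<Rightarrow> 'a set \<Rightarrow> real \<Rightarrow> ('a list \<Rightarrow> bool) pmf" where
  "rand_rel d V p \<equiv> Pi_pmf (tuples d V) False (\<lambda>_. bernoulli_pmf p)"

lemma arc_prob_bounds: "0 \<le> p \<Longrightarrow> p \<le> 1 \<Longrightarrow> 0 \<le> arc_prob r n p \<and> arc_prob r n p \<le> 1"
  by (auto simp: arc_prob_def power_le_one)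

text \<open>The coordinates of the relation that decide one arc. As \<open>us\<close> has fixed
  length, the pair can be read off any tuple in the block, so blocks of different pairs are disjoint
  and the arcs are independent.\<close>

definition arc_block :: "nat \<Rightarrow> 'a set \<Rightarrow> 'a \<times> 'a \<Rightarrow> 'a list set" where
  "arc_block r V xy = {fst xy # us @ [snd xy, z] |us z. us \<in> tuples r V \<and> z \<in> V}"

lemma disjoint_arc_blocks: "disjoint_family_on (arc_block r V) I"
  unfolding disjoint_family_on_def
proof (intro ballI impI)
  fix a b :: "'a \<times> 'a" assume "a \<noteq> b"
  moreover have "fst a = fst b \<and> snd a = snd b" if h: "x \<in> arc_block r V a" "x \<in> arc_block r V b" for x
  proof -
    obtain us z us' z' where "x = fst a # us @ [snd a, z]" "x = fst b # us' @ [snd b, z']" "length us = r" "length us' = r"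
      using h unfolding arc_block_def tuples_def by blast
    then have "fst a = fst b" "us @ [snd a, z] = us' @ [snd b, z']" "length us = length us'" by simp_all
    then show ?thesis by simp
  qed
  ultimately show "arc_block r V a \<inter> arc_block r V b = {}" by (meson disjoint_iff prod_eqI)
qed

lemma arc_local:
  assumes "\<forall>x\<in>arc_block r V (x, y). f x = g x"
  shows "arc r (V, f) x y \<longleftrightarrow> arc r (V, g) x y"
proof -
  have "f (x # us @ [y, z]) = g (x # us @ [y, z])" if "us \<in> tuples r V" "z \<in> V" for us z
  proof -
    have "x # us @ [y, z] \<in> arc_block r V (x, y)" using that unfolding arc_block_def by auto
    then show ?thesis using assms by blast
  qed
  then show ?thesis unfolding arc_def by simp
qed

lemma prob_arc:
  assumes V: "finite V" and p: "0 \<le> p" "p \<le> 1" and xy: "x \<in> V" "y \<in> V"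
  shows "measure_pmf.prob (rand_rel (r + 3) V p) {f. arc r (V, f) x y} = arc_prob r (card V) p"
proof -
  let ?M = "rand_rel (r + 3) V p"
  let ?Q = "\<lambda>us f. \<forall>z\<in>V. \<not> f (x # us @ [y, z])"
  have mem: "x # us @ [y, z] \<in> tuples (r + 3) V" if "us \<in> tuples r V" "z \<in> V" for us z
    using that xy by (auto simp: tuples_def)
  have one: "measure_pmf.prob ?M {f. ?Q us f} = (1 - p) ^ card V" if "us \<in> tuples r V" for us
    by (rule prob_Pi_bernoulli_none) (use V p mem[OF that] in \<open>auto simp: finite_tuples inj_on_def\<close>)
  have "measure_pmf.prob ?M {f. \<forall>us\<in>tuples r V. \<not> ?Q us f} = (\<Prod>us\<in>tuples r V. 1 - measure_pmf.prob ?M {f. ?Q us f})"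
  proof (rule prob_blocks_none[where blk = "\<lambda>us. (\<lambda>z. x # us @ [y, z]) ` V" and Q = ?Q])
    show "disjoint_family_on (\<lambda>us. (\<lambda>z. x # us @ [y, z]) ` V) (tuples r V)"
      by (auto simp: disjoint_family_on_def tuples_def)
    show "(\<lambda>z. x # us @ [y, z]) ` V \<subseteq> tuples (r + 3) V" if "us \<in> tuples r V" for us
      using mem[OF that] by blast
  qed (use V in \<open>auto simp: finite_tuples\<close>)
  also have "\<dots> = (1 - (1 - p) ^ card V) ^ (card V ^ r)"
    using one by (simp add: card_tuples V)
  finally have *: "measure_pmf.prob ?M {f. \<forall>us\<in>tuples r V. \<not> ?Q us f} = (1 - (1 - p) ^ card V) ^ (card V ^ r)" .
  have "{f. arc r (V, f) x y} = UNIV - {f. \<forall>us\<in>tuples r V. \<not> ?Q us f}"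
    by (auto simp: arc_def)
  then show ?thesis
    using * measure_pmf.prob_compl[of "{f. \<forall>us\<in>tuples r V. \<not> ?Q us f}" ?M]
    by (simp add: arc_prob_def)
qed

text \<open>The arcs form exactly a binomial random digraph, loops included, so the digraph bounds
  carry over without any error term.\<close>

lemma map_arc_rand_rel:
  assumes V: "finite V" and p: "0 \<le> p" "p \<le> 1"
  shows "map_pmf (\<lambda>f xy. xy \<in> V \<times> V \<and> arc r (V, f) (fst xy) (snd xy)) (rand_rel (r + 3) V p)
       = rand_digraph V (arc_prob r (card V) p)"
proof -
  have "map_pmf (\<lambda>f xy. xy \<in> V \<times> V \<and> arc r (V, f) (fst xy) (snd xy)) (rand_rel (r + 3) V p)
    = Pi_pmf (V \<times> V) False (\<lambda>xy. bernoulli_pmf (measure_pmf.prob (rand_rel (r + 3) V p) {f. arc r (V, f) (fst xy) (snd xy)}))"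
  proof (rule map_Pi_pmf_indicators[where blk = "arc_block r V"])
    show "arc_block r V i \<subseteq> tuples (r + 3) V" if "i \<in> V \<times> V" for i
      using that by (auto simp: arc_block_def tuples_def)
    show "arc r (V, f) (fst i) (snd i) \<longleftrightarrow> arc r (V, g) (fst i) (snd i)" if "\<forall>x\<in>arc_block r V i. f x = g x" for i f g
      using arc_local[of r V "fst i" "snd i" f g] that by simp
  qed (use V in \<open>auto simp: finite_tuples disjoint_arc_blocks\<close>)
  also have "\<dots> = rand_digraph V (arc_prob r (card V) p)"
    by (rule Pi_pmf_cong) (auto simp: prob_arc[OF V p])
  finally show ?thesis .
qed

text \<open>The equality of distributions concerns only pairs in \<open>V \<times> V\<close>; the
  congruence hypothesis on \<open>Q\<close> says that nothing else is looked at.\<close>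

lemma prob_arc_property:
  assumes V: "finite V" and p: "0 \<le> p" "p \<le> 1"
    and Q: "\<And>G G'. (\<And>x y. x \<in> V \<Longrightarrow> y \<in> V \<Longrightarrow> G x y = G' x y) \<Longrightarrow> Q G \<Longrightarrow> Q G'"
    and le: "measure_pmf.prob (rand_digraph V (arc_prob r (card V) p)) {g. \<not> Q (\<lambda>x y. g (x, y))} \<le> e"
  shows "measure_pmf.prob (rand_rel (r + 3) V p) {f. \<not> Q (arc r (V, f))} \<le> e"
proof -
  have "measure_pmf.prob (rand_rel (r + 3) V p) {f. \<not> Q (arc r (V, f))}
      \<le> measure_pmf.prob (rand_rel (r + 3) V p)
          {f. \<not> Q (\<lambda>x y. (x, y) \<in> V \<times> V \<and> arc r (V, f) (fst (x, y)) (snd (x, y)))}"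
  proof (rule measure_pmf.finite_measure_mono, rule subsetI)
    fix f assume *: "f \<in> {f. \<not> Q (arc r (V, f))}"
    have "Q (arc r (V, f))" if "Q (\<lambda>x y. (x, y) \<in> V \<times> V \<and> arc r (V, f) (fst (x, y)) (snd (x, y)))"
      by (rule Q[OF _ that]) simp
    then show "f \<in> {f. \<not> Q (\<lambda>x y. (x, y) \<in> V \<times> V \<and> arc r (V, f) (fst (x, y)) (snd (x, y)))}"
      using * by blast
  qed simp
  also have "\<dots> = measure_pmf.prob (rand_digraph V (arc_prob r (card V) p)) {g. \<not> Q (\<lambda>x y. g (x, y))}"
    unfolding map_arc_rand_rel[OF V p, symmetric] by (simp add: vimage_def)
  finally show ?thesis using le by linarith
qed

lemma
  assumes "\<And>x y. x \<in> V \<Longrightarrow> y \<in> V \<Longrightarrow> G x y = G' x y"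
  shows few_in_cong: "few_in V \<rho> G = few_in V \<rho> G'"
    and expanding_cong: "expanding V \<rho> L G = expanding V \<rho> L G'"
    and selecting_cong: "selecting V \<rho> t hi lo G = selecting V \<rho> t hi lo G'"
    and coding_cong: "coding V \<rho> t a u G = coding V \<rho> t a u G'"
proof -
  have "{y\<in>V. G y x} = {y\<in>V. G' y x}" if "x \<in> V" for x using assms that by auto
  then show "few_in V \<rho> G = few_in V \<rho> G'" unfolding few_in_def by simp
  have "{y\<in>V. (\<exists>x\<in>S. G y x) \<and> (\<forall>x\<in>Z. \<not> G y x)} = {y\<in>V. (\<exists>x\<in>S. G' y x) \<and> (\<forall>x\<in>Z. \<not> G' y x)}"
    if "S \<subseteq> V" "Z \<subseteq> V - S" for S Z
    using assms that by (intro Collect_cong) (metis Diff_iff subsetD)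
  then show "expanding V \<rho> L G = expanding V \<rho> L G'" unfolding expanding_def by simp
  have eq: "{y\<in>X. G c y} = {y\<in>X. G' c y}" if "X \<subseteq> V" "c \<in> V" for X c
    using assms that by auto
  have "(\<exists>c\<in>V. \<forall>b\<in>B. real (card {y\<in>X b. G c y}) < 4 * (real hi * \<rho>) \<and> lo * \<rho> / 4 < card {y\<in>Y b. G c y})
     = (\<exists>c\<in>V. \<forall>b\<in>B. real (card {y\<in>X b. G' c y}) < 4 * (real hi * \<rho>) \<and> lo * \<rho> / 4 < card {y\<in>Y b. G' c y})"
    if "\<forall>b\<in>B. X b \<subseteq> V \<and> card (X b) \<le> hi \<and> Y b \<subseteq> V \<and> card (Y b) \<le> hi \<and> lo \<le> card (Y b)" for B :: "'a set" and X Y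
    using that by (intro bex_cong ball_cong refl) (simp add: eq)
  then show "selecting V \<rho> t hi lo G = selecting V \<rho> t hi lo G'" unfolding selecting_def by simp
  have "{w\<in>V. pattern (G w) Z \<tau> Y} = {w\<in>V. pattern (G' w) Z \<tau> Y}"
    if "Z \<subseteq> V" "\<forall>i\<in>\<tau>. Y i \<subseteq> V - Z \<and> a \<le> real (card (Y i)) * \<rho>" for Z \<tau> and Y :: "'a \<Rightarrow> 'a set"
  proof -
    have "pattern (G w) Z \<tau> Y = pattern (G' w) Z \<tau> Y" if "w \<in> V" for w
      by (rule pattern_cong) (use \<open>Z \<subseteq> V\<close> \<open>\<forall>i\<in>\<tau>. _ i\<close> assms that in blast)
    then show ?thesis by auto
  qed
  then show "coding V \<rho> t a u G = coding V \<rho> t a u G'" unfolding coding_def by simp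
qed

context
  fixes V :: "'a set" and p \<rho> :: real and r :: nat
  assumes V: "finite V" and p: "0 \<le> p" "p \<le> 1" and \<rho>_def: "\<rho> = arc_prob r (card V) p"
begin

lemma rho_range: "0 \<le> \<rho>" "\<rho> \<le> 1"
  using arc_prob_bounds[OF p] by (auto simp: \<rho>_def)

lemma prob_not_few_in:
  "measure_pmf.prob (rand_rel (r + 3) V p) {f. \<not> few_in V \<rho> (arc r (V, f))} \<le> card V * exp (- (card V * \<rho>))"
proof (rule prob_arc_property[OF V p, where Q = "few_in V \<rho>"])
  show "measure_pmf.prob (rand_digraph V (arc_prob r (card V) p)) {g. \<not> few_in V \<rho> (\<lambda>x y. g (x, y))} \<le> card V * exp (- (card V * \<rho>))"
    using prob_large_in_degree[OF V rho_range] unfolding \<rho>_def[symmetric] few_in_def by (simp add: not_less)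
next
  show "few_in V \<rho> G'" if "\<And>x y. x \<in> V \<Longrightarrow> y \<in> V \<Longrightarrow> G x y = G' x y" "few_in V \<rho> G" for G G'
    using that(2) by (rule few_in_cong[THEN iffD1, rotated]) (rule that(1))
qed

lemma prob_not_expanding_arc:
  assumes "(1 + real L) * ln (card V + 1) - card V * \<rho> / 8 = e" "e \<le> 0"
  shows "measure_pmf.prob (rand_rel (r + 3) V p) {f. \<not> expanding V \<rho> L (arc r (V, f))} \<le> card V * exp e"
proof (rule prob_arc_property[OF V p, where Q = "expanding V \<rho> L"])
  have "{g. \<not> expanding V \<rho> L (\<lambda>x y. g (x, y))} = 
     {f. \<exists>S\<subseteq>V. \<exists>Z\<subseteq>V - S. 1 \<le> card S \<and> card Z \<le> L * card S \<and> card S * (1 + real L) * \<rho> \<le> 1 / 2 \<and>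
         real (card {y\<in>V. (\<exists>x\<in>S. f (y, x)) \<and> (\<forall>x\<in>Z. \<not> f (y, x))}) \<le> card V * \<rho> * card S / 8}"
    unfolding expanding_def by (simp add: not_less conj_assoc)
  then show "measure_pmf.prob (rand_digraph V (arc_prob r (card V) p)) {g. \<not> expanding V \<rho> L (\<lambda>x y. g (x, y))} \<le> card V * exp e"
    using prob_not_expanding[OF V rho_range assms] unfolding \<rho>_def[symmetric] by simp
next
  show "expanding V \<rho> L G'" if "\<And>x y. x \<in> V \<Longrightarrow> y \<in> V \<Longrightarrow> G x y = G' x y" "expanding V \<rho> L G" for G G'
    using that(2) by (rule expanding_cong[THEN iffD1, rotated]) (rule that(1))
qed

lemma prob_not_selecting:
  assumes "2 * real t * exp (- (lo * \<rho> / 4)) \<le> 1 / 2" "0 \<le> lo" "lo \<le> real hi"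
  shows "measure_pmf.prob (rand_rel (r + 3) V p) {f. \<not> selecting V \<rho> t hi lo (arc r (V, f))}
    \<le> (card V + 1) ^ (t + 2 * t * hi) * exp (- (card V / 2))"
proof (rule prob_arc_property[OF V p, where Q = "selecting V \<rho> t hi lo"])
  have "{g. \<not> selecting V \<rho> t hi lo (\<lambda>x y. g (x, y))} = 
     {f. \<exists>B\<subseteq>V. card B \<le> t \<and> (\<exists>X Y. (\<forall>b\<in>B. X b \<subseteq> V \<and> card (X b) \<le> hi \<and> Y b \<subseteq> V \<and> card (Y b) \<le> hi \<and> lo \<le> card (Y b)) \<and>
         \<not> (\<exists>c\<in>V. \<forall>b\<in>B. real (card {y\<in>X b. f (c, y)}) < 4 * (hi * \<rho>) \<and> lo * \<rho> / 4 < card {y\<in>Y b. f (c, y)}))}"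
    unfolding selecting_def by blast
  then show "measure_pmf.prob (rand_digraph V (arc_prob r (card V) p)) {g. \<not> selecting V \<rho> t hi lo (\<lambda>x y. g (x, y))}
    \<le> (card V + 1) ^ (t + 2 * t * hi) * exp (- (card V / 2))"
    using prob_no_selector[OF V rho_range assms] unfolding \<rho>_def[symmetric] by simp
next
  show "selecting V \<rho> t hi lo G'" if "\<And>x y. x \<in> V \<Longrightarrow> y \<in> V \<Longrightarrow> G x y = G' x y" "selecting V \<rho> t hi lo G" for G G'
    using that(2) by (rule selecting_cong[THEN iffD1, rotated]) (rule that(1))
qed

lemma prob_not_coding:
  assumes "0 \<le> a" "a \<le> 1"
  shows "measure_pmf.prob (rand_rel (r + 3) V p) {f. \<not> coding V \<rho> t a u (arc r (V, f))}
    \<le> (card V + 1) ^ (t + u + t * u) * exp (- (card V * (a ^ t * (1 - \<rho>) ^ u) / 4))"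
proof (rule prob_arc_property[OF V p, where Q = "coding V \<rho> t a u"])
  have "{g. \<not> coding V \<rho> t a u (\<lambda>x y. g (x, y))} =
     {f. \<exists>\<tau>\<subseteq>V. card \<tau> \<le> t \<and> (\<exists>Z Y. Z \<subseteq> V \<and> (\<forall>i\<in>\<tau>. Y i \<subseteq> V - Z \<and> a \<le> card (Y i) * \<rho>) \<and> disjoint_family_on Y \<tau> \<and>
         card Z + (\<Sum>i\<in>\<tau>. card (Y i)) \<le> u \<and>
         real (card {w\<in>V. pattern (\<lambda>y. f (w, y)) Z \<tau> Y}) \<le> card V * (a ^ t * (1 - \<rho>) ^ u) / 4)}"
    unfolding coding_def by (simp add: not_less conj_assoc)
  then show "measure_pmf.prob (rand_digraph V (arc_prob r (card V) p)) {g. \<not> coding V \<rho> t a u (\<lambda>x y. g (x, y))}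
    \<le> (card V + 1) ^ (t + u + t * u) * exp (- (card V * (a ^ t * (1 - \<rho>) ^ u) / 4))"
    using prob_few_codes[OF V rho_range assms] unfolding \<rho>_def[symmetric] by simp
next
  show "coding V \<rho> t a u G'" if "\<And>x y. x \<in> V \<Longrightarrow> y \<in> V \<Longrightarrow> G x y = G' x y" "coding V \<rho> t a u G" for G G'
    using that(2) by (rule coding_cong[THEN iffD1, rotated]) (rule that(1))
qed

lemma prob_not_transversal:
  assumes "0 \<le> a" "a \<le> 1"
  shows "measure_pmf.prob (rand_rel (r + 3) V p) {f. \<not> transversal (r + 2) (V, f) K a p}
     \<le> (real K + 1) * 2 ^ (card V * K) * exp (- (real (card V) ^ (r + 2) * (a ^ K * (1 - p) ^ card V)))"
proof -
  have "{f. \<not> transversal (r + 2) (V, f) K a p} =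
     {f. \<exists>k\<le>K. \<exists>Y. (\<forall>i<k. Y i \<subseteq> V \<and> a \<le> card (Y i) * p) \<and> disjoint_family_on Y {..<k} \<and>
         \<not> (\<exists>es\<in>tuples (r + 2) V. pattern (\<lambda>z. f (es @ [z])) (V - (\<Union>i<k. Y i)) {..<k} Y)}"
    unfolding transversal_def by (simp add: conj_assoc)
  moreover have "Suc (r + 2) = r + 3" by simp
  ultimately show ?thesis
    using prob_no_transversal[OF V p assms, where m = "r + 2" and K = K] by (simp only:)
qed

end

section \<open>Asymptotics\<close>

definition edge_prob :: "nat \<Rightarrow> real \<Rightarrow> nat \<Rightarrow> real" where
  "edge_prob r \<beta> n = (\<beta> + real r) * ln (real n) / real n"

lemma edge_prob_asymp:
  assumes "\<beta> > 0"
  shows "\<forall>\<^sub>F n in sequentially. 0 < edge_prob r \<beta> n \<and> edge_prob r \<beta> n \<le> 1"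
proof -
  have c: "\<beta> + real r > 0" using assms by simp
  have "\<forall>\<^sub>F n in sequentially. 0 < (\<beta> + real r) * ln (real n) / real n"
    using c by real_asymp
  moreover have "\<forall>\<^sub>F n in sequentially. (\<beta> + real r) * ln (real n) / real n \<le> 1"
    using c by real_asymp
  ultimately show ?thesis unfolding edge_prob_def by eventually_elim simp
qed

lemma isolated_prob_asymp:
  assumes "c > 0"
  shows "\<forall>\<^sub>F n in sequentially. 7 / 8 * real n powr - c \<le> (1 - c * ln (real n) / real n) ^ n \<and>
     (1 - c * ln (real n) / real n) ^ n \<le> 9 / 8 * real n powr - c"
proof -
  have lim: "(\<lambda>n. (1 - c * ln (real n) / real n) ^ n * real n powr c) \<longlonglongrightarrow> 1"
    using assms by real_asymp
  have "\<forall>\<^sub>F n in sequentially. 7 / 8 < (1 - c * ln (real n) / real n) ^ n * real n powr c"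
    "\<forall>\<^sub>F n in sequentially. (1 - c * ln (real n) / real n) ^ n * real n powr c < 9 / 8"
    by (rule order_tendstoD[OF lim]; simp)+
  then show ?thesis
    using eventually_gt_at_top[of 0]
    by eventually_elim (simp add: powr_minus field_simps)
qed

text \<open>The upper bound is Bernoulli's inequality. For the lower one,
  \<open>(1 - q) ^ N * (1 + q) ^ N \<le> 1\<close>, and Bernoulli's inequality bounds the second
  factor from below by \<open>1 + N * q\<close>.\<close>

lemma one_minus_power_bounds:
  fixes q :: real
  assumes "0 \<le> q" "q \<le> 1"
  shows "real N * q / (1 + real N * q) \<le> 1 - (1 - q) ^ N" "1 - (1 - q) ^ N \<le> real N * q"
proof -
  show "1 - (1 - q) ^ N \<le> real N * q"
    using Bernoulli_inequality[of "- q" N] assms by simp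
  have "(1 - q) ^ N * (1 + real N * q) \<le> (1 - q) ^ N * (1 + q) ^ N"
    using assms Bernoulli_inequality[of q N] by (intro mult_left_mono) auto
  also have "\<dots> = ((1 - q) * (1 + q)) ^ N" by (simp add: power_mult_distrib)
  also have "\<dots> \<le> 1" using assms mult_le_one[of q q] by (intro power_le_one) (auto simp: algebra_simps)
  finally have "(1 - q) ^ N \<le> 1 / (1 + real N * q)" using assms by (simp add: field_simps add_pos_nonneg)
  moreover have "1 - 1 / (1 + real N * q) = real N * q / (1 + real N * q)"
  proof -
    have "1 + real N * q > 0" using assms by (simp add: add_pos_nonneg)
    then show ?thesis by (simp add: field_simps)
  qed
  ultimately show "real N * q / (1 + real N * q) \<le> 1 - (1 - q) ^ N" by linarith
qed

lemma exp_le_one_minus: "0 \<le> x \<Longrightarrow> x \<le> 1 / 2 \<Longrightarrow> exp (- (2 * x)) \<le> 1 - (x::real)"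
proof -
  assume x: "0 \<le> x" "x \<le> 1 / 2"
  have "2 * x\<^sup>2 \<le> x" using x mult_left_mono[of x "1/2" x] by (simp add: power2_eq_square)
  then have "- (2 * x) \<le> ln (1 - x)"
    using ln_one_minus_pos_lower_bound[OF x] by simp
  then have "exp (- (2 * x)) \<le> exp (ln (1 - x))" by (simp only: exp_le_cancel_iff)
  then show ?thesis using x by simp
qed

lemma arc_prob_asymp:
  assumes \<beta>: "\<beta> > 0"
  shows "\<forall>\<^sub>F n in sequentially. 1 / 2 * real n powr - \<beta> \<le> arc_prob r n (edge_prob r \<beta> n) \<and>
     arc_prob r n (edge_prob r \<beta> n) \<le> 2 * real n powr - \<beta>"
proof -
  have c: "\<beta> + real r > 0" using \<beta> by simp
  have "\<forall>\<^sub>F n in sequentially. real n powr - \<beta> \<le> 1 / 2" using \<beta> by real_asymp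
  then show ?thesis
    using isolated_prob_asymp[OF c] edge_prob_asymp[OF \<beta>, of r] eventually_gt_at_top[of 0]
  proof eventually_elim
    case (elim n)
    define q where "q = (1 - edge_prob r \<beta> n) ^ n"
    define b where "b = real n powr - \<beta>"
    have q: "0 \<le> q" "q \<le> 1" using elim(3) by (auto simp: q_def power_le_one)
    have "7 / 8 * real n powr - (\<beta> + real r) \<le> q" "q \<le> 9 / 8 * real n powr - (\<beta> + real r)"
      using elim(2) by (auto simp: q_def edge_prob_def)
    moreover have "real (n ^ r) * real n powr - (\<beta> + real r) = b"
    proof -
      have "real (n ^ r) = real n powr real r" using elim(4) by (simp add: powr_realpow)
      then show ?thesis by (simp add: powr_add[symmetric] b_def)
    qed
    ultimately have Nq: "7 / 8 * b \<le> real (n ^ r) * q" "real (n ^ r) * q \<le> 9 / 8 * b"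
      using mult_left_mono[of "7 / 8 * real n powr - (\<beta> + real r)" q "real (n ^ r)"]
        mult_left_mono[of q "9 / 8 * real n powr - (\<beta> + real r)" "real (n ^ r)"] by (simp_all add: mult_ac)
    have b: "0 \<le> b" "b \<le> 1 / 2" using elim(1) by (simp_all add: b_def)
    have "1 / 2 * b \<le> real (n ^ r) * q / (1 + real (n ^ r) * q)"
    proof -
      \<comment> \<open>With \<open>b \<le> 1 / 2\<close> the left side is at most
        \<open>1 + 9 / 16\<close>; dividing 7/8 by 7/4 leaves the constant 1/2 of the
        statement.\<close>
      have "1 + real (n ^ r) * q \<le> 7 / 4" using Nq b by linarith
      moreover have "0 < 1 + real (n ^ r) * q" using q by (simp add: add_pos_nonneg)
      ultimately have "1 / 2 * b * (1 + real (n ^ r) * q) \<le> 1 / 2 * b * (7 / 4)" using b by (intro mult_left_mono) auto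
      also have "\<dots> \<le> real (n ^ r) * q" using Nq by linarith
      finally show ?thesis using \<open>0 < 1 + real (n ^ r) * q\<close> by (simp add: pos_le_divide_eq)
    qed
    also note one_minus_power_bounds(1)[OF q, of "n ^ r"]
    finally have lower: "1 / 2 * b \<le> arc_prob r n (edge_prob r \<beta> n)" by (simp add: arc_prob_def q_def)
    have "arc_prob r n (edge_prob r \<beta> n) \<le> real (n ^ r) * q"
      using one_minus_power_bounds(2)[OF q, of "n ^ r"] by (simp add: arc_prob_def q_def)
    then show ?case using lower Nq b by (simp add: b_def)
  qed
qed

text \<open>The set reached along \<open>ops\<close> has size about \<open>n\<close> to the power \<open>size_expo \<beta> ops\<close>.\<close>

primrec size_expo :: "real \<Rightarrow> bool list \<Rightarrow> real" where
  "size_expo \<beta> [] = 0"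
| "size_expo \<beta> (grow # ops) = (if grow then 1 - \<beta> else - \<beta>) + size_expo \<beta> ops"

text \<open>Growing needs size times density to tend to 0, so that in-neighbourhoods hardly overlap.
  Selecting needs it to tend to infinity for concentration, and the size has to stay below a power
  of \<open>n\<close> smaller than 1 for the union bound over sets of that size.\<close>

primrec admissible :: "real \<Rightarrow> bool list \<Rightarrow> bool" where
  "admissible \<beta> [] \<longleftrightarrow> True"
| "admissible \<beta> (grow # ops) \<longleftrightarrow> admissible \<beta> ops \<and>
     (if grow then size_expo \<beta> ops < \<beta> else \<beta> < size_expo \<beta> ops \<and> size_expo \<beta> ops < 1)"

text \<open>Each step loses 4 from \<open>size_hi\<close> and 2 from the upper bound on
  \<open>\<rho>\<close>, which makes 8; at worst 8 from \<open>size_lo\<close> and 2 from the lower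
  bound on \<open>\<rho>\<close>, which makes 16.\<close>

lemma size_bounds:
  assumes n: "n > 0" and \<rho>: "1 / 2 * n powr - \<beta> \<le> \<rho>" "\<rho> \<le> 2 * n powr - \<beta>"
  shows "size_hi n \<rho> ops \<le> 8 ^ length ops * n powr size_expo \<beta> ops"
    and "n powr size_expo \<beta> ops \<le> 16 ^ length ops * size_lo n \<rho> ops"
proof -
  have step: "n * n powr - \<beta> = n powr (1 - \<beta>)" using n by (simp add: powr_diff powr_minus field_simps)
  have b: "0 \<le> n powr - \<beta>" by simp
  have \<rho>0: "0 \<le> \<rho>" using \<rho> b by linarith
  have g1: "n * \<rho> \<le> 2 * n powr (1 - \<beta>)"
    using mult_left_mono[OF \<rho>(2), of n] n unfolding step[symmetric] by simp
  have g2: "n powr (1 - \<beta>) \<le> 2 * (n * \<rho>)"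
    using mult_left_mono[OF \<rho>(1), of n] n unfolding step[symmetric] by simp
  show "size_hi n \<rho> ops \<le> 8 ^ length ops * n powr size_expo \<beta> ops"
  proof (induction ops)
    case (Cons g ops)
    have f: "(if g then n * \<rho> else \<rho>) \<le> 2 * n powr (if g then 1 - \<beta> else - \<beta>)" "0 \<le> (if g then n * \<rho> else \<rho>)"
      using g1 \<rho> \<rho>0 n by auto
    have "size_hi n \<rho> (g # ops) \<le> 4 * ((2 * n powr (if g then 1 - \<beta> else - \<beta>)) * (8 ^ length ops * n powr size_expo \<beta> ops))"
      unfolding size_hi.simps using f Cons.IH
      by (intro mult_left_mono order_trans[OF mult_left_mono[OF Cons.IH f(2)]] mult_right_mono) auto
    then show ?case by (simp add: powr_add algebra_simps)
  qed (use n in simp)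
  show "n powr size_expo \<beta> ops \<le> 16 ^ length ops * size_lo n \<rho> ops"
  proof (induction ops)
    case (Cons g ops)
    have f: "n powr (if g then 1 - \<beta> else - \<beta>) \<le> 16 * (if g then n * \<rho> / 8 else \<rho> / 4)" "0 \<le> (if g then n * \<rho> / 8 else \<rho> / 4)"
      using g2 \<rho> \<rho>0 n by (cases g; simp add: mult_ac)+
    have "n powr size_expo \<beta> (g # ops) = n powr (if g then 1 - \<beta> else - \<beta>) * n powr size_expo \<beta> ops"
      by (simp add: powr_add)
    also have "\<dots> \<le> (16 * (if g then n * \<rho> / 8 else \<rho> / 4)) * (16 ^ length ops * size_lo n \<rho> ops)"
      using f Cons.IH by (intro mult_mono) auto
    finally show ?case by (simp add: mult_ac)
  qed (use n in simp)
qed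

text \<open>The factor 2 leaves room for rounding \<open>size_hi\<close> down to a natural number
  that is still at least \<open>size_lo\<close>.\<close>

lemma size_lo_le_hi: "0 \<le> n \<Longrightarrow> 0 \<le> \<rho> \<Longrightarrow> size_lo n \<rho> ops \<le> size_hi n \<rho> ops \<and> 0 \<le> size_lo n \<rho> ops
    \<and> (ops \<noteq> [] \<longrightarrow> 2 * size_lo n \<rho> ops \<le> size_hi n \<rho> ops)"
proof (induction ops)
  case (Cons g ops)
  then have IH: "size_lo n \<rho> ops \<le> size_hi n \<rho> ops" "0 \<le> size_lo n \<rho> ops" by auto
  let ?f = "if g then n * \<rho> else \<rho>"
  have f: "0 \<le> ?f" using Cons by simp
  have "2 * size_lo n \<rho> (g # ops) \<le> ?f * size_lo n \<rho> ops" using Cons IH by (auto intro!: mult_right_mono)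
  also have "\<dots> \<le> ?f * size_hi n \<rho> ops" using f IH by (intro mult_left_mono) auto
  also have "\<dots> \<le> size_hi n \<rho> (g # ops)" using f IH by (simp add: mult_nonneg_nonneg)
  finally have "2 * size_lo n \<rho> (g # ops) \<le> size_hi n \<rho> (g # ops)" .
  moreover have "0 \<le> size_lo n \<rho> (g # ops)" using Cons IH by simp
  ultimately show ?case by linarith
qed simp

text \<open>Two demands meet here. The loss for a family of \<open>t ^ 2\<close> classes is about
  \<open>exp (- c * t ^ 3)\<close>, which must be subpolynomial in \<open>n\<close>; an exponent
  below 1/3 achieves this. And \<open>t\<close> must exceed \<open>2 * tow l\<close> at the critical
  sizes, for which any positive power of \<open>ln n\<close> is enough.\<close>

abbreviation tbound :: "nat \<Rightarrow> real" where "tbound n \<equiv> ln (real n) powr (1 / 8)"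

definition tsize :: "nat \<Rightarrow> nat" where "tsize n = nat \<lfloor>tbound n\<rfloor>"

lemma tsize_le: "real (tsize n) \<le> tbound n"
  unfolding tsize_def by simp

lemma power_le_exp: "real k \<le> x \<Longrightarrow> (real n + 1) ^ k \<le> exp (x * ln (real n + 1))"
proof -
  assume k: "real k \<le> x"
  have "(real n + 1) ^ k = exp (real k * ln (real n + 1))" by (simp add: exp_of_nat_mult)
  also have "\<dots> \<le> exp (x * ln (real n + 1))" using k by (simp add: mult_right_mono)
  finally show ?thesis .
qed

section \<open>The pseudo-random properties hold asymptotically almost surely for
  \<open>\<beta>\<close> between 0 and 1\<close>

context
  fixes \<beta> :: real and r :: nat
  assumes \<beta>: "0 < \<beta>" "\<beta> < 1"
begin

abbreviation "P n \<equiv> edge_prob r \<beta> n"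
abbreviation "R n \<equiv> arc_prob r n (P n)"

definition typical :: "nat \<Rightarrow> bool" where
  "typical n \<longleftrightarrow> 0 < n \<and> 1 \<le> tbound n \<and> 0 < P n \<and> P n \<le> 1 \<and> 0 < R n \<and> R n \<le> 1 \<and> 1 / 2 * real n powr - \<beta> \<le> R n \<and> R n \<le> 2 * real n powr - \<beta>"

lemma eventually_typical: "eventually typical sequentially"
proof -
  have "\<forall>\<^sub>F n in sequentially. 1 \<le> tbound n" by real_asymp
  then show ?thesis
    using edge_prob_asymp[OF \<beta>(1), of r] arc_prob_asymp[OF \<beta>(1), of r] eventually_gt_at_top[of 0]
  proof eventually_elim
    case (elim n)
    have "0 < 1 / 2 * real n powr - \<beta>" using elim by simp
    then show ?case using elim arc_prob_bounds[of "P n" r n] unfolding typical_def by linarith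
  qed
qed

abbreviation "Prob n Q \<equiv> measure_pmf.prob (rand_rel (r + 3) {1..n} (P n)) {f. Q f}"

lemma few_in_whp: "(\<lambda>n. Prob n (\<lambda>f. \<not> few_in {1..n} (R n) (arc r ({1..n}, f)))) \<longlonglongrightarrow> 0"
proof (rule Lim_null_comparison)
  show "(\<lambda>n. real n * exp (- (real n * (1 / 2 * real n powr - \<beta>)))) \<longlonglongrightarrow> 0"
    using \<beta>(2) by real_asymp
  show "\<forall>\<^sub>F n in sequentially. norm (Prob n (\<lambda>f. \<not> few_in {1..n} (R n) (arc r ({1..n}, f)))) \<le> real n * exp (- (real n * (1 / 2 * real n powr - \<beta>)))"
    using eventually_typical
  proof eventually_elim
    case (elim n)
    have "Prob n (\<lambda>f. \<not> few_in {1..n} (R n) (arc r ({1..n}, f))) \<le> n * exp (- (n * R n))"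
      using prob_not_few_in[of "{1..n}" "P n" "R n" r] elim by (simp add: typical_def)
    also have "\<dots> \<le> real n * exp (- (real n * (1 / 2 * real n powr - \<beta>)))"
      using elim unfolding typical_def by (intro mult_left_mono) (simp_all add: mult_left_mono)
    finally show ?case by simp
  qed
qed

lemma expanding_whp:
  fixes C :: nat
  assumes C: "C > 0"
  shows "(\<lambda>n. Prob n (\<lambda>f. \<not> expanding {1..n} (R n) (C * tsize n) (arc r ({1..n}, f)))) \<longlonglongrightarrow> 0"
proof (rule Lim_null_comparison)
  let ?e = "\<lambda>n. (1 + real C * tbound n) * ln (real n + 1) - real n * (1 / 2 * real n powr - \<beta>) / 8"
  have C': "real C > 0" using C by simp
  show "(\<lambda>n. real n * exp (?e n)) \<longlonglongrightarrow> 0"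
    using \<beta>(2) C' by real_asymp
  have "\<forall>\<^sub>F n in sequentially. ?e n \<le> 0" using \<beta>(2) C' by real_asymp
  then show "\<forall>\<^sub>F n in sequentially. norm (Prob n (\<lambda>f. \<not> expanding {1..n} (R n) (C * tsize n) (arc r ({1..n}, f)))) \<le> real n * exp (?e n)"
    using eventually_typical
  proof eventually_elim
    case (elim n)
    define e where "e = (1 + real (C * tsize n)) * ln (card {1..n} + 1) - card {1..n} * R n / 8"
    have "(1 + real (C * tsize n)) * ln (real n + 1) \<le> (1 + real C * tbound n) * ln (real n + 1)"
      using tsize_le[of n] by (intro mult_right_mono) (auto simp: mult_left_mono)
    moreover have "real n * (1 / 2 * real n powr - \<beta>) \<le> real n * R n"
      using elim(2) unfolding typical_def by (intro mult_left_mono) auto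
    ultimately have e: "e \<le> ?e n" by (simp add: e_def add.commute)
    have "Prob n (\<lambda>f. \<not> expanding {1..n} (R n) (C * tsize n) (arc r ({1..n}, f))) \<le> n * exp e"
      using prob_not_expanding_arc[of "{1..n}" "P n" "R n" r "C * tsize n" e] elim e unfolding e_def[symmetric] typical_def
      by (simp add: e_def)
    also have "\<dots> \<le> n * exp (?e n)" using e by (intro mult_left_mono) auto
    finally show ?case by simp
  qed
qed

lemma selecting_whp:
  assumes \<sigma>: "\<beta> < size_expo \<beta> ops" "size_expo \<beta> ops < 1"
  shows "(\<lambda>n. Prob n (\<lambda>f. \<not> selecting {1..n} (R n) (tsize n) (nat \<lfloor>size_hi (card {1..n}) (R n) ops\<rfloor>)
     (size_lo (card {1..n}) (R n) ops) (arc r ({1..n}, f)))) \<longlonglongrightarrow> 0"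
proof (rule Lim_null_comparison)
  define s where "s = size_expo \<beta> ops"
  define D :: real where "D = 8 ^ length ops"
  define D' :: real where "D' = 1 / 16 ^ length ops"
  have D: "D > 0" "D' > 0" by (simp_all add: D_def D'_def)
  have s: "\<beta> < s" "0 < s" "s < 1" using \<sigma> \<beta> by (simp_all add: s_def)
  have ne: "ops \<noteq> []" using s(2) by (auto simp: s_def)
  show "(\<lambda>n. exp ((tbound n + 2 * tbound n * (D * real n powr s)) * ln (real n + 1) - real n / 2)) \<longlonglongrightarrow> 0"
    using s(2,3) D by real_asymp
  have "\<forall>\<^sub>F n in sequentially. 2 * tbound n * exp (- (D' * real n powr s * (1 / 2 * real n powr - \<beta>) / 4)) \<le> 1 / 2"
    using s(1) D by real_asymp
  moreover have "\<forall>\<^sub>F n in sequentially. 2 \<le> D' * real n powr s" using s D by real_asymp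
  ultimately show "\<forall>\<^sub>F n in sequentially. norm (Prob n (\<lambda>f. \<not> selecting {1..n} (R n) (tsize n) (nat \<lfloor>size_hi (card {1..n}) (R n) ops\<rfloor>)
     (size_lo (card {1..n}) (R n) ops) (arc r ({1..n}, f)))) \<le> exp ((tbound n + 2 * tbound n * (D * real n powr s)) * ln (real n + 1) - real n / 2)"
    using eventually_typical
  proof eventually_elim
    case (elim n)
    note ty = elim(3)[unfolded typical_def]
    define hi where "hi = size_hi n (R n) ops"
    define lo where "lo = size_lo n (R n) ops"
    have hi: "hi \<le> D * real n powr s"
      using size_bounds(1)[of "real n" \<beta> "R n" ops] ty by (simp add: hi_def D_def s_def)
    have lo: "D' * real n powr s \<le> lo"
      using size_bounds(2)[of "real n" \<beta> "R n" ops] ty by (simp add: lo_def D'_def s_def field_simps)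
    have lohi: "lo \<le> hi" "0 \<le> lo" "2 * lo \<le> hi"
      using size_lo_le_hi[of "real n" "R n" ops] ty ne by (auto simp: hi_def lo_def)
    have nhi: "real (nat \<lfloor>hi\<rfloor>) \<le> hi" "lo \<le> real (nat \<lfloor>hi\<rfloor>)"
      using lohi lo elim(2) by linarith+
    have "D' * real n powr s * (1 / 2 * real n powr - \<beta>) \<le> lo * R n"
      using lo ty lohi D by (intro mult_mono) auto
    then have "2 * real (tsize n) * exp (- (lo * R n / 4)) \<le> 2 * tbound n * exp (- (D' * real n powr s * (1 / 2 * real n powr - \<beta>) / 4))"
      using tsize_le[of n] by (intro mult_mono) auto
    also note elim(1)
    finally have small: "2 * real (tsize n) * exp (- (lo * R n / 4)) \<le> 1 / 2" .
    have "Prob n (\<lambda>f. \<not> selecting {1..n} (R n) (tsize n) (nat \<lfloor>hi\<rfloor>) lo (arc r ({1..n}, f)))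
       \<le> (real n + 1) ^ (tsize n + 2 * tsize n * nat \<lfloor>hi\<rfloor>) * exp (- (n / 2))"
      using prob_not_selecting[of "{1..n}" "P n" "R n" r "tsize n" lo "nat \<lfloor>hi\<rfloor>"] ty small lohi nhi by (simp add: add.commute)
    also have "\<dots> \<le> exp ((tbound n + 2 * tbound n * (D * real n powr s)) * ln (real n + 1)) * exp (- (n / 2))"
    proof (rule mult_right_mono[OF power_le_exp])
      have "real (tsize n) * real (nat \<lfloor>hi\<rfloor>) \<le> tbound n * (D * real n powr s)"
        using tsize_le[of n] nhi hi by (intro mult_mono) auto
      then show "real (tsize n + 2 * tsize n * nat \<lfloor>hi\<rfloor>) \<le> tbound n + 2 * tbound n * (D * real n powr s)"
        using tsize_le[of n] by simp
    qed simp
    also have "\<dots> = exp ((tbound n + 2 * tbound n * (D * real n powr s)) * ln (real n + 1) - real n / 2)"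
      by (simp only: exp_add[symmetric] diff_conv_add_uminus)
    finally show ?case by (simp add: hi_def lo_def)
  qed
qed

lemma selecting_all_whp:
  assumes "admissible \<beta> ops"
  shows "(\<lambda>n. Prob n (\<lambda>f. \<not> selecting_all {1..n} (R n) (tsize n) ops (arc r ({1..n}, f)))) \<longlonglongrightarrow> 0"
  using assms
proof (induction ops)
  case (Cons g ops)
  show ?case
  proof (cases g)
    case False
    have adm: "admissible \<beta> ops" "\<beta> < size_expo \<beta> ops" "size_expo \<beta> ops < 1"
      using Cons.prems False by auto
    show ?thesis
    proof (rule Lim_null_comparison)
      show "(\<lambda>n. Prob n (\<lambda>f. \<not> selecting_all {1..n} (R n) (tsize n) ops (arc r ({1..n}, f))) +
         Prob n (\<lambda>f. \<not> selecting {1..n} (R n) (tsize n) (nat \<lfloor>size_hi (card {1..n}) (R n) ops\<rfloor>)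
           (size_lo (card {1..n}) (R n) ops) (arc r ({1..n}, f)))) \<longlonglongrightarrow> 0"
        using tendsto_add[OF Cons.IH[OF adm(1)] selecting_whp[OF adm(2,3)]] by (simp only: add_0)
      have "Prob n (\<lambda>f. \<not> selecting_all {1..n} (R n) (tsize n) (g # ops) (arc r ({1..n}, f))) \<le>
        Prob n (\<lambda>f. \<not> selecting_all {1..n} (R n) (tsize n) ops (arc r ({1..n}, f))) +
        Prob n (\<lambda>f. \<not> selecting {1..n} (R n) (tsize n) (nat \<lfloor>size_hi (card {1..n}) (R n) ops\<rfloor>)
         (size_lo (card {1..n}) (R n) ops) (arc r ({1..n}, f)))" for n
        using False by (intro order_trans[OF _ measure_Un_le] measure_pmf.finite_measure_mono) auto
      then show "\<forall>\<^sub>F n in sequentially. norm (Prob n (\<lambda>f. \<not> selecting_all {1..n} (R n) (tsize n) (g # ops) (arc r ({1..n}, f)))) \<le>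
        Prob n (\<lambda>f. \<not> selecting_all {1..n} (R n) (tsize n) ops (arc r ({1..n}, f))) +
        Prob n (\<lambda>f. \<not> selecting {1..n} (R n) (tsize n) (nat \<lfloor>size_hi (card {1..n}) (R n) ops\<rfloor>)
         (size_lo (card {1..n}) (R n) ops) (arc r ({1..n}, f)))"
        by (intro always_eventually allI) (simp only: real_norm_def abs_of_nonneg[OF measure_nonneg])
    qed
  qed (use Cons in simp)
qed simp

text \<open>The upper and lower size bounds differ by at most \<open>8 * 16 = 128\<close> per step,
  which gives \<open>L = 128 ^ h * t\<close>.\<close>

lemma sizes_ok_eventually:
  assumes "admissible \<beta> ops" "length ops \<le> h"
  shows "\<forall>\<^sub>F n in sequentially. sizes_ok (card {1..n}) (R n) (tsize n) (128 ^ h * tsize n) ops"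
  using assms
proof (induction ops)
  case (Cons g ops)
  define D :: real where "D = 8 ^ length ops"
  define C :: real where "C = 128 ^ h"
  define s where "s = size_expo \<beta> ops"
  have DC: "D > 0" "C > 0" by (simp_all add: D_def C_def)
  have "\<forall>\<^sub>F n in sequentially. g \<longrightarrow> D * real n powr s * (1 + C * tbound n) * (2 * real n powr - \<beta>) \<le> 1 / 2"
  proof (cases g)
    case True
    then have "s < \<beta>" using Cons.prems by (simp add: s_def)
    then have "\<forall>\<^sub>F n in sequentially. D * real n powr s * (1 + C * tbound n) * (2 * real n powr - \<beta>) \<le> 1 / 2"
      using DC by real_asymp
    then show ?thesis by eventually_elim simp
  qed simp
  moreover have "\<forall>\<^sub>F n in sequentially. sizes_ok (card {1..n}) (R n) (tsize n) (128 ^ h * tsize n) ops"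
    using Cons by simp
  ultimately show ?case
    using eventually_typical
  proof eventually_elim
    case (elim n)
    note ty = elim(3)[unfolded typical_def]
    define hi where "hi = size_hi n (R n) ops"
    define lo where "lo = size_lo n (R n) ops"
    have hi: "hi \<le> D * real n powr s"
      using size_bounds(1)[of "real n" \<beta> "R n" ops] ty by (simp add: hi_def D_def s_def)
    have lo: "real n powr s \<le> 16 ^ length ops * lo"
      using size_bounds(2)[of "real n" \<beta> "R n" ops] ty by (simp add: lo_def s_def)
    have lo0: "0 \<le> lo" "0 \<le> hi" using size_lo_le_hi[of "real n" "R n" ops] ty by (auto simp: hi_def lo_def)
    have "hi \<le> 8 ^ length ops * (16 ^ length ops * lo)"
      using hi lo unfolding D_def by (meson mult_left_mono order_trans zero_le_numeral zero_le_power)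
    also have "\<dots> = 128 ^ length ops * lo" by (simp add: power_mult_distrib[symmetric] mult.assoc[symmetric])
    also have "\<dots> \<le> 128 ^ h * lo" using Cons.prems lo0 by (intro mult_right_mono power_increasing) auto
    finally have "real (tsize n) * hi \<le> real (tsize n) * (128 ^ h * lo)" by (rule mult_left_mono) simp
    then have one: "real (tsize n) * hi \<le> real (128 ^ h * tsize n) * lo" by (simp add: mult_ac)
    have two: "hi * (1 + real (128 ^ h * tsize n)) * R n \<le> 1 / 2" if g
    proof -
      have "hi * (1 + real (128 ^ h * tsize n)) * R n \<le> D * real n powr s * (1 + C * tbound n) * (2 * real n powr - \<beta>)"
        using hi lo0 tsize_le[of n] ty DC by (intro mult_mono mult_nonneg_nonneg add_mono) (auto simp: C_def)
      then show ?thesis using elim(1) that by linarith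
    qed
    show ?case using elim(2) one two by (simp add: hi_def lo_def)
  qed
qed simp

text \<open>Bounds the total size of \<open>t\<close> sets reached along a path of length
  \<open>h\<close> with final exponent \<open>\<beta>\<close>.\<close>

definition usize :: "nat \<Rightarrow> nat \<Rightarrow> nat" where
  "usize h n = nat \<lceil>8 ^ h * tbound n * real n powr \<beta>\<rceil>"

lemma usize_bounds: "8 ^ h * tbound n * real n powr \<beta> \<le> usize h n" "usize h n \<le> 8 ^ h * tbound n * real n powr \<beta> + 1"
  unfolding usize_def by (simp_all add: of_nat_ceiling)

text \<open>The logarithm is the price per factor \<open>1 / (2 * 16 ^ h)\<close>. The rest comes
  from \<open>2 * R n * usize h n\<close>, which is at most \<open>4 * 8 ^ h * tbound n + 4\<close>,
  and \<open>tbound n \<ge> 1\<close> absorbs the last 4.\<close>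

definition rate :: "nat \<Rightarrow> real" where
  "rate h = ln (2 * 16 ^ h) + 4 * 8 ^ h + 4"

lemma rate_pos: "0 < rate h"
proof -
  have "0 \<le> ln (2 * 16 ^ h :: real)" by (rule ln_ge_zero) (simp add: one_le_power order_trans[of 1 "2 :: real"])
  then show ?thesis unfolding rate_def by (simp add: add_nonneg_pos)
qed

lemma types_lower_bound:
  assumes ty: "typical n" and half: "R n \<le> 1 / 2"
  shows "exp (- rate h * tbound n) \<le> (1 / (2 * 16 ^ h)) ^ tsize n * (1 - R n) ^ usize h n"
proof -
  note ty = ty[unfolded typical_def]
  have l: "0 \<le> ln (2 * 16 ^ h :: real)" by (rule ln_ge_zero) (simp add: one_le_power order_trans[of 1 "2 :: real"])
  have "exp (- ln (2 * 16 ^ h) * tbound n) \<le> exp (real (tsize n) * (- ln (2 * 16 ^ h)))"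
    using mult_left_mono[OF tsize_le[of n] l] by (simp add: mult.commute)
  also have "\<dots> = (1 / (2 * 16 ^ h)) ^ tsize n"
    unfolding exp_of_nat_mult by (simp add: exp_minus inverse_eq_divide)
  finally have A: "exp (- ln (2 * 16 ^ h) * tbound n) \<le> (1 / (2 * 16 ^ h)) ^ tsize n" .
  have "2 * R n * usize h n \<le> 2 * (2 * real n powr - \<beta>) * (8 ^ h * tbound n * real n powr \<beta> + 1)"
    using ty usize_bounds(2)[of h n] by (intro mult_mono) auto
  also have "\<dots> = 4 * 8 ^ h * tbound n * (real n powr - \<beta> * real n powr \<beta>) + 4 * real n powr - \<beta>"
    by (simp add: algebra_simps)
  also have "real n powr - \<beta> * real n powr \<beta> = 1" using ty by (simp add: powr_add[symmetric])
  also have "real n powr - \<beta> \<le> 1"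
    using ty \<beta> ge_one_powr_ge_zero[of "real n" \<beta>] by (simp add: powr_minus inverse_le_1_iff)
  finally have "2 * R n * usize h n \<le> (4 * 8 ^ h + 4) * tbound n" using ty by (simp add: algebra_simps)
  then have "exp (- (4 * 8 ^ h + 4) * tbound n) \<le> exp (real (usize h n) * (- (2 * R n)))"
    by (simp add: algebra_simps)
  also have "\<dots> = exp (- (2 * R n)) ^ usize h n" by (rule exp_of_nat_mult)
  also have "\<dots> \<le> (1 - R n) ^ usize h n"
    using ty half by (intro power_mono exp_le_one_minus) auto
  finally have B: "exp (- (4 * 8 ^ h + 4) * tbound n) \<le> (1 - R n) ^ usize h n" .
  have "exp (- rate h * tbound n) = exp (- ln (2 * 16 ^ h) * tbound n) * exp (- (4 * 8 ^ h + 4) * tbound n)"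
    by (simp add: exp_add[symmetric] rate_def algebra_simps)
  also have "\<dots> \<le> (1 / (2 * 16 ^ h)) ^ tsize n * (1 - R n) ^ usize h n"
    by (rule mult_mono[OF A B]) auto
  finally show ?thesis .
qed

lemma eventually_R_half: "\<forall>\<^sub>F n in sequentially. R n \<le> 1 / 2"
proof -
  have "\<forall>\<^sub>F n in sequentially. 2 * real n powr - \<beta> \<le> 1 / 2" using \<beta>(1) by real_asymp
  then show ?thesis using eventually_typical by eventually_elim (simp add: typical_def)
qed

text \<open>The union bound costs an exponent of order \<open>n powr \<beta>\<close> up to
  logarithmic factors, against a gain of \<open>n * exp (- c * tbound n)\<close>, which is
  \<open>n\<close> to the power \<open>1 - o(1)\<close>.\<close>

lemma coding_whp:
  "(\<lambda>n. Prob n (\<lambda>f. \<not> coding {1..n} (R n) (tsize n) (1 / (2 * 16 ^ h)) (usize h n) (arc r ({1..n}, f)))) \<longlonglongrightarrow> 0"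
proof (rule Lim_null_comparison)
  define D :: real where "D = 8 ^ h"
  define c where "c = rate h"
  have Dc: "D > 0" "c > 0" by (simp_all add: D_def c_def rate_pos)
  let ?e = "\<lambda>n. (tbound n + (1 + tbound n) * (D * tbound n * real n powr \<beta> + 1)) * ln (real n + 1) - real n * exp (- c * tbound n) / 4"
  show "(\<lambda>n. exp (?e n)) \<longlonglongrightarrow> 0" using \<beta> Dc by real_asymp
  show "\<forall>\<^sub>F n in sequentially. norm (Prob n (\<lambda>f. \<not> coding {1..n} (R n) (tsize n) (1 / (2 * 16 ^ h)) (usize h n) (arc r ({1..n}, f)))) \<le> exp (?e n)"
    using eventually_typical eventually_R_half
  proof eventually_elim
    case (elim n)
    note ty = elim(1)[unfolded typical_def]
    let ?a = "1 / (2 * 16 ^ h) :: real"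
    have a: "0 \<le> ?a" "?a \<le> 1" by (simp_all add: one_le_power order_trans[of 1 "2 :: real"])
    have "Prob n (\<lambda>f. \<not> coding {1..n} (R n) (tsize n) ?a (usize h n) (arc r ({1..n}, f)))
       \<le> (real n + 1) ^ (tsize n + usize h n + tsize n * usize h n) * exp (- (n * (?a ^ tsize n * (1 - R n) ^ usize h n) / 4))"
      using prob_not_coding[of "{1..n}" "P n" "R n" r ?a "tsize n" "usize h n"] ty a by (simp add: add.commute)
    also have "\<dots> \<le> exp ((tbound n + (1 + tbound n) * (D * tbound n * real n powr \<beta> + 1)) * ln (real n + 1)) * exp (- (n * exp (- c * tbound n) / 4))"
    proof (rule mult_mono[OF power_le_exp])
      have "real (tsize n) * real (usize h n) \<le> tbound n * (D * tbound n * real n powr \<beta> + 1)"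
        using tsize_le[of n] usize_bounds(2)[of h n] by (intro mult_mono) (auto simp: D_def)
      then show "real (tsize n + usize h n + tsize n * usize h n) \<le> tbound n + (1 + tbound n) * (D * tbound n * real n powr \<beta> + 1)"
        using tsize_le[of n] usize_bounds(2)[of h n] unfolding D_def by (simp add: distrib_right)
      have "real n * exp (- c * tbound n) \<le> real n * (?a ^ tsize n * (1 - R n) ^ usize h n)"
        unfolding c_def by (intro mult_left_mono types_lower_bound elim) simp
      then show "exp (- (n * (?a ^ tsize n * (1 - R n) ^ usize h n) / 4)) \<le> exp (- (n * exp (- c * tbound n) / 4))"
        by simp
    qed auto
    also have "\<dots> = exp (?e n)" by (simp only: exp_add[symmetric] diff_conv_add_uminus)
    finally show ?case by simp
  qed
qed

text \<open>The number of families has logarithm of order \<open>n * ln n powr (1 / 4)\<close>. The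
  expected number of suitable rows is \<open>n\<close> to the power
  \<open>2 - \<beta> - o(1)\<close>, and this wins since \<open>2 - \<beta> > 1\<close>.\<close>

lemma transversal_whp:
  "(\<lambda>n. Prob n (\<lambda>f. \<not> transversal (r + 2) ({1..n}, f) ((tsize n)\<^sup>2) (exp (- rate h * tbound n) / 4) (P n))) \<longlonglongrightarrow> 0"
proof (rule Lim_null_comparison)
  define c where "c = rate h"
  have c: "c > 0" by (simp add: c_def rate_pos)
  let ?T2 = "\<lambda>n::nat. ln (real n) powr (1 / 4)"
  let ?g = "\<lambda>n. (?T2 n + 1) * exp (real n * ?T2 n * ln 2 - 1 / 2 * real n powr (2 - \<beta>) * exp (- (c * tbound n + 2) * ?T2 n))"
  show "?g \<longlonglongrightarrow> 0" using \<beta> c by real_asymp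
  have "\<beta> + real r > 0" using \<beta> by simp
  from isolated_prob_asymp[OF this]
  show "\<forall>\<^sub>F n in sequentially. norm (Prob n (\<lambda>f. \<not> transversal (r + 2) ({1..n}, f) ((tsize n)\<^sup>2) (exp (- rate h * tbound n) / 4) (P n))) \<le> ?g n"
    using eventually_typical
  proof eventually_elim
    case (elim n)
    note ty = elim(2)[unfolded typical_def]
    define K where "K = (tsize n)\<^sup>2"
    define a where "a = exp (- c * tbound n) / 4"
    have a: "0 \<le> a" "a \<le> 1"
    proof -
      have "exp (- c * tbound n) \<le> 1" using c by simp
      then show "a \<le> 1" unfolding a_def by linarith
      show "0 \<le> a" by (simp add: a_def)
    qed
    have "real K \<le> (tbound n)\<^sup>2" unfolding K_def of_nat_power using tsize_le[of n] by (intro power_mono) auto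
    also have "\<dots> = ?T2 n" by (simp add: power2_eq_square powr_add[symmetric])
    finally have K: "real K \<le> ?T2 n" .
    have "exp (- (c * tbound n + 2) * ?T2 n) \<le> exp (real K * (- (c * tbound n + 2)))"
      using mult_right_mono[OF K, of "c * tbound n + 2"] c by (simp add: algebra_simps)
    also have "\<dots> = exp (- (c * tbound n + 2)) ^ K" by (rule exp_of_nat_mult)
    also have "\<dots> \<le> a ^ K"
    proof (rule power_mono)
      \<comment> \<open>The factor 1/4 in \<open>a\<close> is absorbed into the exponent by
        \<open>4 \<le> exp 2\<close>.\<close>
      have "(4::real) \<le> exp 1 * exp 1" using exp_ge_add_one_self[of 1] mult_mono[of 2 "exp 1" 2 "exp (1::real)"] by simp
      then have "4 \<le> exp (2::real)" by (simp add: exp_add[symmetric])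
      then show "exp (- (c * tbound n + 2)) \<le> a"
        by (simp add: a_def exp_add exp_diff exp_minus field_simps)
    qed simp
    finally have aK: "exp (- (c * tbound n + 2) * ?T2 n) \<le> a ^ K" .
    have "real n ^ (r + 2) = real n powr real (r + 2)" using ty by (subst powr_realpow) auto
    then have e: "real n ^ (r + 2) * real n powr - (\<beta> + real r) = real n powr (2 - \<beta>)"
      by (simp add: powr_add[symmetric])
    have "1 / 2 * real n powr (2 - \<beta>) \<le> 7 / 8 * real n powr (2 - \<beta>)" by simp
    also have "\<dots> = real n ^ (r + 2) * (7 / 8 * real n powr - (\<beta> + real r))"
      unfolding e[symmetric] by (rule mult.left_commute)
    also have "\<dots> \<le> real n ^ (r + 2) * (1 - P n) ^ n"
      using elim(1) by (intro mult_left_mono) (auto simp: edge_prob_def)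
    finally have n2: "1 / 2 * real n powr (2 - \<beta>) \<le> real n ^ (r + 2) * (1 - P n) ^ n" .
    have lower: "1 / 2 * real n powr (2 - \<beta>) * exp (- (c * tbound n + 2) * ?T2 n) \<le> real n ^ (r + 2) * (a ^ K * (1 - P n) ^ n)"
      using mult_mono[OF n2 aK] ty by (simp add: mult_ac)
    have "Prob n (\<lambda>f. \<not> transversal (r + 2) ({1..n}, f) K a (P n))
      \<le> (real K + 1) * 2 ^ (n * K) * exp (- (real n ^ (r + 2) * (a ^ K * (1 - P n) ^ n)))"
      using prob_not_transversal[of "{1..n}" "P n" "R n" r a K] ty a by simp
    also have "(2::real) ^ (n * K) = exp (real (n * K) * ln 2)" by (subst exp_of_nat_mult) simp
    also have "(real K + 1) * exp (real (n * K) * ln 2) * exp (- (real n ^ (r + 2) * (a ^ K * (1 - P n) ^ n)))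
       = (real K + 1) * exp (real (n * K) * ln 2 - real n ^ (r + 2) * (a ^ K * (1 - P n) ^ n))"
      by (simp add: exp_diff exp_minus field_simps)
    also have "\<dots> \<le> ?g n"
    proof (rule mult_mono)
      have "real (n * K) * ln 2 \<le> real n * ?T2 n * ln 2"
        using K by (intro mult_right_mono) (auto simp: mult_left_mono)
      then show "exp (real (n * K) * ln 2 - real n ^ (r + 2) * (a ^ K * (1 - P n) ^ n))
        \<le> exp (real n * ?T2 n * ln 2 - 1 / 2 * real n powr (2 - \<beta>) * exp (- (c * tbound n + 2) * ?T2 n))"
        using lower by simp
    qed (use K in auto)
    finally show ?case by (simp add: K_def a_def c_def)
  qed
qed

lemma rich_whp:
  assumes ops: "admissible \<beta> ops" "size_expo \<beta> ops = \<beta>"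
  shows "(\<lambda>n. Prob n (\<lambda>f. \<not> rich (tsize n) {1..n} (tuples (length ops) {1..n}) (tuples (r + 2) {1..n})
     (nbr ({1..n}, f)) (code r ops ({1..n}, f)))) \<longlonglongrightarrow> 0"
proof (rule Lim_null_comparison)
  define h where "h = length ops"
  let ?a = "1 / (2 * 16 ^ h) :: real"
  let ?a' = "\<lambda>n. exp (- rate h * tbound n) / 4"
  let ?L = "\<lambda>n. 128 ^ h * tsize n"
  let ?E1 = "\<lambda>n f. \<not> few_in {1..n} (R n) (arc r ({1..n}, f))"
  let ?E2 = "\<lambda>n f. \<not> expanding {1..n} (R n) (?L n) (arc r ({1..n}, f))"
  let ?E3 = "\<lambda>n f. \<not> selecting_all {1..n} (R n) (tsize n) ops (arc r ({1..n}, f))"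
  let ?E4 = "\<lambda>n f. \<not> coding {1..n} (R n) (tsize n) ?a (usize h n) (arc r ({1..n}, f))"
  let ?E5 = "\<lambda>n f. \<not> transversal (r + 2) ({1..n}, f) ((tsize n)\<^sup>2) (?a' n) (P n)"
  have pw: "(0::nat) < 128 ^ h" by simp
  show "(\<lambda>n. Prob n (?E1 n) + (Prob n (?E2 n) + (Prob n (?E3 n) + (Prob n (?E4 n) + Prob n (?E5 n))))) \<longlonglongrightarrow> 0"
    using tendsto_add[OF few_in_whp tendsto_add[OF expanding_whp[OF pw] tendsto_add[OF selecting_all_whp[OF ops(1)]
      tendsto_add[OF coding_whp[of h] transversal_whp[of h]]]]] by (simp only: add_0)
  have gr: "\<beta> + real r > 0" using \<beta> by simp
  have "\<forall>\<^sub>F n in sequentially. 1 \<le> (real n / (2 * tbound n) - 1) * ((\<beta> + real r) * ln (real n) / real n)"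
    using gr by real_asymp
  moreover have "\<forall>\<^sub>F n in sequentially. 1 \<le> (\<beta> + real r) * ln (real n)" using gr by real_asymp
  moreover have "\<forall>\<^sub>F n in sequentially. tbound n \<le> real n / 2" by real_asymp
  ultimately show "\<forall>\<^sub>F n in sequentially. norm (Prob n (\<lambda>f. \<not> rich (tsize n) {1..n} (tuples (length ops) {1..n}) (tuples (r + 2) {1..n})
     (nbr ({1..n}, f)) (code r ops ({1..n}, f)))) \<le> Prob n (?E1 n) + (Prob n (?E2 n) + (Prob n (?E3 n) + (Prob n (?E4 n) + Prob n (?E5 n))))"
    using eventually_typical eventually_R_half sizes_ok_eventually[OF ops(1) order_refl]
  proof eventually_elim
    case (elim n)
    note ty = elim(4)[unfolded typical_def]
    \<comment> \<open>Then \<open>t\<close> disjoint sets of size \<open>s\<close> fill at most half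
      of the vertices and leave space for \<open>B\<close>, while \<open>s * P n\<close> is still of
      order \<open>ln n / tbound n\<close>.\<close>
    define s where "s = nat \<lfloor>real n / (2 * tbound n)\<rfloor>"
    have rich: "rich (tsize n) {1..n} (tuples (length ops) {1..n}) (tuples (r + 2) {1..n}) (nbr ({1..n}, f)) (code r ops ({1..n}, f))"
      if good: "\<not> ?E1 n f" "\<not> ?E2 n f" "\<not> ?E3 n f" "\<not> ?E4 n f" "\<not> ?E5 n f" for f
    proof (rule rich_if_pseudorandom[where \<rho> = "R n" and p = "P n" and L = "?L n" and a = ?a and u = "usize h n" and a' = "?a' n" and s = s])
      \<comment> \<open>Origin of the constant \<open>?a\<close>: the final size is at least
        \<open>n powr \<beta> / 16 ^ h\<close> and the density at least half of
        \<open>n powr - \<beta>\<close>, so the product is at least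
        \<open>1 / (2 * 16 ^ h)\<close>.\<close>
      have "real n powr \<beta> \<le> 16 ^ h * size_lo n (R n) ops"
        using size_bounds(2)[of "real n" \<beta> "R n" ops] ty ops(2) by (simp add: h_def)
      moreover have "1 / 2 * real n powr - \<beta> * real n powr \<beta> = 1 / 2" using ty by (simp add: powr_add[symmetric])
      moreover have "1 / 2 * real n powr - \<beta> * real n powr \<beta> \<le> R n * (16 ^ h * size_lo n (R n) ops)"
        using ty calculation(1) by (intro mult_mono) auto
      ultimately show "?a \<le> size_lo (real (card {1..n})) (R n) ops * R n"
        by (simp add: field_simps)
      have "real (tsize n) * size_hi n (R n) ops \<le> tbound n * (8 ^ h * real n powr \<beta>)"
        using size_bounds(1)[of "real n" \<beta> "R n" ops] ty ops(2) tsize_le[of n] size_pos[of "real n" "R n" ops]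
        by (intro mult_mono) (auto simp: h_def)
      then show "real (tsize n) * size_hi (real (card {1..n})) (R n) ops \<le> real (usize h n)"
        using usize_bounds(1)[of h n] by (simp add: mult_ac)
      have np: "1 \<le> real n * P n" using elim(2) ty by (simp add: edge_prob_def)
      have "?a' n * 1 \<le> ((?a ^ tsize n * (1 - R n) ^ usize h n) / 4) * (real n * P n)"
      proof (intro mult_mono divide_right_mono)
        show tl: "exp (- rate h * tbound n) \<le> ?a ^ tsize n * (1 - R n) ^ usize h n"
          by (rule types_lower_bound[OF elim(4,5)])
        show "0 \<le> (?a ^ tsize n * (1 - R n) ^ usize h n) / 4"
          using order_trans[OF exp_ge_zero tl] by (rule divide_nonneg_nonneg) simp
      qed (use np in auto)
      then show "?a' n \<le> real (card {1..n}) * (?a ^ tsize n * (1 - R n) ^ usize h n) / 4 * P n"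
        by (simp add: mult_ac)
      have "?a' n \<le> 1"
      proof -
        have "exp (- rate h * tbound n) \<le> 1" using rate_pos[of h] by simp
        then show ?thesis by linarith
      qed
      also have "1 \<le> (real n / (2 * tbound n) - 1) * P n" using elim(1) by (simp add: edge_prob_def)
      also have "\<dots> \<le> real s * P n"
      proof (rule mult_right_mono)
        show "real n / (2 * tbound n) - 1 \<le> real s" unfolding s_def by linarith
      qed (use ty in simp)
      finally show "?a' n \<le> real s * P n" .
      have "real s \<le> real n / (2 * tbound n)" unfolding s_def by simp
      then have "real (tsize n) * real s \<le> tbound n * (real n / (2 * tbound n))"
        using tsize_le[of n] by (intro mult_mono) auto
      also have "\<dots> = real n / 2"
      proof -
        have "x * (real n / (2 * x)) = real n / 2" if "1 \<le> x" for x :: real using that by simp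
        then show ?thesis using ty by blast
      qed
      finally have "real (tsize n * s + tsize n) \<le> real n" using elim(3) tsize_le[of n] by simp
      then show "tsize n * s + tsize n \<le> card {1..n}" by (simp only: of_nat_le_iff card_atLeastAtMost diff_Suc_1 diff_Suc_Suc minus_nat.diff_0)
    qed (use good ty elim(6) in \<open>simp_all add: h_def\<close>)
    have "Prob n (\<lambda>f. \<not> rich (tsize n) {1..n} (tuples (length ops) {1..n}) (tuples (r + 2) {1..n})
     (nbr ({1..n}, f)) (code r ops ({1..n}, f))) \<le> measure_pmf.prob (rand_rel (r + 3) {1..n} (P n))
       ({f. ?E1 n f} \<union> ({f. ?E2 n f} \<union> ({f. ?E3 n f} \<union> ({f. ?E4 n f} \<union> {f. ?E5 n f}))))"
    proof (rule measure_pmf.finite_measure_mono)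
      show "{f. \<not> rich (tsize n) {1..n} (tuples (length ops) {1..n}) (tuples (r + 2) {1..n})
        (nbr ({1..n}, f)) (code r ops ({1..n}, f))}
        \<subseteq> {f. ?E1 n f} \<union> ({f. ?E2 n f} \<union> ({f. ?E3 n f} \<union> ({f. ?E4 n f} \<union> {f. ?E5 n f})))"
        using rich by blast
    qed simp
    also have "\<dots> \<le> Prob n (?E1 n) + (Prob n (?E2 n) + (Prob n (?E3 n) + (Prob n (?E4 n) + Prob n (?E5 n))))"
      by (intro order_trans[OF measure_Un_le] add_mono order_refl) auto
    finally show ?case by simp
  qed
qed

end

section \<open>The three parts of the theorem\<close>

text \<open>As long as the exponent differs from \<open>\<beta>\<close>, growing below
  \<open>\<beta>\<close> and selecting above it keeps it in the interval from 0 to 1 (1 excluded),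
  so a path that never met \<open>\<beta>\<close> could be continued for any number of steps.
  Rationality makes the rotation periodic, which contradicts this.\<close>

lemma admissible_path_exists:
  fixes \<beta> :: real
  assumes "\<beta> \<in> \<rat>" "0 < \<beta>" "\<beta> < 1"
  shows "\<exists>ops. admissible \<beta> ops \<and> size_expo \<beta> ops = \<beta>"
proof (rule ccontr)
  assume no: "\<nexists>ops. admissible \<beta> ops \<and> size_expo \<beta> ops = \<beta>"
  have path: "\<exists>ops. admissible \<beta> ops \<and> 0 \<le> size_expo \<beta> ops \<and> size_expo \<beta> ops < 1 \<and> size_expo \<beta> ops - real i * (1 - \<beta>) \<in> \<int>" for i
  proof (induction i)
    case 0
    show ?case by (rule exI[of _ "[]"]) simp
  next
    case (Suc i)
    then obtain ops where ops: "admissible \<beta> ops" "0 \<le> size_expo \<beta> ops" "size_expo \<beta> ops < 1"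
      "size_expo \<beta> ops - real i * (1 - \<beta>) \<in> \<int>" by blast
    have "size_expo \<beta> ops \<noteq> \<beta>" using no ops(1) by blast
    then consider "size_expo \<beta> ops < \<beta>" | "\<beta> < size_expo \<beta> ops" by linarith
    then show ?case
    proof cases
      case 1
      have "size_expo \<beta> (True # ops) - real (Suc i) * (1 - \<beta>) = size_expo \<beta> ops - real i * (1 - \<beta>)"
        by (simp add: algebra_simps)
      then have "size_expo \<beta> (True # ops) - real (Suc i) * (1 - \<beta>) \<in> \<int>" using ops(4) by (simp only:)
      moreover have "admissible \<beta> (True # ops)" "0 \<le> size_expo \<beta> (True # ops)" "size_expo \<beta> (True # ops) < 1"
        using 1 ops assms by auto
      ultimately show ?thesis by blast
    next
      case 2
      have "size_expo \<beta> (False # ops) - real (Suc i) * (1 - \<beta>) = size_expo \<beta> ops - real i * (1 - \<beta>) - 1"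
        by (simp add: algebra_simps)
      then have "size_expo \<beta> (False # ops) - real (Suc i) * (1 - \<beta>) \<in> \<int>"
        using Ints_diff[OF ops(4) Ints_1] by (simp only:)
      moreover have "admissible \<beta> (False # ops)" "0 \<le> size_expo \<beta> (False # ops)" "size_expo \<beta> (False # ops) < 1"
        using 2 ops assms by auto
      ultimately show ?thesis by blast
    qed
  qed
  obtain a b :: int where ab: "b > 0" "\<beta> = of_int a / of_int b"
    using assms(1) by (elim Rats_cases') auto
  \<comment> \<open>For \<open>\<beta> = a / b\<close>, \<open>b - 1\<close> steps lead to
    \<open>(b - 1) * (1 - \<beta>) = b - a - 1 + \<beta>\<close> modulo 1, that is, to
    \<open>\<beta>\<close>.\<close>
  obtain ops where ops: "admissible \<beta> ops" "0 \<le> size_expo \<beta> ops" "size_expo \<beta> ops < 1"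
      "size_expo \<beta> ops - real (nat (b - 1)) * (1 - \<beta>) \<in> \<int>" using path by blast
  have "real (nat (b - 1)) = of_int b - 1" using ab by simp
  then have "size_expo \<beta> ops - \<beta> = (size_expo \<beta> ops - real (nat (b - 1)) * (1 - \<beta>)) + of_int (b - a - 1)"
    using ab by (simp add: field_simps)
  then have "size_expo \<beta> ops - \<beta> \<in> \<int>" using ops(4) by (metis Ints_add Ints_of_int)
  then obtain z where z: "size_expo \<beta> ops - \<beta> = of_int z" by (elim Ints_cases)
  then have "z = 0" using ops assms by linarith
  then show False using z no ops(1) by auto
qed

section \<open>Part (iii): a separated sequence of sentences\<close>

lemma not_totally_bounded_separated:
  fixes x :: "nat \<Rightarrow> 'a :: metric_space"
  assumes S: "\<And>k. x k \<in> S" and sep: "\<And>j k. j \<noteq> k \<Longrightarrow> e \<le> dist (x j) (x k)" and e: "0 < e"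
  shows "\<not> totally_bounded S"
proof
  assume "totally_bounded S"
  then obtain X where X: "finite X" "S \<subseteq> (\<Union>c\<in>X. {y. dist c y < e / 2})"
    using e unfolding totally_bounded_metric by (meson half_gt_zero)
  have "\<forall>k. \<exists>c. c \<in> X \<and> dist c (x k) < e / 2" using S X(2) by blast
  then obtain c where c: "\<And>k. c k \<in> X" "\<And>k. dist (c k) (x k) < e / 2" by metis
  have "finite (range c)" using c(1) X(1) by (meson finite_subset image_subsetI)
  then have "\<not> inj c" using finite_imageD[of c UNIV] by auto
  then obtain j k where jk: "j \<noteq> k" "c j = c k" unfolding inj_def by blast
  have "dist (x j) (x k) \<le> dist (c j) (x j) + dist (c j) (x k)" by (rule dist_triangle3)
  also have "\<dots> < e" using c(2)[of j] c(2)[of k] jk(2) by simp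
  finally show False using sep[OF jk(1)] by simp
qed

text \<open>The limsup norm sees any gap that recurs infinitely often, so it is enough to separate
  two sentences along a sparse sequence of \<open>n\<close>.\<close>

lemma dist_proj_c0_ge:
  assumes "\<exists>\<^sub>F n in sequentially. e \<le> \<bar>apply_bcontfun f n - apply_bcontfun g n\<bar>"
  shows "e \<le> dist (proj_c0 f) (proj_c0 g)"
proof (rule ccontr)
  have d: "dist (proj_c0 f) (proj_c0 g) = limsup_norm (f - g)"
    by (simp add: dist_linf_mod_c0_def minus_linf_mod_c0.abs_eq norm_linf_mod_c0.abs_eq)
  assume "\<not> e \<le> dist (proj_c0 f) (proj_c0 g)"
  then have "limsup (\<lambda>n. ereal \<bar>apply_bcontfun (f - g) n\<bar>) < ereal e"
    unfolding d ereal_limsup_norm[symmetric] by simp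
  then have "\<forall>\<^sub>F n in sequentially. ereal \<bar>apply_bcontfun (f - g) n\<bar> < ereal e"
    by (rule Limsup_lessD)
  then have "\<forall>\<^sub>F n in sequentially. \<not> e \<le> \<bar>apply_bcontfun f n - apply_bcontfun g n\<bar>"
    by eventually_elim (simp add: minus_bcontfun.rep_eq)
  then show False using assms by (simp add: frequently_def)
qed

lemma pr_models_rand_struct:
  assumes "\<And>S :: nat struct. S \<Turnstile> \<phi> \<longleftrightarrow> Q S"
  shows "pr_models (rand_struct d n p) \<phi> = measure_pmf.prob (rand_rel d {1..n} p) {f. Q ({1..n}, f)}"
  unfolding pr_models_def rand_struct_def tuples_def measure_map_pmf vimage_def using assms by simp

text \<open>Fully coded sets have at most \<open>log n\<close> elements, so this is the largest power of 2
  for which none of them has \<open>2 ^ tow l\<close> elements.\<close>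

definition critical_size :: "nat \<Rightarrow> nat" where
  "critical_size l = 2 ^ (2 ^ tow l - 1)"

lemma critical_size_less: "critical_size l < 2 ^ (2 ^ tow l)"
  unfolding critical_size_def by (intro power_strict_increasing) auto

lemma tow_at_top: "filterlim tow at_top sequentially"
  by (rule filterlim_subseq[OF strict_mono_tow])

lemma critical_size_at_top: "filterlim critical_size at_top sequentially"
proof -
  have "filterlim (\<lambda>m::nat. 2 ^ (2 ^ m - 1) :: nat) at_top sequentially"
  proof (rule filterlim_at_top_mono[OF filterlim_ident])
    have "m \<le> 2 ^ (2 ^ m - 1)" for m :: nat
    proof -
      have "m \<le> 2 ^ m - 1" using less_exp[of m] by linarith
      also have "\<dots> < 2 ^ (2 ^ m - 1)" by (rule less_exp)
      finally show ?thesis by simp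
    qed
    then show "\<forall>\<^sub>F m in sequentially. m \<le> 2 ^ (2 ^ m - 1)" by simp
  qed
  from filterlim_compose[OF this tow_at_top] show ?thesis unfolding critical_size_def .
qed

text \<open>With \<open>m = tow l\<close>, \<open>ln n\<close> equals
  \<open>(2 ^ m - 1) * ln 2\<close>, so any positive power of \<open>ln n\<close> is exponential in
  \<open>m\<close> and eventually exceeds \<open>2 * m\<close>.\<close>

lemma tow_le_tsize: "\<forall>\<^sub>F l in sequentially. 2 * tow l \<le> tsize (critical_size l)"
proof -
  have "\<forall>\<^sub>F m in sequentially. 2 * real m \<le> ((2 ^ m - 1) * ln 2) powr (1 / 8)" by real_asymp
  then have "\<forall>\<^sub>F m in sequentially. 2 * m \<le> tsize (2 ^ (2 ^ m - 1))"
  proof eventually_elim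
    case (elim m)
    have "ln (real (2 ^ (2 ^ m - 1))) = real (2 ^ m - 1) * ln 2" by (simp add: ln_realpow)
    also have "\<dots> = (2 ^ m - 1) * ln 2" by (simp add: of_nat_diff)
    finally have "2 * real m \<le> tbound (2 ^ (2 ^ m - 1))" using elim by simp
    then show ?case unfolding tsize_def by (simp add: le_nat_floor)
  qed
  from eventually_compose_filterlim[OF this tow_at_top] show ?thesis unfolding critical_size_def .
qed

lemma not_totally_bounded_FOC:
  fixes \<beta> :: real and r :: nat
  assumes \<beta>: "\<beta> \<in> \<rat>" "0 < \<beta>" "\<beta> < 1"
  shows "\<not> totally_bounded (FOC (r + 3) (\<lambda>n. rand_struct (r + 3) n (edge_prob r \<beta> n)))"
proof -
  obtain ops where ops: "admissible \<beta> ops" "size_expo \<beta> ops = \<beta>"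
    using admissible_path_exists[OF \<beta>] by blast
  let ?Q = "\<lambda>k (S :: nat struct). max_tower k (fst S) (tuples (length ops) (fst S)) (tuples (r + 2) (fst S)) (nbr S) (code r ops S)"
  have "\<exists>\<phi>. fo_sentence (r + 3) \<phi> \<and> (\<forall>S :: nat struct. S \<Turnstile> \<phi> \<longleftrightarrow> ?Q k S)" for k
    using definable_sentence[OF definable_max_tower[of r 0 k ops]] by metis
  then obtain \<phi> where \<phi>: "\<And>k. fo_sentence (r + 3) (\<phi> k)" "\<And>k S. S \<Turnstile> \<phi> k \<longleftrightarrow> ?Q k S" by metis
  let ?D = "\<lambda>n. rand_struct (r + 3) n (edge_prob r \<beta> n)"
  let ?M = "\<lambda>n. rand_rel (r + 3) {1..n} (edge_prob r \<beta> n)"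
  let ?rich = "\<lambda>n f. rich (tsize n) {1..n} (tuples (length ops) {1..n}) (tuples (r + 2) {1..n}) (nbr ({1..n}, f)) (code r ops ({1..n}, f))"
  have pr: "pr_models (?D n) (\<phi> k) = measure_pmf.prob (?M n) {f. ?Q k ({1..n}, f)}" for n k
    by (rule pr_models_rand_struct) (rule \<phi>(2))
  have "\<forall>\<^sub>F n in sequentially. measure_pmf.prob (?M n) {f. \<not> ?rich n f} < 1 / 4"
    by (rule order_tendstoD(2)[OF rich_whp[OF \<beta>(2,3) ops]]) simp
  then have rich: "\<forall>\<^sub>F l in sequentially. measure_pmf.prob (?M (critical_size l)) {f. \<not> ?rich (critical_size l) f} < 1 / 4"
    by (rule eventually_compose_filterlim[OF _ critical_size_at_top])
  \<comment> \<open>In a rich structure the \<open>k\<close>-th sentence just tells whether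
    \<open>k\<close> divides \<open>l\<close>. A failure probability below 1/4 leaves a gap of 1/2
    between the two cases.\<close>
  have dvd: "\<forall>\<^sub>F l in sequentially. \<forall>k\<ge>1. (k dvd l \<longrightarrow> 3 / 4 \<le> pr_models (?D (critical_size l)) (\<phi> k)) \<and>
      (\<not> k dvd l \<longrightarrow> pr_models (?D (critical_size l)) (\<phi> k) \<le> 1 / 4)"
    using rich tow_le_tsize eventually_ge_at_top[of 1]
  proof eventually_elim
    case (elim l)
    define n where "n = critical_size l"
    have n: "card {1..n} < 2 ^ (2 ^ tow l)" using critical_size_less[of l] by (simp add: n_def)
    have nb: "nbr ({1..n}, f) es \<subseteq> {1..n}" for f es by (auto simp: nbr_def)
    have bad: "measure_pmf.prob (?M n) {f. \<not> ?rich n f} \<le> 1 / 4" using elim(1) by (simp add: n_def)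
    show ?case
    proof (intro allI impI conjI)
      fix k :: nat assume k: "1 \<le> k" "k dvd l"
      have "?Q k ({1..n}, f)" if "?rich n f" for f
        using rich_max_tower[OF _ nb that _ elim(3) n k(2)] elim(2) by (simp add: n_def)
      then have "measure_pmf.prob (?M n) {f. \<not> ?Q k ({1..n}, f)} \<le> measure_pmf.prob (?M n) {f. \<not> ?rich n f}"
        by (intro measure_pmf.finite_measure_mono) auto
      moreover have "{f. \<not> ?Q k ({1..n}, f)} = UNIV - {f. ?Q k ({1..n}, f)}" by auto
      ultimately show "3 / 4 \<le> pr_models (?D (critical_size l)) (\<phi> k)"
        using bad measure_pmf.prob_compl[of "{f. ?Q k ({1..n}, f)}" "?M n"] by (simp add: pr n_def)
    next
      fix k :: nat assume k: "1 \<le> k" "\<not> k dvd l"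
      have "\<not> ?Q k ({1..n}, f)" if "?rich n f" for f
        using rich_not_max_tower[OF _ nb that _ elim(3) n k] elim(2) by (simp add: n_def)
      then have "measure_pmf.prob (?M n) {f. ?Q k ({1..n}, f)} \<le> measure_pmf.prob (?M n) {f. \<not> ?rich n f}"
        by (intro measure_pmf.finite_measure_mono) auto
      then show "pr_models (?D (critical_size l)) (\<phi> k) \<le> 1 / 4" using bad by (simp add: pr n_def)
    qed
  qed
  have sep: "\<exists>\<^sub>F n in sequentially. 1 / 2 \<le> \<bar>pr_models (?D n) (\<phi> j) - pr_models (?D n) (\<phi> k)\<bar>"
    if jk: "1 \<le> j" "1 \<le> k" "\<not> j dvd k" for j k
    unfolding frequently_def
  proof
    assume "\<forall>\<^sub>F n in sequentially. \<not> 1 / 2 \<le> \<bar>pr_models (?D n) (\<phi> j) - pr_models (?D n) (\<phi> k)\<bar>"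
    then have "\<forall>\<^sub>F l in sequentially. \<not> 1 / 2 \<le> \<bar>pr_models (?D (critical_size l)) (\<phi> j) - pr_models (?D (critical_size l)) (\<phi> k)\<bar>"
      by (rule eventually_compose_filterlim[OF _ critical_size_at_top])
    from eventually_conj[OF this dvd] obtain N where
      *: "\<forall>l\<ge>N. \<not> 1 / 2 \<le> \<bar>pr_models (?D (critical_size l)) (\<phi> j) - pr_models (?D (critical_size l)) (\<phi> k)\<bar> \<and>
        (\<forall>k\<ge>1. (k dvd l \<longrightarrow> 3 / 4 \<le> pr_models (?D (critical_size l)) (\<phi> k)) \<and>
        (\<not> k dvd l \<longrightarrow> pr_models (?D (critical_size l)) (\<phi> k) \<le> 1 / 4))"
      unfolding eventually_sequentially by (elim exE)
    note N = *[THEN spec, THEN mp, THEN conjunct1] *[THEN spec, THEN mp, THEN conjunct2, THEN spec, THEN mp]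
    \<comment> \<open>A multiple of \<open>k\<close> that is at least \<open>N\<close> and congruent
      to \<open>k\<close> modulo \<open>j\<close>, hence not divisible by \<open>j\<close>.\<close>
    define l where "l = k * (j * N + 1)"
    have "N \<le> l"
    proof -
      have "N \<le> j * N" using jk(1) by (cases j) auto
      also have "\<dots> \<le> k * (j * N + 1)" using jk(2) by (cases k) auto
      finally show ?thesis by (simp add: l_def)
    qed
    moreover have "k dvd l" by (simp add: l_def)
    moreover have "\<not> j dvd l"
    proof
      assume "j dvd l"
      then have "j dvd j * (k * N) + k" by (simp add: l_def algebra_simps)
      then show False using jk(3) by (simp add: dvd_add_right_iff)
    qed
    ultimately have "3 / 4 \<le> pr_models (?D (critical_size l)) (\<phi> k)" "pr_models (?D (critical_size l)) (\<phi> j) \<le> 1 / 4"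
      using N(2)[of l k] N(2)[of l j] jk by simp_all
    then have "1 / 2 \<le> \<bar>pr_models (?D (critical_size l)) (\<phi> j) - pr_models (?D (critical_size l)) (\<phi> k)\<bar>"
      by linarith
    then show False using N(1)[OF \<open>N \<le> l\<close>] by (rule notE[rotated])
  qed
  \<comment> \<open>The index is shifted because divisibility is decided for
    \<open>k \<ge> 1\<close> only.\<close>
  define x where "x k = proj_c0 (Bcontfun (\<lambda>n. pr_models (?D n) (\<phi> (Suc k))))" for k
  show ?thesis
  proof (rule not_totally_bounded_separated[where x = x and e = "1 / 2"])
    show "x k \<in> FOC (r + 3) ?D" for k
      unfolding FOC_def x_def using \<phi>(1) by blast
    show "1 / 2 \<le> dist (x j) (x k)" if "j \<noteq> k" for j k
    proof -
      have less: "1 / 2 \<le> dist (x j) (x k)" if "\<not> Suc j dvd Suc k" for j k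
        unfolding x_def by (rule dist_proj_c0_ge) (use sep[of "Suc j" "Suc k"] that in \<open>simp add: apply_Bcontfun_pr_models\<close>)
      \<comment> \<open>Two distinct numbers cannot divide each other, and \<open>sep\<close> needs
        only one failing direction.\<close>
      have "\<not> Suc j dvd Suc k \<or> \<not> Suc k dvd Suc j" using that by (metis dvd_antisym nat.inject)
      then show ?thesis using less[of j k] less[of k j] by (auto simp: dist_commute)
    qed
  qed simp
qed

section \<open>Parts (i) and (ii): probabilities bounded away from 0 and 1\<close>

lemma not_zero_one_lawI:
  assumes "fo_sentence d \<phi>" "0 < a" "b < 1"
    "\<forall>\<^sub>F n in sequentially. a \<le> pr_models (D n) \<phi> \<and> pr_models (D n) \<phi> \<le> b"
  shows "\<not> fo_zero_one_law d D"
proof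
  assume "fo_zero_one_law d D"
  then consider "(\<lambda>n. pr_models (D n) \<phi>) \<longlonglongrightarrow> 0" | "(\<lambda>n. pr_models (D n) \<phi>) \<longlonglongrightarrow> 1"
    using assms(1) unfolding fo_zero_one_law_def by blast
  then show False
  proof cases
    case 1
    have "a \<le> 0" by (rule tendsto_lowerbound[OF 1]) (use assms(4) in \<open>auto elim: eventually_mono\<close>)
    then show False using assms(2) by simp
  next
    case 2
    have "1 \<le> b" by (rule tendsto_upperbound[OF 2]) (use assms(4) in \<open>auto elim: eventually_mono\<close>)
    then show False using assms(3) by simp
  qed
qed

lemma power_one_minus_ge:
  fixes q :: real
  assumes "0 \<le> q" "q \<le> 1 / 2"
  shows "exp (- (2 * (real N * q))) \<le> (1 - q) ^ N"
proof -
  have "exp (- (2 * (real N * q))) = exp (- (2 * q)) ^ N"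
    by (subst exp_of_nat_mult[symmetric]) (simp add: mult_ac)
  also have "\<dots> \<le> (1 - q) ^ N" by (intro power_mono exp_le_one_minus assms) simp
  finally show ?thesis .
qed

text \<open>With \<open>N = n ^ (r + 1)\<close>, no tuple is isolated with probability exactly
  \<open>(1 - q) ^ N\<close>; as \<open>N * q\<close> lies between 7/8 and 9/8, this stays away from
  0 and 1.\<close>

lemma not_zero_one_law_isolated_tuple: "\<not> fo_zero_one_law (r + 2) (\<lambda>n. rand_struct (r + 2) n (edge_prob r 1 n))"
proof -
  let ?Q = "\<lambda>S :: nat struct. \<exists>es\<in>tuples (r + 1) (fst S). \<forall>z\<in>fst S. \<not> snd S (es @ [z])"
  have D: "definable (r + 2) 0 (\<lambda>S xs. ?Q S)"
    by (intro definable_ex_tuples definable_all definable_not definable_rel_append[where m = "r + 1"]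
      vars_proj_tl vars_proj_take var_proj_hd) simp
  obtain \<phi> where \<phi>: "fo_sentence (r + 2) \<phi>" "\<And>S. S \<Turnstile> \<phi> \<longleftrightarrow> ?Q S"
    using definable_sentence[OF D] by metis
  show ?thesis
  proof (rule not_zero_one_lawI[OF \<phi>(1)])
    have "(1 :: real) + real r > 0" by simp
    from isolated_prob_asymp[OF this]
    show "\<forall>\<^sub>F n in sequentially. 1 / 4 \<le> pr_models (rand_struct (r + 2) n (edge_prob r 1 n)) \<phi> \<and>
       pr_models (rand_struct (r + 2) n (edge_prob r 1 n)) \<phi> \<le> 1 - exp (- 3)"
      using edge_prob_asymp[of 1 r, simplified] eventually_ge_at_top[of 3]
    proof eventually_elim
      case (elim n)
      define p where "p = edge_prob r 1 n"
      define q where "q = (1 - p) ^ n"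
      define N where "N = n ^ (r + 1)"
      have p: "0 \<le> p" "p \<le> 1" using elim(2) by (simp_all add: p_def)
      have q: "0 \<le> q" "q \<le> 1" using p by (auto simp: q_def power_le_one)
      let ?M = "rand_rel (r + 2) {1..n} p"
      have none: "measure_pmf.prob ?M {f. \<forall>es\<in>tuples (r + 1) {1..n}. \<not> (\<forall>z\<in>{1..n}. \<not> f (es @ [z]))} = (1 - q) ^ N"
      proof -
        have mem: "es @ [z] \<in> tuples (r + 2) {1..n}" if "es \<in> tuples (r + 1) {1..n}" "z \<in> {1..n}" for es z
          using tuples_snoc[OF that] by simp
        have "measure_pmf.prob ?M {f. \<forall>es\<in>tuples (r + 1) {1..n}. \<not> (\<forall>z\<in>{1..n}. \<not> f (es @ [z]))}
          = (\<Prod>es\<in>tuples (r + 1) {1..n}. 1 - measure_pmf.prob ?M {f. \<forall>z\<in>{1..n}. \<not> f (es @ [z])})"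
        proof (rule prob_blocks_none[where blk = "\<lambda>es. (\<lambda>z. es @ [z]) ` {1..n}" and Q = "\<lambda>es f. \<forall>z\<in>{1..n}. \<not> f (es @ [z])"])
          show "(\<lambda>z. es @ [z]) ` {1..n} \<subseteq> tuples (r + 2) {1..n}" if "es \<in> tuples (r + 1) {1..n}" for es
            using mem[OF that] by blast
        qed (auto simp: finite_tuples disjoint_family_on_def)
        also have "\<dots> = (\<Prod>es\<in>tuples (r + 1) {1..n}. 1 - q)"
        proof (rule prod.cong[OF refl])
          fix es assume es: "es \<in> tuples (r + 1) {1..n}"
          have "measure_pmf.prob ?M {f. \<forall>z\<in>{1..n}. \<not> f (es @ [z])} = (1 - p) ^ card {1..n}"
            by (rule prob_Pi_bernoulli_none) (use p mem[OF es] in \<open>auto simp: finite_tuples inj_on_def\<close>)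
          then show "1 - measure_pmf.prob ?M {f. \<forall>z\<in>{1..n}. \<not> f (es @ [z])} = 1 - q" by (simp add: q_def)
        qed
        finally show ?thesis by (simp add: card_tuples N_def)
      qed
      have "pr_models (rand_struct (r + 2) n p) \<phi> = measure_pmf.prob ?M {f. ?Q ({1..n}, f)}"
        by (rule pr_models_rand_struct) (rule \<phi>(2))
      also have "{f. ?Q ({1..n}, f)} = UNIV - {f. \<forall>es\<in>tuples (r + 1) {1..n}. \<not> (\<forall>z\<in>{1..n}. \<not> f (es @ [z]))}"
        by auto
      also have "measure_pmf.prob ?M \<dots> = 1 - (1 - q) ^ N"
        using measure_pmf.prob_compl[of "{f. \<forall>es\<in>tuples (r + 1) {1..n}. \<not> (\<forall>z\<in>{1..n}. \<not> f (es @ [z]))}" ?M] none by simp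
      finally have eq: "pr_models (rand_struct (r + 2) n p) \<phi> = 1 - (1 - q) ^ N" .
      have "real N * real n powr - (1 + real r) = 1"
      proof -
        have "real N = real n powr real (r + 1)" using elim(3) unfolding N_def by (subst powr_realpow) auto
        then show ?thesis using elim(3) by (simp add: powr_add[symmetric])
      qed
      moreover have "7 / 8 * real n powr - (1 + real r) \<le> q" and q2: "q \<le> 9 / 8 * real n powr - (1 + real r)"
        using elim(1) by (auto simp: q_def p_def edge_prob_def)
      ultimately have Nq: "7 / 8 \<le> real N * q" "real N * q \<le> 9 / 8"
        using mult_left_mono[of "7 / 8 * real n powr - (1 + real r)" q "real N"]
          mult_left_mono[of q "9 / 8 * real n powr - (1 + real r)" "real N"] by (simp_all add: mult_ac)
      have "(3::nat) \<le> N" using elim(3) self_le_power[of n "r + 1"] unfolding N_def by linarith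
      then have "3 * q \<le> real N * q" using q by (intro mult_right_mono) auto
      then have half: "q \<le> 1 / 2" using Nq by linarith
      \<comment> \<open>At \<open>N * q = 7 / 8\<close> the quotient is 7/15. Below, the exponent 3
        leaves room for \<open>2 * (9 / 8)\<close>.\<close>
      have "1 / 4 \<le> real N * q / (1 + real N * q)" using Nq by (simp add: field_simps)
      also have "\<dots> \<le> 1 - (1 - q) ^ N" by (rule one_minus_power_bounds(1)[OF q])
      finally have "1 / 4 \<le> 1 - (1 - q) ^ N" .
      moreover have "exp (- 3) \<le> exp (- (2 * (real N * q)))" using Nq by simp
      then have "exp (- 3) \<le> (1 - q) ^ N" using power_one_minus_ge[OF q(1) half, of N] by linarith
      ultimately show ?case using eq by (simp add: p_def)
    qed
  qed auto
qed

lemma definable_finite_conj: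
  assumes "finite I" "\<And>i. i \<in> I \<Longrightarrow> definable d N (\<Phi> i)"
  shows "definable d N (\<lambda>S xs. \<forall>i\<in>I. \<Phi> i S xs)"
  using assms
proof (induction I rule: finite_induct)
  case empty
  then show ?case by (simp add: definable_True)
next
  case (insert i I)
  then have "definable d N (\<lambda>S xs. \<Phi> i S xs \<and> (\<forall>i\<in>I. \<Phi> i S xs))"
    by (intro definable_conj) auto
  then show ?case by simp
qed

text \<open>Written as a tuple with pairwise distinct entries, so that the index quantifiers range
  over a fixed finite set and become finite conjunctions.\<close>

definition has_arcs :: "nat \<Rightarrow> 'a set \<Rightarrow> ('a \<Rightarrow> bool) \<Rightarrow> bool" where
  "has_arcs k V N \<longleftrightarrow> (\<exists>ys\<in>tuples k V. (\<forall>i\<in>{..<k}. \<forall>j\<in>{..<k}. i \<noteq> j \<longrightarrow> ys ! i \<noteq> ys ! j) \<and> (\<forall>i\<in>{..<k}. N (ys ! i)))"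

lemma definable_has_arcs: "definable (r + 3) 0 (\<lambda>S xs. \<exists>x\<in>fst S. has_arcs k (fst S) (arc r S x))"
proof -
  have ne: "definable d N (\<lambda>S xs. i \<noteq> j \<longrightarrow> ys xs ! i \<noteq> ys xs ! j)" if "vars_proj N k ys" "i < k" "j < k" for d N ys i j
    by (cases "i = j") (auto intro!: definable_True definable_not definable_eq var_proj_nth that)
  show ?thesis
    unfolding has_arcs_def
    by (intro definable_ex definable_ex_tuples definable_conj definable_finite_conj ne definable_arc
      var_proj_nth[where m = k] vars_proj_take var_proj_hd var_proj_drop) auto
qed

lemma prob_has_arcs_le:
  fixes \<rho> :: real
  assumes V: "finite V" and \<rho>: "0 \<le> \<rho>" "\<rho> \<le> 1" and x: "x \<in> V"
  shows "measure_pmf.prob (rand_digraph V \<rho>) {f. has_arcs k V (\<lambda>y. f (x, y))} \<le> real (card V) ^ k * \<rho> ^ k"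
proof -
  let ?M = "rand_digraph V \<rho>"
  let ?d = "\<lambda>ys. \<forall>i\<in>{..<k}. \<forall>j\<in>{..<k}. i \<noteq> j \<longrightarrow> ys ! i \<noteq> ys ! j"
  have "{f. has_arcs k V (\<lambda>y. f (x, y))} = {f. \<exists>ys\<in>tuples k V. ?d ys \<and> (\<forall>i\<in>{..<k}. f (x, ys ! i))}"
    by (simp add: has_arcs_def)
  also have "measure_pmf.prob ?M \<dots> \<le> real (card V ^ k) * \<rho> ^ k"
  proof (rule prob_union_le)
    fix ys assume ys: "ys \<in> tuples k V"
    then have ysV: "ys ! i \<in> V" if "i < k" for i using that by (auto simp: tuples_def)
    show "measure_pmf.prob ?M {f. ?d ys \<and> (\<forall>i\<in>{..<k}. f (x, ys ! i))} \<le> \<rho> ^ k"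
    proof (cases "?d ys")
      case True
      have "measure_pmf.prob ?M {f. \<forall>i\<in>{..<k}. f (x, ys ! i)} = (\<Prod>i<k. measure_pmf.prob ?M {f. f (x, ys ! i)})"
        by (rule prob_Pi_pmf_blocks[where blk = "\<lambda>i. {(x, ys ! i)}"])
          (use True V x ysV in \<open>auto simp: disjoint_family_on_def\<close>)
      also have "\<dots> = (\<Prod>i<k. \<rho>)"
        by (rule prod.cong[OF refl]) (use V \<rho> x ysV in \<open>auto intro!: prob_Pi_bernoulli_component\<close>)
      finally show ?thesis using True by simp
    next
      case False
      then have empty: "{f. ?d ys \<and> (\<forall>i\<in>{..<k}. f (x, ys ! i))} = {}" by blast
      show ?thesis unfolding empty using \<rho> by simp
    qed
  qed (use V \<rho> in \<open>auto simp: finite_tuples card_tuples\<close>)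
  finally show ?thesis by simp
qed

text \<open>Hitting each of \<open>k\<close> disjoint sets of size \<open>s\<close> exactly once is
  a pattern whose probability is known, and representatives of disjoint sets are automatically
  distinct.\<close>

lemma prob_has_arcs_ge:
  fixes \<rho> :: real
  assumes V: "finite V" and \<rho>: "0 \<le> \<rho>" "\<rho> \<le> 1" "card V * \<rho> \<le> 1 / 2" and x: "x \<in> V" and s: "k * s \<le> card V"
  shows "(s * \<rho>) ^ k / 2 \<le> measure_pmf.prob (rand_digraph V \<rho>) {f. has_arcs k V (\<lambda>y. f (x, y))}"
proof -
  let ?M = "rand_digraph V \<rho>"
  obtain Y :: "nat \<Rightarrow> 'a set" where Y: "\<And>i. i < k \<Longrightarrow> Y i \<subseteq> V \<and> card (Y i) = s" "disjoint_family_on Y {..<k}"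
    using disjoint_subsets[OF V s] by blast
  have "(s * \<rho>) ^ k * (1 / 2) \<le> (s * \<rho>) ^ k * (1 - \<rho>) ^ card V"
    by (intro mult_left_mono one_minus_power_ge_half \<rho>) (use \<rho> in simp)
  also have "\<dots> = (s * \<rho>) ^ card {..<k} * (1 - \<rho>) ^ card V" by simp
  also have "\<dots> \<le> measure_pmf.prob ?M {f. pattern (\<lambda>y. f (x, y)) {} {..<k} Y}"
    by (rule prob_pattern[where V = V]) (use V \<rho> x s Y in \<open>auto simp: inj_on_def\<close>)
  also have "\<dots> \<le> measure_pmf.prob ?M {f. has_arcs k V (\<lambda>y. f (x, y))}"
  proof (rule measure_pmf.finite_measure_mono, rule subsetI)
    fix f assume "f \<in> {f. pattern (\<lambda>y. f (x, y)) {} {..<k} Y}"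
    then have "\<forall>i. \<exists>y. i < k \<longrightarrow> y \<in> Y i \<and> f (x, y)" unfolding pattern_def by blast
    then obtain g where g: "\<And>i. i < k \<Longrightarrow> g i \<in> Y i \<and> f (x, g i)" by metis
    have "map g [0..<k] \<in> tuples k V" using g Y(1) by (force simp: tuples_def)
    moreover have "g i \<noteq> g j" if "i < k" "j < k" "i \<noteq> j" for i j
    proof -
      have "Y i \<inter> Y j = {}" using Y(2) that by (auto simp: disjoint_family_on_def)
      then show ?thesis using g[OF that(1)] g[OF that(2)] by (metis IntI empty_iff)
    qed
    ultimately show "f \<in> {f. has_arcs k V (\<lambda>y. f (x, y))}"
      unfolding has_arcs_def using g by (auto intro!: bexI[of _ "map g [0..<k]"])
  qed simp
  finally show ?thesis by simp
qed

lemma has_arcs_cong: "(\<And>y. y \<in> V \<Longrightarrow> N y = N' y) \<Longrightarrow> has_arcs k V N = has_arcs k V N'"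
proof -
  assume *: "\<And>y. y \<in> V \<Longrightarrow> N y = N' y"
  have "N (ys ! i) = N' (ys ! i)" if "ys \<in> tuples k V" "i < k" for ys i
    using that by (intro *) (auto simp: tuples_def)
  then show ?thesis unfolding has_arcs_def by (intro bex_cong refl) auto
qed

text \<open>For \<open>\<beta> = 1 + 1 / k\<close> the \<open>k\<close>-th power of
  \<open>n powr - \<beta>\<close> is \<open>n powr - (k + 1)\<close>. So a vertex has
  \<open>k\<close> out-neighbours with probability between \<open>c / n\<close> and
  \<open>2 ^ k / n\<close>, and since rows are independent, no such vertex exists with probability
  between \<open>exp (- (2 * 2 ^ k))\<close> and \<open>exp (- c)\<close>.\<close>

lemma not_zero_one_law_many_arcs:
  fixes k :: nat
  assumes k: "k \<ge> 1"
  shows "\<not> fo_zero_one_law (r + 3) (\<lambda>n. rand_struct (r + 3) n (edge_prob r (1 + 1 / real k) n))"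
proof -
  let ?Q = "\<lambda>S :: nat struct. \<exists>x\<in>fst S. has_arcs k (fst S) (arc r S x)"
  obtain \<phi> where \<phi>: "fo_sentence (r + 3) \<phi>" "\<And>S. S \<Turnstile> \<phi> \<longleftrightarrow> ?Q S"
    using definable_sentence[OF definable_has_arcs[of r k]] by metis
  define \<beta> where "\<beta> = 1 + 1 / real k"
  have \<beta>: "\<beta> > 1" using k by (simp add: \<beta>_def)
  then have \<beta>0: "0 < \<beta>" by simp
  \<comment> \<open>Obtained from sets of size at least \<open>n / (2 * k)\<close> and density at
    least half of \<open>n powr - \<beta>\<close>, with the factor 1/2 of
    \<open>prob_has_arcs_ge\<close>.\<close>
  define c where "c = 1 / (2 * (4 * real k) ^ k)"
  have c: "c > 0" using k by (simp add: c_def)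
  show ?thesis
  proof (rule not_zero_one_lawI[OF \<phi>(1)])
    show "0 < 1 - exp (- c)" using c by simp
    show "1 - exp (- (2 * 2 ^ k)) < (1::real)" by simp
    have "\<forall>\<^sub>F n in sequentially. real n * (2 * real n powr - \<beta>) \<le> 1 / 2" using \<beta> by real_asymp
    moreover have "\<forall>\<^sub>F n in sequentially. 2 ^ k / real n \<le> 1 / 2" by real_asymp
    ultimately show "\<forall>\<^sub>F n in sequentially. 1 - exp (- c) \<le> pr_models (rand_struct (r + 3) n (edge_prob r (1 + 1 / real k) n)) \<phi> \<and>
       pr_models (rand_struct (r + 3) n (edge_prob r (1 + 1 / real k) n)) \<phi> \<le> 1 - exp (- (2 * 2 ^ k))"
      using edge_prob_asymp[OF \<beta>0, of r] arc_prob_asymp[OF \<beta>0, of r] eventually_ge_at_top[of "2 * k"]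
      unfolding \<beta>_def[symmetric]
    proof (eventually_elim)
      case (elim n)
      define p where "p = edge_prob r \<beta> n"
      define \<rho> where "\<rho> = arc_prob r n p"
      have n: "0 < n" using elim(5) k by simp
      have p: "0 \<le> p" "p \<le> 1" using elim(3) by (simp_all add: p_def)
      have \<rho>: "0 \<le> \<rho>" "\<rho> \<le> 1" using arc_prob_bounds[OF p] by (auto simp: \<rho>_def)
      have \<rho>b: "1 / 2 * real n powr - \<beta> \<le> \<rho>" "\<rho> \<le> 2 * real n powr - \<beta>"
        using elim(4) by (simp_all add: \<rho>_def p_def)
      let ?G = "rand_digraph {1..n} \<rho>"
      let ?pi = "\<lambda>x. measure_pmf.prob ?G {f. has_arcs k {1..n} (\<lambda>y. f (x, y))}"
      have step: "(real n powr - \<beta>) ^ k = real n powr - (real k + 1)"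
      proof -
        have "(real n powr - \<beta>) ^ k = real n powr (- \<beta> * real k)" using n by (subst powr_power) (simp_all add: mult.commute)
        also have "- \<beta> * real k = - (real k + 1)" using k by (simp add: \<beta>_def field_simps)
        finally show ?thesis .
      qed
      have nk: "real n ^ k * real n powr - (real k + 1) = 1 / real n"
        using n by (simp add: powr_realpow[symmetric] powr_add[symmetric] powr_minus divide_inverse)
      have up: "?pi x \<le> 2 ^ k / real n" if "x \<in> {1..n}" for x
      proof -
        have "?pi x \<le> real n ^ k * \<rho> ^ k" using prob_has_arcs_le[OF _ \<rho> that, of k] by simp
        also have "\<dots> \<le> real n ^ k * (2 * real n powr - \<beta>) ^ k"
          by (intro mult_left_mono power_mono \<rho>b \<rho>) simp
        also have "\<dots> = 2 ^ k * (real n ^ k * real n powr - (real k + 1))" by (simp add: power_mult_distrib step)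
        also have "\<dots> = 2 ^ k / real n" unfolding nk by simp
        finally show ?thesis .
      qed
      have low: "c / real n \<le> ?pi x" if "x \<in> {1..n}" for x
      proof -
        \<comment> \<open>Rounding costs at most a factor 2 because
          \<open>n \<ge> 2 * k\<close>.\<close>
        define s where "s = n div k"
        have ks: "k * s \<le> card {1..n}" by (simp add: s_def)
        have "n = k * s + n mod k" by (simp add: s_def)
        then have "real n = real k * real s + real (n mod k)" by (metis of_nat_add of_nat_mult)
        moreover have "real (n mod k) < real k" using k by simp
        ultimately have "real n \<le> (real s + 1) * real k" by (simp add: algebra_simps)
        then have "real n / real k - 1 \<le> real s"
          using k pos_divide_le_eq[of "real k" "real n" "real s + 1"] by simp
        moreover have "1 \<le> real n / (2 * real k)" using elim(5) k by (simp add: field_simps)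
        moreover have "real n / real k = 2 * (real n / (2 * real k))" by simp
        ultimately have s: "real n / (2 * real k) \<le> real s" by linarith
        have "real n / (2 * real k) * (1 / 2 * real n powr - \<beta>) \<le> real s * \<rho>"
          using s \<rho>b by (intro mult_mono) auto
        then have "(real n / (2 * real k) * (1 / 2 * real n powr - \<beta>)) ^ k / 2 \<le> (real s * \<rho>) ^ k / 2"
          by (intro divide_right_mono power_mono) auto
        also have "\<dots> \<le> ?pi x"
        proof (rule prob_has_arcs_ge[OF _ \<rho> _ that ks])
          have "real n * \<rho> \<le> real n * (2 * real n powr - \<beta>)" by (intro mult_left_mono \<rho>b) simp
          then show "real (card {1..n}) * \<rho> \<le> 1 / 2" using elim(1) by simp
        qed simp
        also have "(real n / (2 * real k) * (1 / 2 * real n powr - \<beta>)) ^ k / 2 = c * (real n ^ k * (real n powr - \<beta>) ^ k)"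
          by (simp add: c_def power_mult_distrib power_divide field_simps)
        also have "\<dots> = c / real n" unfolding step nk by simp
        finally show ?thesis .
      qed
      have blk: "has_arcs k {1..n} (\<lambda>y. f (x, y)) \<longleftrightarrow> has_arcs k {1..n} (\<lambda>y. g (x, y))"
        if "\<forall>z\<in>{x} \<times> {1..n}. f z = g z" for x and f g :: "nat \<times> nat \<Rightarrow> bool"
        by (rule has_arcs_cong) (use that in auto)
      have none: "measure_pmf.prob ?G {f. \<forall>x\<in>{1..n}. \<not> has_arcs k {1..n} (\<lambda>y. f (x, y))} = (\<Prod>x\<in>{1..n}. 1 - ?pi x)"
        by (rule prob_blocks_none[where blk = "\<lambda>x. {x} \<times> {1..n}"]) (use blk in \<open>auto simp: disjoint_rows\<close>)
      have "measure_pmf.prob ?G {f. \<forall>x\<in>{1..n}. \<not> has_arcs k {1..n} (\<lambda>y. f (x, y))} \<le> exp (- (card {1..n} * (c / real n)))"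
        by (rule prob_blocks_none_le[where blk = "\<lambda>x. {x} \<times> {1..n}"]) (use blk low in \<open>auto simp: disjoint_rows\<close>)
      then have G1: "measure_pmf.prob ?G {f. \<not> (\<exists>x\<in>{1..n}. has_arcs k {1..n} (\<lambda>y. f (x, y)))} \<le> exp (- c)"
        using n by simp
      have "exp (- (2 * 2 ^ k)) = exp (- (2 * (real n * (2 ^ k / real n))))" using n by simp
      also have "\<dots> \<le> (1 - 2 ^ k / real n) ^ n"
        by (rule power_one_minus_ge) (use elim(2) in auto)
      also have "\<dots> = (\<Prod>x\<in>{1..n}. 1 - 2 ^ k / real n)" by simp
      also have "\<dots> \<le> (\<Prod>x\<in>{1..n}. 1 - ?pi x)"
      proof (rule prod_mono)
        fix x assume "x \<in> {1..n}"
        then show "0 \<le> 1 - 2 ^ k / real n \<and> 1 - 2 ^ k / real n \<le> 1 - ?pi x"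
          using up[of x] elim(2) by linarith
      qed
      finally have low1: "exp (- (2 * 2 ^ k)) \<le> measure_pmf.prob ?G {f. \<forall>x\<in>{1..n}. \<not> has_arcs k {1..n} (\<lambda>y. f (x, y))}"
        using none by simp
      \<comment> \<open>The double negation matches \<open>prob_arc_property\<close> applied to the
        negated property, which transfers the upper bound as well.\<close>
      have "{f. \<not> \<not> (\<exists>x\<in>{1..n}. has_arcs k {1..n} (\<lambda>y. f (x, y)))} = UNIV - {f. \<forall>x\<in>{1..n}. \<not> has_arcs k {1..n} (\<lambda>y. f (x, y))}"
        by auto
      then have G2: "measure_pmf.prob ?G {f. \<not> \<not> (\<exists>x\<in>{1..n}. has_arcs k {1..n} (\<lambda>y. f (x, y)))} \<le> 1 - exp (- (2 * 2 ^ k))"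
        using low1 measure_pmf.prob_compl[of "{f. \<forall>x\<in>{1..n}. \<not> has_arcs k {1..n} (\<lambda>y. f (x, y))}" ?G] by simp
      have cong: "(\<exists>x\<in>{1..n}. has_arcs k {1..n} (G x)) = (\<exists>x\<in>{1..n}. has_arcs k {1..n} (G' x))"
        if "\<And>x y. x \<in> {1..n} \<Longrightarrow> y \<in> {1..n} \<Longrightarrow> G x y = G' x y" for G G' :: "nat \<Rightarrow> nat \<Rightarrow> bool"
        by (intro bex_cong refl has_arcs_cong that)
      let ?M = "rand_rel (r + 3) {1..n} p"
      have M1: "measure_pmf.prob ?M {f. \<not> (\<exists>x\<in>{1..n}. has_arcs k {1..n} (arc r ({1..n}, f) x))} \<le> exp (- c)"
      proof (rule prob_arc_property[OF _ p, where Q = "\<lambda>G. \<exists>x\<in>{1..n}. has_arcs k {1..n} (G x)"])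
        show "\<exists>x\<in>{1..n}. has_arcs k {1..n} (G' x)"
          if "\<And>x y. x \<in> {1..n} \<Longrightarrow> y \<in> {1..n} \<Longrightarrow> G x y = G' x y" "\<exists>x\<in>{1..n}. has_arcs k {1..n} (G x)" for G G'
          using that(2) by (rule cong[THEN iffD1, rotated]) (rule that(1))
      qed (use G1 in \<open>simp_all add: \<rho>_def\<close>)
      have M2: "measure_pmf.prob ?M {f. \<not> \<not> (\<exists>x\<in>{1..n}. has_arcs k {1..n} (arc r ({1..n}, f) x))} \<le> 1 - exp (- (2 * 2 ^ k))"
      proof (rule prob_arc_property[OF _ p, where Q = "\<lambda>G. \<not> (\<exists>x\<in>{1..n}. has_arcs k {1..n} (G x))"])
        show "\<not> (\<exists>x\<in>{1..n}. has_arcs k {1..n} (G' x))"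
          if "\<And>x y. x \<in> {1..n} \<Longrightarrow> y \<in> {1..n} \<Longrightarrow> G x y = G' x y" "\<not> (\<exists>x\<in>{1..n}. has_arcs k {1..n} (G x))" for G G'
          using that(2) by (rule contrapos_nn) (rule cong[THEN iffD2], rule that(1))
      qed (use G2 in \<open>simp_all add: \<rho>_def\<close>)
      have eq: "pr_models (rand_struct (r + 3) n p) \<phi> = measure_pmf.prob ?M {f. \<exists>x\<in>{1..n}. has_arcs k {1..n} (arc r ({1..n}, f) x)}"
        using pr_models_rand_struct[OF \<phi>(2)] by simp
      have "{f. \<not> (\<exists>x\<in>{1..n}. has_arcs k {1..n} (arc r ({1..n}, f) x))} = UNIV - {f. \<exists>x\<in>{1..n}. has_arcs k {1..n} (arc r ({1..n}, f) x)}"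
        by auto
      then have "1 - exp (- c) \<le> pr_models (rand_struct (r + 3) n p) \<phi>"
        using M1 eq measure_pmf.prob_compl[of "{f. \<exists>x\<in>{1..n}. has_arcs k {1..n} (arc r ({1..n}, f) x)}" ?M] by simp
      then show ?case using M2 eq by (simp add: p_def)
    qed
  qed
qed

theorem theorem9:
  fixes r :: nat
  shows
    "\<not> fo_zero_one_law (r + 2)
        (\<lambda>n. rand_struct (r + 2) n ((real r + 1) * ln (real n) / real n))
   \<and> (\<forall>k::nat. k \<ge> 1 \<longrightarrow>
        \<not> fo_zero_one_law (r + 3)
          (\<lambda>n. rand_struct (r + 3) n ((1 + 1 / real k + real r) * ln (real n) / real n)))
   \<and> (\<forall>\<beta>::real. \<beta> \<in> \<rat> \<longrightarrow> 2 / 3 < \<beta> \<longrightarrow> \<beta> < 1 \<longrightarrow>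
        \<not> totally_bounded (FOC (r + 3)
          (\<lambda>n. rand_struct (r + 3) n ((\<beta> + real r) * ln (real n) / real n))))"
proof (intro conjI allI impI)
  show "\<not> fo_zero_one_law (r + 2) (\<lambda>n. rand_struct (r + 2) n ((real r + 1) * ln (real n) / real n))"
    using not_zero_one_law_isolated_tuple[of r] unfolding edge_prob_def add.commute[of 1 "real r"] .
  show "\<not> fo_zero_one_law (r + 3)
      (\<lambda>n. rand_struct (r + 3) n ((1 + 1 / real k + real r) * ln (real n) / real n))" if "k \<ge> 1" for k
    using not_zero_one_law_many_arcs[OF that, of r] unfolding edge_prob_def .
  show "\<not> totally_bounded (FOC (r + 3) (\<lambda>n. rand_struct (r + 3) n ((\<beta> + real r) * ln (real n) / real n)))"
    if "\<beta> \<in> \<rat>" "2 / 3 < \<beta>" "\<beta> < 1" for \<beta> :: real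
    using not_totally_bounded_FOC[of \<beta> r] that unfolding edge_prob_def by simp
qed

end
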